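(* Let $D$ satisfy (H1), (H2), (H3) as listed in the context. Let $\mathbf{u}_0\in X_1$, let $\mathbf{u}(t)$, $t\ge0$, be the weak solution of the initial-boundary-value problem (P) with initial data $\mathbf{u}_0$, and let $\mathbf{w}=\mathbf{u}-\mathbf{M}(\mathbf{u}_0)$, where $\mathbf{M}(\mathbf{u}_0)=(m(u_0),m(v_0))^T$ and $m(f)=\frac{1}{A(\Omega)}\int_\Omega f(\mathbf{x})\,d\Omega$ with $A(\Omega)$ the area of $\Omega$. If $$T_t(\mathbf{0})=\mathbf{0},\qquad T_t(\mathbf{u}_0+\mathbf{C})=T_t(\mathbf{u}_0)+\mathbf{C},\qquad t\ge0,$$ holds (for all $\mathbf{C}\in\mathbb{R}^2$), then $$\lim_{t\to\infty}\|\mathbf{w}(t)\|_{X_0}=0.$$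
   Context: $\Omega\subset\mathbb{R}^2$ is a bounded (typically rectangular) domain with boundary $\partial\Omega$ and outward normal $n$; $T>0$, $Q_T=\Omega\times(0,T]$, $\overline{Q_T}=\overline\Omega\times[0,T]$. $X_k=H^k(\Omega)\times H^k(\Omega)$, with $H^0(\Omega)=L^2(\Omega)$ and norm $\|\mathbf{u}\|_{X_k}=(\|u\|_k^2+\|v\|_k^2)^{1/2}$, where $\|\cdot\|_k$ is the norm of $H^k(\Omega)$. $J\mathbf{u}$ is the Jacobian matrix of $\mathbf{u}=(u,v)^T$ with respect to the space variables (rows $\nabla u$, $\nabla v$). The cross-diffusion matrix $D=(D_{ij})_{i,j=1,2}$ assigns to $\mathbf{u}:\overline{Q_T}\to\mathbb{R}^2$ the matrix-valued function $D(\mathbf{u})(\mathbf{x},t)=D(\mathbf{u}(\mathbf{x},t))\in M_{2\times2}(\mathbb{R})$. The hypotheses on $D$ are: (H1) there is $\alpha>0$ such that for each $\mathbf{u}:\overline{Q_T}\to\mathbb{R}^2$, $\xi^TD(\mathbf{u}(\mathbf{x},t))\xi\ge\alpha|\xi|^2$ for all $\xi\in\mathbb{R}^2$, $(\mathbf{x},t)\in\overline{Q_T}$; (H2) there is $L>0$ such that for all $\mathbf{u},\mathbf{v}:\overline{Q_T}\to\mathbb{R}^2$, $(\mathbf{x},t)\in\overline{Q_T}$, $i,j=1,2$, $|D_{ij}(\mathbf{v}(\mathbf{x},t))-D_{ij}(\mathbf{u}(\mathbf{x},t))|\le L|\mathbf{v}(\mathbf{x},t)-\mathbf{u}(\mathbf{x},t)|$;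 (H3) there is $M>0$ such that for each $\mathbf{u}:\overline{Q_T}\to\mathbb{R}^2$, $|D_{ij}(\mathbf{u}(\mathbf{x},t))|\le M$ for all $(\mathbf{x},t)\in\overline{Q_T}$, $i,j=1,2$. Problem (P), for $\mathbf{u}=(u,v)^T$ and $\mathbf{u}_0=(u_0,v_0)^T$: $$\partial_t u=\mathrm{div}(D_{11}(\mathbf{u})\nabla u+D_{12}(\mathbf{u})\nabla v),\quad \partial_t v=\mathrm{div}(D_{21}(\mathbf{u})\nabla u+D_{22}(\mathbf{u})\nabla v)\quad\text{in }Q_T,$$ with $u(\mathbf{x},0)=u_0(\mathbf{x})$, $v(\mathbf{x},0)=v_0(\mathbf{x})$ for $\mathbf{x}\in\Omega$, and on $\partial\Omega\times[0,T]$: $\langle D_{11}(\mathbf{u})\nabla u+D_{12}(\mathbf{u})\nabla v,n\rangle=0$, $\langle D_{21}(\mathbf{u})\nabla u+D_{22}(\mathbf{u})\nabla v,n\rangle=0$. A weak solution of (P) is $\mathbf{u}=(u,v)^T\in C(0,T,X_0)\cap L^2(0,T,X_1)$, with $\mathbf{u}(0)=\mathbf{u}_0$, such that for any $t\in(0,T]$ $$\int_\Omega\left((\partial_tu)w_1+(\partial_tv)w_2\right)d\Omega+\int_\Omega\mathrm{tr}\left((J\mathbf{w})^TD(\mathbf{u})(J\mathbf{u})\right)d\Omega=0\quad\text{for all }\mathbf{w}=(w_1,w_2)^T\in X_1,$$ where $\mathrm{tr}$ is the trace and the integral of a product of an element of $(H^1(\Omega))'$ and one of $H^1(\Omega)$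 is understood as the duality pairing. Under (H1)-(H3), for $\mathbf{u}_0\in X_1$ the weak solution exists and is unique for every $T>0$. Scale-space operator: for $t\ge0$, $T_t(\mathbf{u}_0):=\mathbf{u}(t)=\mathbf{u}(\cdot,t)$, where $\mathbf{u}$ is the unique weak solution of (P) with initial data $\mathbf{u}_0$ ($T$ being arbitrary). Vectors in $\mathbb{R}^2$ are identified with constant functions on $\Omega$. *)

theory Defs
  imports "HOL-Analysis.Analysis"
begin

text \<open>
  Elements of Lebesgue and Sobolev spaces on \<open>\<Omega>\<close> are represented by functions on the whole plane,
  of which only the values almost everywhere on \<open>\<Omega>\<close> matter; equality in these spaces is equality
  almost everywhere. A pair \<open>(u, v)\<close> of scalar functions is a function into \<open>real^2\<close>.
\<close>

text \<open>
  The domain: bounded, open, connected, and locally below the graph of a Lipschitz function in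
  suitable orthonormal coordinates, so that an outward unit normal exists almost everywhere on the
  boundary. Rectangles are included (at a corner, take the second axis along the diagonal).
\<close>

definition lipschitz_domain :: "(real^2) set \<Rightarrow> bool" where
  "lipschitz_domain \<Omega> \<longleftrightarrow>
     open \<Omega> \<and> connected \<Omega> \<and> bounded \<Omega> \<and> \<Omega> \<noteq> {} \<and>
     (\<forall>p\<in>frontier \<Omega>. \<exists>e1 e2 r h \<phi> L.
        norm e1 = 1 \<and> norm e2 = 1 \<and> e1 \<bullet> e2 = 0 \<and> r > 0 \<and> h > 0 \<and>
        L-lipschitz_on UNIV (\<phi> :: real \<Rightarrow> real) \<and>
        (\<forall>s y. \<bar>s\<bar> < r \<longrightarrow> \<bar>y\<bar> < h \<longrightarrow>
           (p + s *\<^sub>R e1 + y *\<^sub>R e2 \<in> \<Omega> \<longleftrightarrow> y < \<phi> s)))"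


subsection \<open>Lebesgue and Sobolev spaces\<close>

definition L2 :: "(real^2) set \<Rightarrow> (real^2 \<Rightarrow> real) set" where
  "L2 \<Omega> = {f. f \<in> borel_measurable (lebesgue_on \<Omega>) \<and> integrable (lebesgue_on \<Omega>) (\<lambda>x. (f x)\<^sup>2)}"

definition norm_L2 :: "(real^2) set \<Rightarrow> (real^2 \<Rightarrow> real) \<Rightarrow> real" where
  "norm_L2 \<Omega> f = sqrt (LINT x|lebesgue_on \<Omega>. (f x)\<^sup>2)"

text \<open>\<open>\<phi>\<close> is continuously differentiable with gradient \<open>\<phi>'\<close> and compactly supported in \<open>S\<close>.
  Weak derivatives are the same whether tested with such functions or with smooth ones.\<close>

definition test_function ::
    "'a::euclidean_space set \<Rightarrow> ('a \<Rightarrow> real) \<Rightarrow> ('a \<Rightarrow> 'a) \<Rightarrow> bool" where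
  "test_function S \<phi> \<phi>' \<longleftrightarrow>
     (\<forall>x. GDERIV \<phi> x :> \<phi>' x) \<and> continuous_on UNIV \<phi>' \<and>
     (\<exists>K. compact K \<and> K \<subseteq> S \<and> (\<forall>x. x \<notin> K \<longrightarrow> \<phi> x = 0))"

definition weak_gradient ::
    "(real^2) set \<Rightarrow> (real^2 \<Rightarrow> real) \<Rightarrow> (real^2 \<Rightarrow> real^2) \<Rightarrow> bool" where
  "weak_gradient \<Omega> f g \<longleftrightarrow>
     (\<forall>i. (\<lambda>x. g x $ i) \<in> L2 \<Omega>) \<and>
     (\<forall>\<phi> \<phi>'. test_function \<Omega> \<phi> \<phi>' \<longrightarrow>
        (\<forall>i. (LINT x|lebesgue_on \<Omega>. f x * \<phi>' x $ i) = - (LINT x|lebesgue_on \<Omega>. g x $ i * \<phi> x)))"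

definition H1 :: "(real^2) set \<Rightarrow> (real^2 \<Rightarrow> real) set" where
  "H1 \<Omega> = {f \<in> L2 \<Omega>. \<exists>g. weak_gradient \<Omega> f g}"

text \<open>For \<open>f \<in> H1 \<Omega>\<close> this is determined up to a null set.\<close>

definition grad :: "(real^2) set \<Rightarrow> (real^2 \<Rightarrow> real) \<Rightarrow> real^2 \<Rightarrow> real^2" where
  "grad \<Omega> f = (SOME g. weak_gradient \<Omega> f g)"

definition norm_H1 :: "(real^2) set \<Rightarrow> (real^2 \<Rightarrow> real) \<Rightarrow> real" where
  "norm_H1 \<Omega> f = sqrt ((norm_L2 \<Omega> f)\<^sup>2 + (LINT x|lebesgue_on \<Omega>. (norm (grad \<Omega> f x))\<^sup>2))"

definition X0 :: "(real^2) set \<Rightarrow> (real^2 \<Rightarrow> real^2) set" where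
  "X0 \<Omega> = {u. \<forall>i. (\<lambda>x. u x $ i) \<in> L2 \<Omega>}"

definition norm_X0 :: "(real^2) set \<Rightarrow> (real^2 \<Rightarrow> real^2) \<Rightarrow> real" where
  "norm_X0 \<Omega> u = sqrt ((norm_L2 \<Omega> (\<lambda>x. u x $ 1))\<^sup>2 + (norm_L2 \<Omega> (\<lambda>x. u x $ 2))\<^sup>2)"

definition X1 :: "(real^2) set \<Rightarrow> (real^2 \<Rightarrow> real^2) set" where
  "X1 \<Omega> = {u. \<forall>i. (\<lambda>x. u x $ i) \<in> H1 \<Omega>}"

definition norm_X1 :: "(real^2) set \<Rightarrow> (real^2 \<Rightarrow> real^2) \<Rightarrow> real" where
  "norm_X1 \<Omega> u = sqrt ((norm_H1 \<Omega> (\<lambda>x. u x $ 1))\<^sup>2 + (norm_H1 \<Omega> (\<lambda>x. u x $ 2))\<^sup>2)"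

definition jacobian :: "(real^2) set \<Rightarrow> (real^2 \<Rightarrow> real^2) \<Rightarrow> real^2 \<Rightarrow> real^2^2" where
  "jacobian \<Omega> u x = (\<chi> i. grad \<Omega> (\<lambda>y. u y $ i) x)"

text \<open>The dual of \<open>H1 \<Omega>\<close>; only the values of a functional on \<open>H1 \<Omega>\<close> matter.\<close>

definition H1_dual :: "(real^2) set \<Rightarrow> ((real^2 \<Rightarrow> real) \<Rightarrow> real) set" where
  "H1_dual \<Omega> = {F.
     (\<forall>f\<in>H1 \<Omega>. \<forall>g\<in>H1 \<Omega>. F (\<lambda>x. f x + g x) = F f + F g) \<and>
     (\<forall>c. \<forall>f\<in>H1 \<Omega>. F (\<lambda>x. c * f x) = c * F f) \<and>
     (\<exists>K. \<forall>f\<in>H1 \<Omega>. \<bar>F f\<bar> \<le> K * norm_H1 \<Omega> f)}"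

definition norm_H1_dual :: "(real^2) set \<Rightarrow> ((real^2 \<Rightarrow> real) \<Rightarrow> real) \<Rightarrow> real" where
  "norm_H1_dual \<Omega> F = (SUP f\<in>{f \<in> H1 \<Omega>. norm_H1 \<Omega> f \<le> 1}. \<bar>F f\<bar>)"


subsection \<open>Vector-valued functions of time\<close>

definition cont_X0 :: "(real^2) set \<Rightarrow> real \<Rightarrow> (real \<Rightarrow> real^2 \<Rightarrow> real^2) \<Rightarrow> bool" where
  "cont_X0 \<Omega> T u \<longleftrightarrow>
     (\<forall>t\<in>{0..T}. u t \<in> X0 \<Omega>) \<and>
     (\<forall>t\<in>{0..T}. ((\<lambda>s. norm_X0 \<Omega> (u s - u t)) \<longlongrightarrow> 0) (at t within {0..T}))"

text \<open>The Bochner space \<open>L\<^sup>2(0,T,V)\<close> for a space of functions \<open>V\<close> with norm \<open>N\<close>: almost everywhere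
  limits of simple functions (strong measurability) with square-integrable norm. The subtraction
  is that of the function space. The library's Bochner integral is not applicable since \<open>V\<close>
  is not a type.\<close>

definition L2_bochner :: "real \<Rightarrow> 'b::minus set \<Rightarrow> ('b \<Rightarrow> real) \<Rightarrow> (real \<Rightarrow> 'b) \<Rightarrow> bool" where
  "L2_bochner T V N f \<longleftrightarrow>
     (\<exists>s. (\<forall>n. simple_function (lebesgue_on {0..T}) (s n) \<and> (\<forall>t\<in>{0..T}. s n t \<in> V)) \<and>
          (AE t in lebesgue_on {0..T}. f t \<in> V \<and> (\<lambda>n. N (s n t - f t)) \<longlonglongrightarrow> 0)) \<and>
     integrable (lebesgue_on {0..T}) (\<lambda>t. (N (f t))\<^sup>2)"

text \<open>\<open>f'\<close>, with values in the dual of \<open>H1 \<Omega>\<close>, is the distributional time derivative of \<open>f\<close> on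
  \<open>(0,T)\<close>, where an \<open>L\<^sup>2\<close> function is identified with the functional given by its
  \<open>L\<^sup>2\<close> inner product.\<close>

definition time_derivative ::
    "(real^2) set \<Rightarrow> real \<Rightarrow> (real \<Rightarrow> real^2 \<Rightarrow> real) \<Rightarrow>
     (real \<Rightarrow> (real^2 \<Rightarrow> real) \<Rightarrow> real) \<Rightarrow> bool" where
  "time_derivative \<Omega> T f f' \<longleftrightarrow>
     L2_bochner T (H1_dual \<Omega>) (norm_H1_dual \<Omega>) f' \<and>
     (\<forall>w\<in>H1 \<Omega>. \<forall>\<psi> \<psi>'. test_function {0<..<T} \<psi> \<psi>' \<longrightarrow>
        (LINT t|lebesgue_on {0..T}. \<psi>' t * (LINT x|lebesgue_on \<Omega>. f t x * w x)) =
        - (LINT t|lebesgue_on {0..T}. \<psi> t * f' t w))"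


subsection \<open>The cross-diffusion problem\<close>

definition uniformly_elliptic ::
    "(real^2) set \<Rightarrow> real \<Rightarrow> (real^2 \<Rightarrow> real^2^2) \<Rightarrow> bool" where
  "uniformly_elliptic \<Omega> T D \<longleftrightarrow>
     (\<exists>\<alpha>>0. \<forall>u :: real \<Rightarrow> real^2 \<Rightarrow> real^2. \<forall>\<xi>. \<forall>x\<in>closure \<Omega>. \<forall>t\<in>{0..T}.
        \<xi> \<bullet> (D (u t x) *v \<xi>) \<ge> \<alpha> * (norm \<xi>)\<^sup>2)"

definition lipschitz_coefficients ::
    "(real^2) set \<Rightarrow> real \<Rightarrow> (real^2 \<Rightarrow> real^2^2) \<Rightarrow> bool" where
  "lipschitz_coefficients \<Omega> T D \<longleftrightarrow>
     (\<exists>L>0. \<forall>(u :: real \<Rightarrow> real^2 \<Rightarrow> real^2) v. \<forall>x\<in>closure \<Omega>. \<forall>t\<in>{0..T}. \<forall>i j.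
        \<bar>D (v t x) $ i $ j - D (u t x) $ i $ j\<bar> \<le> L * norm (v t x - u t x))"

definition bounded_coefficients ::
    "(real^2) set \<Rightarrow> real \<Rightarrow> (real^2 \<Rightarrow> real^2^2) \<Rightarrow> bool" where
  "bounded_coefficients \<Omega> T D \<longleftrightarrow>
     (\<exists>M>0. \<forall>u :: real \<Rightarrow> real^2 \<Rightarrow> real^2. \<forall>x\<in>closure \<Omega>. \<forall>t\<in>{0..T}. \<forall>i j.
        \<bar>D (u t x) $ i $ j\<bar> \<le> M)"

text \<open>An element of \<open>L\<^sup>2(0,T,X1)\<close> and its time derivative are only determined for almost every
  time, so the variational equation is imposed for almost every \<open>t\<close>.\<close>

definition weak_solution ::
    "(real^2) set \<Rightarrow> (real^2 \<Rightarrow> real^2^2) \<Rightarrow> real \<Rightarrow> (real^2 \<Rightarrow> real^2) \<Rightarrow>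
     (real \<Rightarrow> real^2 \<Rightarrow> real^2) \<Rightarrow> bool" where
  "weak_solution \<Omega> D T u0 u \<longleftrightarrow>
     cont_X0 \<Omega> T u \<and> L2_bochner T (X1 \<Omega>) (norm_X1 \<Omega>) u \<and>
     (AE x in lebesgue_on \<Omega>. u 0 x = u0 x) \<and>
     (\<exists>ut vt.
        time_derivative \<Omega> T (\<lambda>t x. u t x $ 1) ut \<and>
        time_derivative \<Omega> T (\<lambda>t x. u t x $ 2) vt \<and>
        (AE t in lebesgue_on {0..T}. \<forall>w\<in>X1 \<Omega>.
           ut t (\<lambda>x. w x $ 1) + vt t (\<lambda>x. w x $ 2) +
           (LINT x|lebesgue_on \<Omega>.
              trace (transpose (jacobian \<Omega> w x) ** D (u t x) ** jacobian \<Omega> (u t) x)) = 0))"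

definition global_weak_solution ::
    "(real^2) set \<Rightarrow> (real^2 \<Rightarrow> real^2^2) \<Rightarrow> (real^2 \<Rightarrow> real^2) \<Rightarrow>
     (real \<Rightarrow> real^2 \<Rightarrow> real^2) \<Rightarrow> bool" where
  "global_weak_solution \<Omega> D u0 u \<longleftrightarrow> (\<forall>T>0. weak_solution \<Omega> D T u0 u)"

text \<open>The scale-space operator. Uniqueness of weak solutions means equality almost everywhere on
  \<open>\<Omega>\<close> at each \<open>t \<ge> 0\<close>, hence the choice of a representative.\<close>

definition scale_space ::
    "(real^2) set \<Rightarrow> (real^2 \<Rightarrow> real^2^2) \<Rightarrow> real \<Rightarrow> (real^2 \<Rightarrow> real^2) \<Rightarrow> real^2 \<Rightarrow> real^2" where
  "scale_space \<Omega> D t u0 = (SOME u. global_weak_solution \<Omega> D u0 u) t"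

definition mean :: "(real^2) set \<Rightarrow> (real^2 \<Rightarrow> real) \<Rightarrow> real" where
  "mean \<Omega> f = 1 / measure lebesgue \<Omega> * (LINT x|lebesgue_on \<Omega>. f x)"

definition mean_vec :: "(real^2) set \<Rightarrow> (real^2 \<Rightarrow> real^2) \<Rightarrow> real^2" where
  "mean_vec \<Omega> u = (\<chi> i. mean \<Omega> (\<lambda>x. u x $ i))"

end

theory Submission imports Defs
begin

text \<open>
  Testing the equation with constants shows that the mean is conserved; testing it with the solution
  itself gives, by ellipticity and the Poincare inequality,
  \<open>\<psi> b - \<psi> a \<le> - \<kappa> \<integral>\<^sub>a\<^sup>b \<psi>\<close> for the squared distance \<open>\<psi>\<close> from the mean. As \<open>\<psi>\<close> is then
  nonincreasing, \<open>\<psi> b (1 + \<kappa> (b - a)) \<le> \<psi> a\<close>, so that \<open>\<psi>\<close> tends to 0.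

  The Poincare inequality needs no compactness theorem. It holds on convex sets by integrating the
  translation estimate \<open>\<parallel>f(\<sqdot> + h) - f\<parallel> \<le> \<bar>h\<bar> \<parallel>\<nabla>f\<parallel>\<close> over \<open>h\<close>; it passes from a set to a translate of it
  inside the domain, which reaches the boundary, where the domain lies below a graph; and it passes to
  the union of two overlapping open sets, hence to the connected domain.

  The energy inequality uses only \<open>\<parallel>u t\<parallel>\<^sup>2 - \<parallel>u r\<parallel>\<^sup>2 \<le> 2 \<langle>u t - u r, u t\<rangle>\<close>, averaged over \<open>t\<close> with
  \<open>r = t - h\<close>, where the test function \<open>u t\<close> is approximated by a simple function of \<open>t\<close>.
\<close>

section \<open>The du Bois-Reymond lemma\<close>

text \<open>The time derivative of a weak solution lives only in the dual of \<open>H1\<close>, so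
  the energy balance is not a pointwise chain rule: the solution cannot be inserted as a test
  function into an identity that is distributional in time. The convexity inequality circumvents
  this because it keeps \<open>u t\<close> frozen while it is paired with two values of
  \<open>u\<close>. With a simple function in place of \<open>u t\<close> only finitely many fixed
  test functions remain; for each of them the pairing is a real function with square-integrable
  derivative, whose difference quotients converge weakly. The approximation errors are controlled by
  a bound on the time derivative that is uniform in the test function, and the weak equation
  provides it.

  The Poincare inequality is carried with a free constant instead of the mean. This form survives
  translation and gluing; the mean returns at the end as the minimizer of the quadratic deviation.
  Constants are crude, because any positive decay rate yields the limit.\<close>

definition smoothstep :: "real \<Rightarrow> real" where
  "smoothstep x = 2 * (max 0 x)\<^sup>2 - 4 * (max 0 (x - 1/2))\<^sup>2 + 2 * (max 0 (x - 1))\<^sup>2"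

text \<open>The derivative of \<open>smoothstep\<close>: a hat on [0,1] of height 2 and mass 1.
  Writing both with positive parts makes continuity immediate and reduces differentiation to the
  square of the positive part. \<open>smoothstep\<close> is only continuously differentiable, which
  is all that \<open>test_function\<close> asks for.\<close>

definition tent :: "real \<Rightarrow> real" where
  "tent x = 4 * max 0 x - 8 * max 0 (x - 1/2) + 4 * max 0 (x - 1)"

lemma DERIV_max_0_power2: "((\<lambda>x. (max 0 x)\<^sup>2) has_real_derivative 2 * max 0 x) (at x)"
proof -
  consider "x < 0" | "x = 0" | "x > 0" by linarith
  then show ?thesis
  proof cases
    case 1
    show ?thesis
      by (rule has_field_derivative_transform_within_open[where f = "\<lambda>_. 0" and S = "{..<0}"])
         (use 1 in auto)
  next
    case 2
    have "((\<lambda>h. (max 0 (0 + h))\<^sup>2 / h) \<longlongrightarrow> 0) (at (0::real))"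
    proof (rule Lim_null_comparison)
      show "\<forall>\<^sub>F h in at (0::real). norm ((max 0 (0 + h))\<^sup>2 / h) \<le> \<bar>h\<bar>"
        by (auto simp: max_def power2_eq_square intro!: always_eventually)
      show "((\<lambda>h::real. \<bar>h\<bar>) \<longlongrightarrow> 0) (at 0)"
        by (rule tendsto_eq_intros | simp)+
    qed
    then show ?thesis using 2 by (simp add: DERIV_def)
  next
    case 3
    show ?thesis
      by (rule has_field_derivative_transform_within_open[where f = "\<lambda>x. x\<^sup>2" and S = "{0<..}"])
         (use 3 in \<open>auto intro!: derivative_eq_intros\<close>)
  qed
qed

lemma DERIV_smoothstep: "(smoothstep has_real_derivative tent x) (at x)"
proof -
  have *: "((\<lambda>x. (max 0 (x - c))\<^sup>2) has_real_derivative 2 * max 0 (x - c)) (at x)" for c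
    using DERIV_chain2[OF DERIV_max_0_power2, of "\<lambda>x. x - c" 1 x UNIV]
    by (simp add: DERIV_diff[OF DERIV_ident DERIV_const, simplified])
  show ?thesis
    unfolding smoothstep_def[abs_def] tent_def
    by (rule derivative_eq_intros DERIV_max_0_power2 * refl | simp)+
qed

lemmas DERIV_smoothstep_compose [derivative_intros] = DERIV_smoothstep[THEN DERIV_chain2]

lemma continuous_on_tent [continuous_intros]:
  "continuous_on S f \<Longrightarrow> continuous_on S (\<lambda>x. tent (f x))"
  unfolding tent_def by (intro continuous_intros)

lemma continuous_on_smoothstep [continuous_intros]:
  "continuous_on S f \<Longrightarrow> continuous_on S (\<lambda>x. smoothstep (f x))"
  unfolding smoothstep_def by (intro continuous_intros)

lemma tent_nonneg: "tent x \<ge> 0"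
  unfolding tent_def by (auto simp: max_def)

lemma tent_eq_0: "x \<le> 0 \<or> x \<ge> 1 \<Longrightarrow> tent x = 0"
  unfolding tent_def by (auto simp: max_def)

lemma smoothstep_eq_0: "x \<le> 0 \<Longrightarrow> smoothstep x = 0"
  unfolding smoothstep_def by (auto simp: max_def)

lemma smoothstep_eq_1: "x \<ge> 1 \<Longrightarrow> smoothstep x = 1"
  unfolding smoothstep_def by (auto simp: max_def power2_eq_square algebra_simps)

lemma smoothstep_mono: "x \<le> y \<Longrightarrow> smoothstep x \<le> smoothstep y"
  by (rule DERIV_nonneg_imp_nondecreasing) (use DERIV_smoothstep tent_nonneg in blast)+

lemma smoothstep_bounds: "0 \<le> smoothstep x" "smoothstep x \<le> 1"
  using smoothstep_mono[of "min x 0" x] smoothstep_mono[of x "max x 1"]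
  by (auto simp: smoothstep_eq_0 smoothstep_eq_1)

text \<open>A plateau on [a,b] with ramps of width 1/n. The product form keeps the values in [0,1]
  even while the two ramps overlap, which gives a dominating function for every n; once they no
  longer overlap, the derivative is a difference of two scaled hats.\<close>

definition bump :: "real \<Rightarrow> real \<Rightarrow> real \<Rightarrow> real \<Rightarrow> real" where
  "bump n a b x = smoothstep (n * (x - a)) * smoothstep (n * (b - x))"

definition bump_deriv :: "real \<Rightarrow> real \<Rightarrow> real \<Rightarrow> real \<Rightarrow> real" where
  "bump_deriv n a b x = n * tent (n * (x - a)) * smoothstep (n * (b - x))
     - n * smoothstep (n * (x - a)) * tent (n * (b - x))"

lemma DERIV_bump: "(bump n a b has_real_derivative bump_deriv n a b x) (at x)"
  unfolding bump_def[abs_def] bump_deriv_def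
  by (auto intro!: derivative_eq_intros simp: algebra_simps)

lemma bump_bounds: "0 \<le> bump n a b x" "bump n a b x \<le> 1"
  unfolding bump_def using smoothstep_bounds by (auto intro: mult_le_one)

lemma continuous_on_bump [continuous_intros]:
  "continuous_on S f \<Longrightarrow> continuous_on S (\<lambda>x. bump n a b (f x))"
  "continuous_on S f \<Longrightarrow> continuous_on S (\<lambda>x. bump_deriv n a b (f x))"
  unfolding bump_def bump_deriv_def by (intro continuous_intros; assumption)+

lemma bump_eq_0:
  assumes "n \<ge> 0" "x \<le> a \<or> b \<le> x"
  shows "bump n a b x = 0"
  using assms unfolding bump_def
  by (auto simp: smoothstep_eq_0 mult_le_0_iff)

lemma bump_tendsto: "(\<lambda>n. bump (real n) a b x) \<longlonglongrightarrow> indicator {a<..<b} x"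
proof (cases "a < x \<and> x < b")
  case True
  have "\<forall>\<^sub>F n in sequentially. bump (real n) a b x = 1"
  proof -
    have "\<forall>\<^sub>F n in sequentially. real n \<ge> max (1 / (x - a)) (1 / (b - x))"
      using filterlim_real_sequentially by (rule filterlim_at_top[THEN iffD1, rule_format])
    then show ?thesis
    proof eventually_elim
      case (elim n)
      then have "real n * (x - a) \<ge> 1" "real n * (b - x) \<ge> 1"
        using True by (auto simp: field_simps)
      then show ?case by (simp add: bump_def smoothstep_eq_1)
    qed
  qed
  then show ?thesis using True by (simp add: tendsto_eventually)
next
  case False
  then show ?thesis by (auto simp: bump_eq_0)
qed

text \<open>Products of one-dimensional bumps give explicit test functions that approximate the
  indicator of a box. The one-dimensional case is used again for test functions of time.\<close>

lemma test_function_bump: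
  fixes a b :: "'a::euclidean_space"
  assumes "n \<ge> 0" and "cbox a b \<subseteq> S"
  shows "test_function S (\<lambda>x. \<Prod>i\<in>Basis. bump n (a \<bullet> i) (b \<bullet> i) (x \<bullet> i))
    (\<lambda>x. \<Sum>i\<in>Basis. (bump_deriv n (a \<bullet> i) (b \<bullet> i) (x \<bullet> i) *
        (\<Prod>j\<in>Basis - {i}. bump n (a \<bullet> j) (b \<bullet> j) (x \<bullet> j))) *\<^sub>R i)"
  unfolding test_function_def
proof (intro conjI allI exI[of _ "cbox a b"] impI)
  fix x :: 'a
  have "((\<lambda>x. \<Prod>i\<in>Basis. bump n (a \<bullet> i) (b \<bullet> i) (x \<bullet> i)) has_derivative
     (\<lambda>y. \<Sum>i\<in>Basis. (bump_deriv n (a \<bullet> i) (b \<bullet> i) (x \<bullet> i) * (y \<bullet> i)) *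
        (\<Prod>j\<in>Basis - {i}. bump n (a \<bullet> j) (b \<bullet> j) (x \<bullet> j)))) (at x)"
  proof (rule has_derivative_prod)
    fix i :: 'a
    show "((\<lambda>x. bump n (a \<bullet> i) (b \<bullet> i) (x \<bullet> i)) has_derivative
       (\<lambda>y. bump_deriv n (a \<bullet> i) (b \<bullet> i) (x \<bullet> i) * (y \<bullet> i))) (at x)"
      by (rule has_derivative_compose[OF _ DERIV_bump[unfolded has_field_derivative_def]])
         (auto intro!: derivative_eq_intros)
  qed
  then show "GDERIV (\<lambda>x. \<Prod>i\<in>Basis. bump n (a \<bullet> i) (b \<bullet> i) (x \<bullet> i)) x :>
    (\<Sum>i\<in>Basis. (bump_deriv n (a \<bullet> i) (b \<bullet> i) (x \<bullet> i) *
        (\<Prod>j\<in>Basis - {i}. bump n (a \<bullet> j) (b \<bullet> j) (x \<bullet> j))) *\<^sub>R i)"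
    by (simp add: gderiv_def inner_sum_right mult_ac)
next
  fix x assume "x \<notin> cbox a b"
  then obtain i where "i \<in> Basis" "x \<bullet> i \<le> a \<bullet> i \<or> b \<bullet> i \<le> x \<bullet> i"
    by (auto simp: mem_box not_le intro: less_imp_le)
  then have "bump n (a \<bullet> i) (b \<bullet> i) (x \<bullet> i) = 0"
    using bump_eq_0 assms by blast
  with \<open>i \<in> Basis\<close> show "(\<Prod>i\<in>Basis. bump n (a \<bullet> i) (b \<bullet> i) (x \<bullet> i)) = 0"
    by auto
qed (use assms in \<open>auto intro!: continuous_intros\<close>)

lemma test_function_bump_real:
  assumes "n \<ge> 0" and "{a..b} \<subseteq> S"
  shows "test_function S (bump n a b) (bump_deriv n a b)"
  using test_function_bump[of n a b S] assms by (simp add: cbox_interval)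

text \<open>Off its compact support the function is locally zero, so uniqueness of derivatives makes
  the gradient vanish there too; on the support everything is bounded by continuity.\<close>

lemma test_function_bounded:
  assumes "test_function S \<phi> \<phi>'"
  obtains B where "\<And>x. \<bar>\<phi> x\<bar> \<le> B" "\<And>x. norm (\<phi>' x) \<le> B" "B \<ge> 0"
    and "continuous_on UNIV \<phi>" "continuous_on UNIV \<phi>'" "\<And>x. x \<notin> S \<Longrightarrow> \<phi> x = 0" "\<And>x. x \<notin> S \<Longrightarrow> \<phi>' x = 0"
proof -
  obtain K where K: "compact K" "K \<subseteq> S" "\<And>x. x \<notin> K \<Longrightarrow> \<phi> x = 0"
    and D: "\<And>x. (\<phi> has_derivative (\<lambda>h. h \<bullet> \<phi>' x)) (at x)" and c': "continuous_on UNIV \<phi>'"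
    using assms unfolding test_function_def gderiv_def by blast
  have c: "continuous_on UNIV \<phi>"
    using D by (auto intro!: continuous_at_imp_continuous_on has_derivative_continuous)
  have K': "\<phi>' x = 0" if "x \<notin> K" for x
  proof -
    have "(\<phi> has_derivative (\<lambda>h. 0)) (at x)"
    proof (rule has_derivative_transform_within_open[of "\<lambda>_. 0" _ _ _ "- K"])
      show "open (- K)" using K(1) by (simp add: compact_imp_closed open_Compl)
    qed (use that K in auto)
    with D[of x] have "(\<lambda>h. h \<bullet> \<phi>' x) = (\<lambda>h. 0)" by (rule has_derivative_unique)
    then show ?thesis by (metis inner_eq_zero_iff)
  qed
  have "compact (\<phi> ` K)" "compact (\<phi>' ` K)"
    using K(1) c c' by (auto intro!: compact_continuous_image intro: continuous_on_subset)
  then obtain B1 B2 where "\<And>x. x \<in> K \<Longrightarrow> norm (\<phi> x) \<le> B1" "\<And>x. x \<in> K \<Longrightarrow> norm (\<phi>' x) \<le> B2"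
    by (metis bounded_iff compact_imp_bounded imageI)
  note B = this
  show ?thesis
  proof (rule that[of "max 0 (max B1 B2)"])
    show "\<bar>\<phi> x\<bar> \<le> max 0 (max B1 B2)" for x
      using B(1)[of x] K(3)[of x] by (cases "x \<in> K") auto
    show "norm (\<phi>' x) \<le> max 0 (max B1 B2)" for x
      using B(2)[of x] K'[of x] by (cases "x \<in> K") auto
    show "\<phi> x = 0" "\<phi>' x = 0" if "x \<notin> S" for x
      using that K K' by auto
  qed (use c c' in auto)
qed

text \<open>Bumps converge boundedly to the indicator of an open box, so \<open>k\<close> has
  integral 0 over each box whose closure lies in \<open>V\<close>. Boxes are stable under
  intersection and generate the Borel sets, so inside one such box the integral vanishes over every
  Borel set and \<open>k\<close> is 0 almost everywhere. Countably many closed boxes exhaust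
  \<open>V\<close>.\<close>

lemma du_bois_reymond:
  fixes k :: "'a::euclidean_space \<Rightarrow> real"
  assumes V: "open V" and k: "integrable lborel k"
    and test: "\<And>\<phi> \<phi>'. test_function V \<phi> \<phi>' \<Longrightarrow> (LINT x|lborel. k x * \<phi> x) = 0"
  shows "AE x in lborel. x \<in> V \<longrightarrow> k x = 0"
proof -
  have km [measurable]: "k \<in> borel_measurable borel"
    using borel_measurable_integrable[OF k] by simp
  have box: "(LINT x|lborel. k x * indicator (box a b) x) = 0" if "cbox a b \<subseteq> V" for a b
  proof -
    let ?\<phi> = "\<lambda>n x. \<Prod>i\<in>Basis. bump (real n) (a \<bullet> i) (b \<bullet> i) (x \<bullet> i)"
    have [measurable]: "?\<phi> n \<in> borel_measurable borel" for n
      by (intro borel_measurable_continuous_onI continuous_intros)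
    have "(\<lambda>n. LINT x|lborel. k x * ?\<phi> n x) \<longlonglongrightarrow> (LINT x|lborel. k x * indicator (box a b) x)"
    proof (rule integral_dominated_convergence[where w = "\<lambda>x. \<bar>k x\<bar>"])
      show "AE x in lborel. (\<lambda>n. k x * ?\<phi> n x) \<longlonglongrightarrow> k x * indicator (box a b) x"
      proof (intro AE_I2 tendsto_mult_left)
        fix x :: 'a
        have "(\<Prod>i\<in>Basis. indicator {a \<bullet> i<..<b \<bullet> i} (x \<bullet> i)) = (indicator (box a b) x :: real)"
          by (auto simp: indicator_def mem_box intro!: prod.neutral)
        moreover have "(\<lambda>n. ?\<phi> n x) \<longlonglongrightarrow> (\<Prod>i\<in>Basis. indicator {a \<bullet> i<..<b \<bullet> i} (x \<bullet> i))"
          by (intro tendsto_prod bump_tendsto)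
        ultimately show "(\<lambda>n. ?\<phi> n x) \<longlonglongrightarrow> indicator (box a b) x" by simp
      qed
      show "AE x in lborel. norm (k x * ?\<phi> n x) \<le> \<bar>k x\<bar>" for n
      proof (intro AE_I2)
        fix x :: 'a
        have "0 \<le> ?\<phi> n x" "?\<phi> n x \<le> 1"
          by (auto intro!: prod_nonneg prod_le_1 simp: bump_bounds)
        then show "norm (k x * ?\<phi> n x) \<le> \<bar>k x\<bar>"
          by (simp add: abs_mult mult_left_le)
      qed
    qed (use k in auto)
    moreover have "(LINT x|lborel. k x * ?\<phi> n x) = 0" for n
      by (rule test[OF test_function_bump]) (use that in auto)
    ultimately show ?thesis by (simp add: LIMSEQ_const_iff)
  qed
  have on_box: "AE x in lborel. x \<in> box p q \<longrightarrow> k x = 0" if pq: "cbox p q \<subseteq> V" for p q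
  proof -
    \<comment> \<open>Truncating to one box lets arbitrary Borel sets be tested, including those
      that leave \<open>V\<close>.\<close>
    let ?K = "\<lambda>x. k x * indicator (box p q) x"
    have K: "integrable lborel ?K"
      by (rule integrable_real_mult_indicator) (use k in auto)
    have "(\<integral>x\<in>A. ?K x \<partial>lborel) = (\<integral>x\<in>A. 0 \<partial>lborel)" if "A \<in> sets borel" for A
    proof -
      have Kset: "set_integrable lborel B ?K" if "B \<in> sets borel" for B
        unfolding set_integrable_def by (rule integrable_mult_indicator) (use that K in auto)
      have stable: "Int_stable (range (\<lambda>(a, b). box a b :: 'a set))"
        by (auto simp: Int_stable_def box_Int_box)
      have "A \<in> sigma_sets UNIV (range (\<lambda>(a, b). box a b))"
        using that unfolding borel_eq_box by simp
      have closed: "range (\<lambda>(a, b). box a b :: 'a set) \<subseteq> Pow UNIV" by simp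
      from stable closed \<open>A \<in> sigma_sets _ _\<close> have "(\<integral>x\<in>A. ?K x \<partial>lborel) = 0"
      proof (induction rule: sigma_sets_induct_disjoint)
        case (basic B)
        then obtain c d where B: "B = box c d" by auto
        let ?c = "\<Sum>i\<in>Basis. max (c \<bullet> i) (p \<bullet> i) *\<^sub>R i"
        let ?d = "\<Sum>i\<in>Basis. min (d \<bullet> i) (q \<bullet> i) *\<^sub>R i"
        have Int: "box c d \<inter> box p q = box ?c ?d" by (rule box_Int_box)
        have "(LINT x|lborel. k x * indicator (box ?c ?d) x) = 0"
        \<comment> \<open>The intersection with the truncating box is again a box, and its closure
          stays in \<open>V\<close>.\<close>
        proof (rule box)
          have "cbox ?c ?d = cbox c d \<inter> cbox p q" by (simp add: Int_interval)
          then show "cbox ?c ?d \<subseteq> V" using pq by blast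
        qed
        then show ?case unfolding set_lebesgue_integral_def B
          by (simp add: Int[symmetric] indicator_inter_arith mult_ac)
      next
        case empty
        then show ?case by (simp add: set_lebesgue_integral_def)
      next
        case (compl B)
        then have [measurable]: "B \<in> sets borel" unfolding borel_eq_box by simp
        have "(\<integral>x\<in>B. ?K x \<partial>lborel) + (\<integral>x\<in>UNIV - B. ?K x \<partial>lborel) = (\<integral>x\<in>B \<union> (UNIV - B). ?K x \<partial>lborel)"
          by (rule set_integral_Un[symmetric]) (auto intro: Kset)
        also have "B \<union> (UNIV - B) = UNIV" by auto
        also have "(\<integral>x\<in>UNIV. ?K x \<partial>lborel) = 0"
          using box[OF pq] by (simp add: set_lebesgue_integral_def)
        finally show ?case using compl by simp
      next
        case (union B)
        then have B [measurable]: "B i \<in> sets borel" for i unfolding borel_eq_box by auto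
        have "(\<integral>x\<in>(\<Union>i. B i). ?K x \<partial>lborel) = (\<Sum>i. (\<integral>x\<in>B i. ?K x \<partial>lborel))"
          by (rule lebesgue_integral_countable_add)
             (use union B in \<open>auto simp: disjoint_family_on_def intro!: Kset\<close>)
        then show ?case using union by simp
      qed
      then show ?thesis by (simp add: set_lebesgue_integral_def)
    qed
    then have "AE x in lborel. ?K x = 0"
      by (intro density_unique_real K) auto
    then show ?thesis by eventually_elim (auto simp: indicator_def)
  qed
  obtain \<D> where \<D>: "countable \<D>" "\<D> \<subseteq> Pow V" "\<And>X. X \<in> \<D> \<Longrightarrow> \<exists>a b. X = cbox a b" "\<Union>\<D> = V"
    using open_countable_Union_open_cbox[OF V] by blast
  have "AE x in lborel. \<forall>X\<in>\<D>. x \<in> X \<longrightarrow> k x = 0"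
  proof (rule AE_ball_countable'[OF _ \<D>(1)])
    fix X assume "X \<in> \<D>"
    then obtain a b where X: "X = cbox a b" "cbox a b \<subseteq> V" using \<D> by blast
    \<comment> \<open>The cover consists of closed boxes while \<open>on_box\<close> speaks of open
      ones; the faces are null.\<close>
    have "AE x in lborel. x \<notin> cbox a b - box a b"
      using null_sets_cbox_Diff_box by (rule AE_not_in)
    with on_box[OF X(2)] show "AE x in lborel. x \<in> X \<longrightarrow> k x = 0"
      unfolding X by eventually_elim auto
  qed
  then show ?thesis by eventually_elim (use \<D> in blast)
qed

section \<open>Translates of Sobolev functions\<close>

lemma
  fixes f :: "'a::euclidean_space \<Rightarrow> 'b::euclidean_space"
  assumes [measurable]: "f \<in> borel_measurable borel"
  shows lborel_integrable_translation: "integrable lborel (\<lambda>x. f (x + c)) \<longleftrightarrow> integrable lborel f"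
    and lborel_integral_translation: "(LINT x|lborel. f (x + c)) = (LINT x|lborel. f x)"
proof -
  show "integrable lborel (\<lambda>x. f (x + c)) \<longleftrightarrow> integrable lborel f"
    using integrable_distr_eq[of "(+) c" lborel borel f] by (simp add: lborel_distr_plus add.commute)
  show "(LINT x|lborel. f (x + c)) = (LINT x|lborel. f x)"
    using integral_distr[of "(+) c" lborel borel f] by (simp add: lborel_distr_plus add.commute)
qed

lemma nn_integral_lborel_translation:
  fixes f :: "'a::euclidean_space \<Rightarrow> ennreal"
  assumes [measurable]: "f \<in> borel_measurable borel"
  shows "(\<integral>\<^sup>+x. f (x + c) \<partial>lborel) = (\<integral>\<^sup>+x. f x \<partial>lborel)"
  using nn_integral_distr[of "(+) c" lborel borel f] by (simp add: lborel_distr_plus add.commute)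

lemma test_function_translation:
  assumes "test_function S \<phi> \<phi>'" and "\<And>x. x \<in> S \<Longrightarrow> x + c \<in> T"
  shows "test_function T (\<lambda>x. \<phi> (x - c)) (\<lambda>x. \<phi>' (x - c))"
  unfolding test_function_def
proof (intro conjI allI)
  obtain K where K: "compact K" "K \<subseteq> S" "\<And>x. x \<notin> K \<Longrightarrow> \<phi> x = 0"
    and D: "\<And>x. (\<phi> has_derivative (\<lambda>h. h \<bullet> \<phi>' x)) (at x)" and c': "continuous_on UNIV \<phi>'"
    using assms unfolding test_function_def gderiv_def by blast
  show "GDERIV (\<lambda>x. \<phi> (x - c)) x :> \<phi>' (x - c)" for x
    unfolding gderiv_def
    by (rule has_derivative_compose[OF _ D, of "\<lambda>x. x - c" "\<lambda>h. h"])
       (auto intro!: derivative_eq_intros)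
  show "continuous_on UNIV (\<lambda>x. \<phi>' (x - c))"
    by (rule continuous_on_compose2[OF c']) (auto intro!: continuous_intros)
  show "\<exists>K. compact K \<and> K \<subseteq> T \<and> (\<forall>x. x \<notin> K \<longrightarrow> \<phi> (x - c) = 0)"
  proof (intro exI conjI allI impI)
    show "compact ((\<lambda>x. x + c) ` K)"
      using K(1) by (intro compact_continuous_image continuous_intros)
    show "(\<lambda>x. x + c) ` K \<subseteq> T" using K(2) assms(2) by auto
    show "\<phi> (x - c) = 0" if "x \<notin> (\<lambda>x. x + c) ` K" for x
    proof (rule K(3))
      show "x - c \<notin> K" using that by (metis diff_add_cancel image_eqI)
    qed
  qed
qed

text \<open>The fundamental theorem along the segment from \<open>x\<close> to \<open>x - h\<close>.
  It is needed for smooth functions only; Sobolev functions inherit it by duality.\<close>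

lemma test_function_FTC:
  fixes x h :: "'a::euclidean_space"
  assumes test: "test_function S \<phi> \<phi>'"
  shows "\<phi> (x - h) - \<phi> x = - (LINT s|lborel. indicator {0..1} s * (\<phi>' (x - s *\<^sub>R h) \<bullet> h))"
proof -
  have D: "(\<phi> has_derivative (\<lambda>k. k \<bullet> \<phi>' y)) (at y)" and c: "continuous_on UNIV \<phi>'" for y
    using test unfolding test_function_def gderiv_def by blast+
  have "(LINT s|lborel. indicator {0..1} s *\<^sub>R - (\<phi>' (x - s *\<^sub>R h) \<bullet> h)) =
      \<phi> (x - 1 *\<^sub>R h) - \<phi> (x - 0 *\<^sub>R h)"
  proof (rule integral_FTC_Icc)
    fix s :: real
    have "((\<lambda>s. \<phi> (x - s *\<^sub>R h)) has_derivative (\<lambda>t. (- (t *\<^sub>R h)) \<bullet> \<phi>' (x - s *\<^sub>R h))) (at s within {0..1})"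
      by (rule has_derivative_compose[OF _ D]) (auto intro!: derivative_eq_intros)
    then show "((\<lambda>s. \<phi> (x - s *\<^sub>R h)) has_vector_derivative - (\<phi>' (x - s *\<^sub>R h) \<bullet> h)) (at s within {0..1})"
      by (simp add: has_vector_derivative_def inner_commute)
  next
    show "continuous_on {0..1} (\<lambda>s. - (\<phi>' (x - s *\<^sub>R h) \<bullet> h))"
      by (intro continuous_intros continuous_on_compose2[OF c]) auto
  qed simp
  then show ?thesis by simp
qed

text \<open>The integral of \<open>\<phi>\<close> is invariant under translation by
  \<open>h\<close>. Writing the difference by the fundamental theorem and exchanging integrals,
  every slice in \<open>s\<close> contributes the same integral of the directional derivative, which
  is therefore 0. This is why constants have weak gradient 0.\<close>

lemma integral_test_function_gradient:
  fixes h :: "'a::euclidean_space"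
  assumes test: "test_function S \<phi> \<phi>'"
  shows "(LINT x|lborel. \<phi>' x \<bullet> h) = 0"
proof -
  obtain K where K: "compact K" "K \<subseteq> S" "\<And>x. x \<notin> K \<Longrightarrow> \<phi> x = 0"
    and D: "\<And>x. GDERIV \<phi> x :> \<phi>' x" and c': "continuous_on UNIV \<phi>'"
    using test unfolding test_function_def by blast
  have testK: "test_function K \<phi> \<phi>'" using K D c' unfolding test_function_def by blast
  obtain B where c: "continuous_on UNIV \<phi>" and z: "\<And>x. x \<notin> K \<Longrightarrow> \<phi>' x = 0"
    using test_function_bounded[OF testK] by metis
  have [measurable]: "\<phi> \<in> borel_measurable borel" "\<phi>' \<in> borel_measurable borel"
    using c c' by (auto intro: borel_measurable_continuous_onI)
  have int: "integrable lborel k" if "continuous_on UNIV k" "\<And>x. x \<notin> K \<Longrightarrow> k x = 0" for k :: "'a \<Rightarrow> real"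
  proof -
    have "integrable lborel (\<lambda>x. indicator K x *\<^sub>R k x)"
      using borel_integrable_compact[OF K(1)] that(1) by (blast intro: continuous_on_subset)
    moreover have "(\<lambda>x. indicator K x *\<^sub>R k x) = k"
    proof
      show "indicator K x *\<^sub>R k x = k x" for x using that(2)[of x] by (cases "x \<in> K") auto
    qed
    ultimately show ?thesis by simp
  qed
  have \<phi>i: "integrable lborel \<phi>" using c K by (intro int) auto
  have hi: "integrable lborel (\<lambda>x. \<phi>' x \<bullet> h)" using c' z by (intro int continuous_intros) auto
  define H where "H = (\<lambda>(s::real, x). indicator {0..1} s * (\<phi>' (x - s *\<^sub>R h) \<bullet> h))"
  have [measurable]: "H \<in> borel_measurable (lborel \<Otimes>\<^sub>M lborel)" unfolding H_def by measurable
  have Hi: "integrable (lborel \<Otimes>\<^sub>M lborel) H"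
  proof (rule lborel_pair.Fubini_integrable)
    have "(LINT x|lborel. norm (H (s, x))) = indicator {0..1} s * (LINT x|lborel. \<bar>\<phi>' x \<bullet> h\<bar>)" for s
      using lborel_integral_translation[of "\<lambda>x. \<bar>\<phi>' x \<bullet> h\<bar>" "- s *\<^sub>R h"]
      by (simp add: H_def abs_mult)
    then show "integrable lborel (\<lambda>s. LINT x|lborel. norm (H (s, x)))" by simp
    show "AE s in lborel. integrable lborel (\<lambda>x. H (s, x))"
      using hi lborel_integrable_translation[of "\<lambda>x. \<phi>' x \<bullet> h" "- s *\<^sub>R h" for s]
      by (auto simp: H_def intro!: AE_I2)
  qed simp
  have "0 = (LINT x|lborel. \<phi> (x - h) - \<phi> x)"
    using \<phi>i lborel_integral_translation[of \<phi> "- h"] lborel_integrable_translation[of \<phi> "- h"] by simp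
  also have "\<dots> = - (LINT x|lborel. LINT s|lborel. H (s, x))"
    by (simp add: test_function_FTC[OF test] H_def)
  also have "(LINT x|lborel. LINT s|lborel. H (s, x)) = (LINT s|lborel. LINT x|lborel. H (s, x))"
    using lborel_pair.Fubini_integral[of "\<lambda>s x. H (s, x)"] Hi by simp
  also have "\<dots> = (LINT s|lborel. indicator {0..1::real} s * (LINT x|lborel. \<phi>' x \<bullet> h))"
  proof (rule Bochner_Integration.integral_cong[OF refl])
    fix s :: real
    show "(LINT x|lborel. H (s, x)) = indicator {0..1} s * (LINT x|lborel. \<phi>' x \<bullet> h)"
      using lborel_integral_translation[of "\<lambda>x. \<phi>' x \<bullet> h" "- s *\<^sub>R h"] by (simp add: H_def)
  qed
  finally show ?thesis by simp
qed

text \<open>Borel representatives on the whole space are used because Fubini's theorem is available for the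
  Borel product measure but not for the completed one.\<close>

definition borel_weak_gradient :: "'a::euclidean_space set \<Rightarrow> ('a \<Rightarrow> real) \<Rightarrow> ('a \<Rightarrow> 'a) \<Rightarrow> bool" where
  "borel_weak_gradient \<Omega> f g \<longleftrightarrow>
     f \<in> borel_measurable borel \<and> g \<in> borel_measurable borel \<and>
     integrable lborel f \<and> integrable lborel g \<and> integrable lborel (\<lambda>x. (norm (g x))\<^sup>2) \<and>
     (\<forall>\<phi> \<phi>' h. test_function \<Omega> \<phi> \<phi>' \<longrightarrow>
        (LINT x|lborel. f x * (\<phi>' x \<bullet> h)) = - (LINT x|lborel. (g x \<bullet> h) * \<phi> x))"

text \<open>Tested against \<open>\<phi>\<close> supported in \<open>V\<close>, the translation of
  \<open>f\<close> moves to \<open>\<phi>\<close>, where the fundamental theorem applies; for each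
  \<open>s\<close> the weak gradient relation is used with a translate of \<open>\<phi>\<close>, and
  a second translation brings the gradient of \<open>f\<close> to the point \<open>x + s h\<close>.
  The segment condition keeps all these translates supported in \<open>\<Omega>\<close>.\<close>

lemma weak_gradient_difference:
  fixes f :: "'a::euclidean_space \<Rightarrow> real"
  assumes fg: "borel_weak_gradient \<Omega> f g" and V: "open V"
    and seg: "\<And>x s. x \<in> V \<Longrightarrow> 0 \<le> s \<Longrightarrow> s \<le> 1 \<Longrightarrow> x + s *\<^sub>R h \<in> \<Omega>"
  shows "AE x in lborel. x \<in> V \<longrightarrow>
    f (x + h) - f x = (LINT s|lborel. indicator {0..1} s * (g (x + s *\<^sub>R h) \<bullet> h))"
proof -
  have [measurable]: "f \<in> borel_measurable borel" "g \<in> borel_measurable borel"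
    and fi: "integrable lborel f" and gi: "integrable lborel g"
    and wg: "\<And>\<phi> \<phi>' h. test_function \<Omega> \<phi> \<phi>' \<Longrightarrow>
        (LINT x|lborel. f x * (\<phi>' x \<bullet> h)) = - (LINT x|lborel. (g x \<bullet> h) * \<phi> x)"
    using fg unfolding borel_weak_gradient_def by blast+
  have ghi: "integrable lborel (\<lambda>x. g x \<bullet> h)" using gi by simp
  define H where "H = (\<lambda>(s::real, x). indicator {0..1} s * (g (x + s *\<^sub>R h) \<bullet> h))"
  have [measurable]: "H \<in> borel_measurable (lborel \<Otimes>\<^sub>M lborel)" unfolding H_def by measurable
  have ind: "integrable lborel (indicator {0..1::real} :: real \<Rightarrow> real)" by simp
  have Hi: "integrable (lborel \<Otimes>\<^sub>M lborel) H"
  proof (rule lborel_pair.Fubini_integrable)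
    have "(LINT x|lborel. norm (H (s, x))) = indicator {0..1} s * (LINT x|lborel. \<bar>g x \<bullet> h\<bar>)" for s
      using lborel_integral_translation[of "\<lambda>x. \<bar>g x \<bullet> h\<bar>" "s *\<^sub>R h"]
      by (simp add: H_def abs_mult)
    then show "integrable lborel (\<lambda>s. LINT x|lborel. norm (H (s, x)))" using ind by simp
    show "AE s in lborel. integrable lborel (\<lambda>x. H (s, x))"
      using ghi lborel_integrable_translation[of "\<lambda>x. g x \<bullet> h"]
      by (auto simp: H_def intro!: AE_I2)
  qed simp
  have H_int: "integrable lborel (\<lambda>x. LINT s|lborel. H (s, x))"
    using lborel_pair.integrable_snd[of "\<lambda>s x. H (s, x)"] Hi by simp
  have fh: "integrable lborel (\<lambda>x. f (x + h))"
    using fi lborel_integrable_translation[of f h] by simp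
  have "AE x in lborel. x \<in> V \<longrightarrow> f (x + h) - f x - (LINT s|lborel. H (s, x)) = 0"
  proof (rule du_bois_reymond[OF V])
    show "integrable lborel (\<lambda>x. f (x + h) - f x - (LINT s|lborel. H (s, x)))"
      using fi fh H_int by simp
    fix \<phi> \<phi>' assume test: "test_function V \<phi> \<phi>'"
    obtain B where B: "\<And>x. \<bar>\<phi> x\<bar> \<le> B" "\<And>x. norm (\<phi>' x) \<le> B" "B \<ge> 0"
      and c: "continuous_on UNIV \<phi>" "continuous_on UNIV \<phi>'"
      using test_function_bounded[OF test] by metis
    have [measurable]: "\<phi> \<in> borel_measurable borel" "\<phi>' \<in> borel_measurable borel"
      using c by (auto intro: borel_measurable_continuous_onI)
    have bdd: "integrable lborel (\<lambda>x. k x * \<phi> (x - c))" if "integrable lborel k" for k c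
      by (rule Bochner_Integration.integrable_bound[OF integrable_mult_right[OF integrable_abs[OF that], of B]])
         (use that B in \<open>auto simp: abs_mult mult.commute[of B] intro!: mult_left_mono order_trans[OF B(1)]\<close>)
    note FTC = test_function_FTC[OF test]
    \<comment> \<open>\<open>P\<close> carries the derivative on the test function, \<open>H\<close>
      on \<open>f\<close>. The order of integration is exchanged once for each, and the two are
      matched slice by slice in \<open>s\<close>.\<close>
    define P where "P = (\<lambda>(s::real, x). indicator {0..1} s * (f x * (\<phi>' (x - s *\<^sub>R h) \<bullet> h)))"
    have [measurable]: "P \<in> borel_measurable (lborel \<Otimes>\<^sub>M lborel)" unfolding P_def by measurable
    have Pb: "integrable (lborel \<Otimes>\<^sub>M lborel) P"
    proof (rule Bochner_Integration.integrable_bound)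
      show "integrable (lborel \<Otimes>\<^sub>M lborel) (\<lambda>(s, x). indicator {0..1::real} s * (B * norm h) * \<bar>f x\<bar>)"
      proof (rule lborel_pair.Fubini_integrable)
        show "integrable lborel (\<lambda>s. LINT x|lborel. norm (case (s, x) of (s, x) \<Rightarrow> indicator {0..1::real} s * (B * norm h) * \<bar>f x\<bar>))"
          using ind B by (simp add: abs_mult)
      qed (use fi in auto)
      show "AE z in lborel \<Otimes>\<^sub>M lborel. norm (P z) \<le> norm (case z of (s, x) \<Rightarrow> indicator {0..1::real} s * (B * norm h) * \<bar>f x\<bar>)"
      proof (intro AE_I2, clarify)
        fix s :: real and x :: 'a
        have "\<bar>\<phi>' (x - s *\<^sub>R h) \<bullet> h\<bar> \<le> B * norm h"
          using Cauchy_Schwarz_ineq2 B(2,3) by (meson mult_right_mono norm_ge_zero order_trans)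
        then show "norm (P (s, x)) \<le> norm (indicator {0..1} s * (B * norm h) * \<bar>f x\<bar>)"
          using B(3) by (auto simp: P_def abs_mult indicator_def mult.commute[of "\<bar>f x\<bar>"] mult_right_mono)
      qed
    qed simp
    have "(LINT x|lborel. (f (x + h) - f x) * \<phi> x) = (LINT x|lborel. f (x + h) * \<phi> x) - (LINT x|lborel. f x * \<phi> x)"
      using bdd[OF fh, of 0] bdd[OF fi, of 0] by (simp add: left_diff_distrib)
    also have "(LINT x|lborel. f (x + h) * \<phi> x) = (LINT x|lborel. f x * \<phi> (x - h))"
      using lborel_integral_translation[of "\<lambda>x. f x * \<phi> (x - h)" h] by simp
    also have "(LINT x|lborel. f x * \<phi> (x - h)) - (LINT x|lborel. f x * \<phi> x) =
        (LINT x|lborel. f x * (\<phi> (x - h) - \<phi> x))"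
      using bdd[OF fi, of h] bdd[OF fi, of 0] by (simp add: right_diff_distrib)
    also have "\<dots> = - (LINT x|lborel. LINT s|lborel. P (s, x))"
      by (simp add: FTC P_def mult.left_commute[of _ "f _"])
    also have "(LINT x|lborel. LINT s|lborel. P (s, x)) = (LINT s|lborel. LINT x|lborel. P (s, x))"
      using lborel_pair.Fubini_integral[of "\<lambda>s x. P (s, x)"] Pb by simp
    also have "\<dots> = - (LINT s|lborel. LINT x|lborel. H (s, x) * \<phi> x)"
    proof -
      have "(LINT x|lborel. P (s, x)) = - (LINT x|lborel. H (s, x) * \<phi> x)" for s
      proof (cases "s \<in> {0..1}")
        case True
        \<comment> \<open>The test function here is \<open>\<phi>\<close> shifted by
          \<open>s h\<close>, with support in \<open>\<Omega>\<close> by the segment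
          condition.\<close>
        have "(LINT x|lborel. f x * (\<phi>' (x - s *\<^sub>R h) \<bullet> h)) = - (LINT x|lborel. (g x \<bullet> h) * \<phi> (x - s *\<^sub>R h))"
          by (rule wg, rule test_function_translation[OF test]) (use seg True in auto)
        also have "(LINT x|lborel. (g x \<bullet> h) * \<phi> (x - s *\<^sub>R h)) = (LINT x|lborel. (g (x + s *\<^sub>R h) \<bullet> h) * \<phi> x)"
          using lborel_integral_translation[of "\<lambda>x. (g x \<bullet> h) * \<phi> (x - s *\<^sub>R h)" "s *\<^sub>R h"] by simp
        finally show ?thesis using True by (simp add: P_def H_def)
      qed (simp add: P_def H_def)
      then show ?thesis by simp
    qed
    also have "(LINT s|lborel. LINT x|lborel. H (s, x) * \<phi> x) = (LINT x|lborel. LINT s|lborel. H (s, x) * \<phi> x)"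
    proof -
      have "integrable (lborel \<Otimes>\<^sub>M lborel) (\<lambda>(s, x). H (s, x) * \<phi> x)"
        by (rule Bochner_Integration.integrable_bound[OF integrable_mult_right[OF integrable_abs[OF Hi], of B]])
           (use B in \<open>auto simp: abs_mult mult.commute[of B] intro!: mult_left_mono order_trans[OF B(1)] AE_I2\<close>)
      then show ?thesis
        using lborel_pair.Fubini_integral[of "\<lambda>s x. H (s, x) * \<phi> x"] by simp
    qed
    also have "\<dots> = (LINT x|lborel. (LINT s|lborel. H (s, x)) * \<phi> x)" by simp
    finally have "(LINT x|lborel. (f (x + h) - f x) * \<phi> x) = (LINT x|lborel. (LINT s|lborel. H (s, x)) * \<phi> x)"
      by simp
    moreover have "(LINT x|lborel. (f (x + h) - f x - (LINT s|lborel. H (s, x))) * \<phi> x) =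
        (LINT x|lborel. (f (x + h) - f x) * \<phi> x) - (LINT x|lborel. (LINT s|lborel. H (s, x)) * \<phi> x)"
      using bdd[OF Bochner_Integration.integrable_diff[OF fh fi], of 0] bdd[OF H_int, of 0]
      by (simp add: left_diff_distrib)
    ultimately show "(LINT x|lborel. (f (x + h) - f x - (LINT s|lborel. H (s, x))) * \<phi> x) = 0" by simp
  qed
  then show ?thesis by (simp add: H_def)
qed

text \<open>Cauchy-Schwarz in \<open>s\<close> bounds the squared difference by an average of
  squared gradients along the segment; after Tonelli each of the translated gradients has the same
  norm over the whole space. The nonnegative integral on the left makes finiteness part of the
  conclusion.\<close>

lemma translation_estimate:
  fixes f :: "'a::euclidean_space \<Rightarrow> real"
  assumes fg: "borel_weak_gradient \<Omega> f g" and V: "open V"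
    and seg: "\<And>x s. x \<in> V \<Longrightarrow> 0 \<le> s \<Longrightarrow> s \<le> 1 \<Longrightarrow> x + s *\<^sub>R h \<in> \<Omega>"
  shows "(\<integral>\<^sup>+x\<in>V. ennreal ((f (x + h) - f x)\<^sup>2) \<partial>lborel) \<le>
    ennreal ((norm h)\<^sup>2 * (LINT x|lborel. (norm (g x))\<^sup>2))"
proof -
  have [measurable]: "f \<in> borel_measurable borel" "g \<in> borel_measurable borel"
    and g2: "integrable lborel (\<lambda>x. (norm (g x))\<^sup>2)"
    using fg unfolding borel_weak_gradient_def by blast+
  have [measurable]: "V \<in> sets borel" using V by simp
  let ?q = "\<lambda>x s. ennreal (indicator {0..1} s * (norm (g (x + s *\<^sub>R h)) * norm h)\<^sup>2)"
  have bound: "ennreal ((LINT s|lborel. indicator {0..1} s * (g (x + s *\<^sub>R h) \<bullet> h))\<^sup>2) \<le> (\<integral>\<^sup>+s. ?q x s \<partial>lborel)" for x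
  proof -
    let ?r = "\<lambda>s. indicator {0..1} s * (g (x + s *\<^sub>R h) \<bullet> h)"
    have "ennreal \<bar>LINT s|lborel. ?r s\<bar> \<le> (\<integral>\<^sup>+s. ennreal \<bar>?r s\<bar> \<partial>lborel)"
      using integral_norm_bound_ennreal[of lborel ?r] not_integrable_integral_eq[of lborel ?r]
      by (cases "integrable lborel ?r") auto
    \<comment> \<open>The repeated indicator is the second factor for Cauchy-Schwarz; its norm is
      1.\<close>
    also have "\<dots> = (\<integral>\<^sup>+s. indicator {0..1} s * ennreal \<bar>?r s\<bar> \<partial>lborel)"
      by (intro nn_integral_cong) (auto simp: indicator_def)
    finally have "(ennreal \<bar>LINT s|lborel. ?r s\<bar>)\<^sup>2 \<le> (\<integral>\<^sup>+s. indicator {0..1} s * ennreal \<bar>?r s\<bar> \<partial>lborel)\<^sup>2"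
      by (rule power_mono) simp
    also have "\<dots> \<le> (\<integral>\<^sup>+s. (indicator {0..1::real} s)\<^sup>2 \<partial>lborel) * (\<integral>\<^sup>+s. (ennreal \<bar>?r s\<bar>)\<^sup>2 \<partial>lborel)"
      by (rule Cauchy_Schwarz_nn_integral) measurable
    also have "(\<integral>\<^sup>+s. (indicator {0..1::real} s)\<^sup>2 \<partial>lborel) = (\<integral>\<^sup>+s. indicator {0..1::real} s \<partial>lborel)"
      by (intro nn_integral_cong) (auto simp: indicator_def)
    also have "\<dots> = 1" by simp
    also have "(\<integral>\<^sup>+s. (ennreal \<bar>?r s\<bar>)\<^sup>2 \<partial>lborel) \<le> (\<integral>\<^sup>+s. ?q x s \<partial>lborel)"
    proof (intro nn_integral_mono)
      fix s :: real
      have "\<bar>g (x + s *\<^sub>R h) \<bullet> h\<bar> \<le> norm (g (x + s *\<^sub>R h)) * norm h" by (rule Cauchy_Schwarz_ineq2)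
      then have "(g (x + s *\<^sub>R h) \<bullet> h)\<^sup>2 \<le> (norm (g (x + s *\<^sub>R h)) * norm h)\<^sup>2"
        by (metis abs_ge_zero power2_abs power_mono)
      then show "(ennreal \<bar>?r s\<bar>)\<^sup>2 \<le> ?q x s"
        by (auto simp: ennreal_power indicator_def intro!: ennreal_leI)
    qed
    finally show ?thesis by (simp add: ennreal_power mult_left_mono)
  qed
  have diff: "AE x in lborel. x \<in> V \<longrightarrow>
      f (x + h) - f x = (LINT s|lborel. indicator {0..1} s * (g (x + s *\<^sub>R h) \<bullet> h))"
    by (rule weak_gradient_difference[OF fg V]) (rule seg)
  have "(\<integral>\<^sup>+x\<in>V. ennreal ((f (x + h) - f x)\<^sup>2) \<partial>lborel) \<le> (\<integral>\<^sup>+x. \<integral>\<^sup>+s. ?q x s \<partial>lborel \<partial>lborel)"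
  proof (rule nn_integral_mono_AE)
    show "AE x in lborel. ennreal ((f (x + h) - f x)\<^sup>2) * indicator V x \<le> (\<integral>\<^sup>+s. ?q x s \<partial>lborel)"
      using diff
    proof eventually_elim
      case (elim x)
      then show ?case using bound[of x] by (auto simp: indicator_def)
    qed
  qed
  also have "\<dots> = (\<integral>\<^sup>+s. \<integral>\<^sup>+x. ?q x s \<partial>lborel \<partial>lborel)"
    by (rule lborel_pair.Fubini'[symmetric]) measurable
  also have "\<dots> = (\<integral>\<^sup>+s. indicator {0..1::real} s * ennreal ((norm h)\<^sup>2 * (LINT x|lborel. (norm (g x))\<^sup>2)) \<partial>lborel)"
  proof (intro nn_integral_cong)
    fix s :: real
    have "(\<integral>\<^sup>+x. ennreal ((norm (g (x + s *\<^sub>R h)) * norm h)\<^sup>2) \<partial>lborel) =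
        (\<integral>\<^sup>+x. ennreal ((norm (g x) * norm h)\<^sup>2) \<partial>lborel)"
      by (rule nn_integral_lborel_translation) simp
    also have "\<dots> = ennreal (LINT x|lborel. (norm (g x) * norm h)\<^sup>2)"
      by (rule nn_integral_eq_integral) (use g2 in \<open>auto simp: power_mult_distrib\<close>)
    also have "(LINT x|lborel. (norm (g x) * norm h)\<^sup>2) = (norm h)\<^sup>2 * (LINT x|lborel. (norm (g x))\<^sup>2)"
      by (simp add: power_mult_distrib)
    finally show "(\<integral>\<^sup>+x. ?q x s \<partial>lborel) = indicator {0..1} s * ennreal ((norm h)\<^sup>2 * (LINT x|lborel. (norm (g x))\<^sup>2))"
      by (auto simp: indicator_def)
  qed
  also have "\<dots> = ennreal ((norm h)\<^sup>2 * (LINT x|lborel. (norm (g x))\<^sup>2))"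
    by (simp add: nn_integral_multc)
  finally show ?thesis .
qed

section \<open>Sets with a Poincare inequality\<close>

text \<open>The free constant \<open>c\<close> can be chosen anew for each \<open>S\<close>. The
  gradient term is taken over the whole space rather than over \<open>S\<close>, so estimates on
  different sets share one right-hand side.\<close>

definition poincare_const :: "'a::euclidean_space set \<Rightarrow> 'a set \<Rightarrow> real \<Rightarrow> bool" where
  "poincare_const \<Omega> S C \<longleftrightarrow> (\<forall>f g. borel_weak_gradient \<Omega> f g \<longrightarrow>
     (\<exists>c. (\<integral>\<^sup>+x\<in>S. ennreal ((f x - c)\<^sup>2) \<partial>lborel) \<le>
       ennreal (C * (LINT x|lborel. (norm (g x))\<^sup>2))))"

definition poincare_set :: "'a::euclidean_space set \<Rightarrow> 'a set \<Rightarrow> bool" where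
  "poincare_set \<Omega> S \<longleftrightarrow> S \<in> sets borel \<and> (\<exists>C\<ge>0. poincare_const \<Omega> S C)"

section \<open>Transport and gluing of Poincare inequalities\<close>

lemma sum_power2_le: "(a + b)\<^sup>2 \<le> 2 * a\<^sup>2 + 2 * (b::real)\<^sup>2"
  using zero_le_power2[of "a - b"] by (simp add: power2_eq_square algebra_simps)

lemma ennreal_2_mult: "0 \<le> a \<Longrightarrow> 2 * ennreal a = ennreal (2 * a)"
  using ennreal_mult[of 2 a] by simp

lemma ennreal_power2_diff_le: "ennreal ((a - c)\<^sup>2) \<le> 2 * ennreal ((a - b)\<^sup>2) + 2 * ennreal ((b - c)\<^sup>2)"
proof -
  have "ennreal ((a - c)\<^sup>2) \<le> ennreal (2 * (a - b)\<^sup>2 + 2 * (b - c)\<^sup>2)"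
    using sum_power2_le[of "a - b" "b - c"] by (intro ennreal_leI) simp
  also have "\<dots> = 2 * ennreal ((a - b)\<^sup>2) + 2 * ennreal ((b - c)\<^sup>2)"
    by (simp add: ennreal_2_mult)
  finally show ?thesis .
qed

text \<open>Split \<open>f x - c\<close> at \<open>f (x + d)\<close>: the translation estimate
  handles one part, the inequality on \<open>S\<close> the other. In this way pieces of the domain
  that are not convex inherit the inequality from convex ones.\<close>

lemma poincare_set_translate:
  fixes \<Omega> :: "'a::euclidean_space set"
  assumes S: "poincare_set \<Omega> S" and A: "open A"
    and into: "\<And>x. x \<in> A \<Longrightarrow> x + d \<in> S"
    and seg: "\<And>x s. x \<in> A \<Longrightarrow> 0 \<le> s \<Longrightarrow> s \<le> 1 \<Longrightarrow> x + s *\<^sub>R d \<in> \<Omega>"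
  shows "poincare_set \<Omega> A"
proof -
  obtain C where [measurable]: "S \<in> sets borel" and C: "C \<ge> 0" "poincare_const \<Omega> S C"
    using S unfolding poincare_set_def by blast
  have [measurable]: "A \<in> sets borel" using A by simp
  have "\<exists>c. (\<integral>\<^sup>+x\<in>A. ennreal ((f x - c)\<^sup>2) \<partial>lborel) \<le>
      ennreal ((2 * (norm d)\<^sup>2 + 2 * C) * (LINT x|lborel. (norm (g x))\<^sup>2))"
    if fg: "borel_weak_gradient \<Omega> f g" for f g
  proof -
    have [measurable]: "f \<in> borel_measurable borel" using fg unfolding borel_weak_gradient_def by blast
    let ?E = "LINT x|lborel. (norm (g x))\<^sup>2"
    have E: "?E \<ge> 0" by simp
    obtain c where c: "(\<integral>\<^sup>+x\<in>S. ennreal ((f x - c)\<^sup>2) \<partial>lborel) \<le> ennreal (C * ?E)"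
      using C(2) fg unfolding poincare_const_def by blast
    have 1: "(\<integral>\<^sup>+x\<in>A. ennreal ((f (x + d) - f x)\<^sup>2) \<partial>lborel) \<le> ennreal ((norm d)\<^sup>2 * ?E)"
      by (rule translation_estimate[OF fg A]) (rule seg)
    have "(\<integral>\<^sup>+x\<in>A. ennreal ((f (x + d) - c)\<^sup>2) \<partial>lborel) \<le>
        (\<integral>\<^sup>+x. (ennreal ((f (x + d) - c)\<^sup>2) * indicator S (x + d)) \<partial>lborel)"
      using into by (intro nn_integral_mono) (auto simp: indicator_def)
    also have "\<dots> = (\<integral>\<^sup>+x\<in>S. ennreal ((f x - c)\<^sup>2) \<partial>lborel)"
      by (rule nn_integral_lborel_translation) simp
    finally have 2: "(\<integral>\<^sup>+x\<in>A. ennreal ((f (x + d) - c)\<^sup>2) \<partial>lborel) \<le> ennreal (C * ?E)"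
      using c by (rule order_trans)
    have "(\<integral>\<^sup>+x\<in>A. ennreal ((f x - c)\<^sup>2) \<partial>lborel) \<le>
      (\<integral>\<^sup>+x. (2 * (ennreal ((f (x + d) - f x)\<^sup>2) * indicator A x) + 2 * (ennreal ((f (x + d) - c)\<^sup>2) * indicator A x)) \<partial>lborel)"
    proof (intro nn_integral_mono)
      fix x
      have "ennreal ((f x - c)\<^sup>2) \<le> 2 * ennreal ((f (x + d) - f x)\<^sup>2) + 2 * ennreal ((f (x + d) - c)\<^sup>2)"
        using ennreal_power2_diff_le[of "f x" c "f (x + d)"] by (simp add: power2_commute[of "f x" "f (x + d)"])
      then show "ennreal ((f x - c)\<^sup>2) * indicator A x \<le>
          2 * (ennreal ((f (x + d) - f x)\<^sup>2) * indicator A x) + 2 * (ennreal ((f (x + d) - c)\<^sup>2) * indicator A x)"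
        by (auto simp: indicator_def)
    qed
    also have "\<dots> = 2 * (\<integral>\<^sup>+x\<in>A. ennreal ((f (x + d) - f x)\<^sup>2) \<partial>lborel) + 2 * (\<integral>\<^sup>+x\<in>A. ennreal ((f (x + d) - c)\<^sup>2) \<partial>lborel)"
      by (simp add: nn_integral_add nn_integral_cmult)
    also have "\<dots> \<le> 2 * ennreal ((norm d)\<^sup>2 * ?E) + 2 * ennreal (C * ?E)"
      by (intro add_mono mult_left_mono 1 2) auto
    also have "\<dots> = ennreal (2 * ((norm d)\<^sup>2 * ?E)) + ennreal (2 * (C * ?E))"
      using C(1) E by (simp only: ennreal_2_mult mult_nonneg_nonneg zero_le_power2)
    also have "\<dots> = ennreal (2 * ((norm d)\<^sup>2 * ?E) + 2 * (C * ?E))"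
      by (rule ennreal_plus[symmetric]) (use C(1) E in auto)
    also have "2 * ((norm d)\<^sup>2 * ?E) + 2 * (C * ?E) = (2 * (norm d)\<^sup>2 + 2 * C) * ?E"
      by (simp only: distrib_right mult.assoc)
    finally show ?thesis by blast
  qed
  then show ?thesis
    unfolding poincare_set_def poincare_const_def using C(1) by (intro conjI exI[of _ "2 * (norm d)\<^sup>2 + 2 * C"]) auto
qed

text \<open>Integrate the squared difference of \<open>f x\<close> and \<open>f y\<close> over all
  pairs in \<open>V\<close>. In the variable \<open>h = y - x\<close>, which ranges over a ball of
  radius \<open>2 * R\<close>, each slice falls under the translation estimate. Some
  \<open>y\<close> does no worse than the average, and \<open>f y\<close> serves as the constant.
  The result is (2R)^2 times the measure \<open>B\<close> of that ball divided by the measure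
  \<open>m\<close> of \<open>V\<close>.\<close>

lemma poincare_set_convex:
  fixes \<Omega> :: "'a::euclidean_space set"
  assumes V: "convex V" "open V" "bounded V" "V \<subseteq> \<Omega>"
  shows "poincare_set \<Omega> V"
proof (cases "V = {}")
  case True
  then show ?thesis by (auto simp: poincare_set_def poincare_const_def intro!: exI[of _ 0])
next
  case False
  have [measurable]: "V \<in> sets borel" using V by simp
  obtain R where R: "R > 0" "\<And>x. x \<in> V \<Longrightarrow> norm x \<le> R"
    using V(3) by (auto simp: bounded_pos)
  define m where "m = measure lborel V"
  have mfin: "emeasure lborel V = ennreal m"
    unfolding m_def by (rule emeasure_eq_ennreal_measure) (use emeasure_bounded_finite[OF V(3)] in auto)
  have m: "m > 0"
    using open_not_negligible[OF V(2) False] mfin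
    by (auto simp: negligible_iff_null_sets null_sets_completion_iff null_sets_def m_def zero_less_measure_iff)
  define B where "B = measure lborel (cball (0::'a) (2 * R))"
  have B: "emeasure lborel (cball (0::'a) (2 * R)) = ennreal B"
    unfolding B_def by (rule emeasure_eq_ennreal_measure) (use emeasure_lborel_cball_finite[of "0::'a" "2 * R"] in auto)
  have "\<exists>c. (\<integral>\<^sup>+x\<in>V. ennreal ((f x - c)\<^sup>2) \<partial>lborel) \<le>
      ennreal (((2 * R)\<^sup>2 * B / m) * (LINT x|lborel. (norm (g x))\<^sup>2))"
    if fg: "borel_weak_gradient \<Omega> f g" for f g
  proof -
    have [measurable]: "f \<in> borel_measurable borel" using fg unfolding borel_weak_gradient_def by blast
    let ?E = "LINT x|lborel. (norm (g x))\<^sup>2"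
    have E: "?E \<ge> 0" by simp
    define I where "I y = (\<integral>\<^sup>+x\<in>V. ennreal ((f x - f y)\<^sup>2) \<partial>lborel)" for y
    have [measurable]: "I \<in> borel_measurable borel" unfolding I_def by measurable
    have "(\<integral>\<^sup>+y\<in>V. I y \<partial>lborel) = (\<integral>\<^sup>+y. \<integral>\<^sup>+x. ennreal ((f x - f y)\<^sup>2) * indicator V x * indicator V y \<partial>lborel \<partial>lborel)"
      unfolding I_def by (intro nn_integral_cong nn_integral_multc[symmetric]) measurable
    also have "\<dots> = (\<integral>\<^sup>+x. \<integral>\<^sup>+y. ennreal ((f x - f y)\<^sup>2) * indicator V x * indicator V y \<partial>lborel \<partial>lborel)"
      by (rule lborel_pair.Fubini') measurable
    \<comment> \<open>Substitution \<open>y = h + x\<close> for fixed \<open>x\<close>.\<close>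
    also have "\<dots> = (\<integral>\<^sup>+x. \<integral>\<^sup>+h. ennreal ((f x - f (h + x))\<^sup>2) * indicator V x * indicator V (h + x) \<partial>lborel \<partial>lborel)"
      by (intro nn_integral_cong nn_integral_lborel_translation[symmetric]) measurable
    also have "\<dots> = (\<integral>\<^sup>+h. \<integral>\<^sup>+x. ennreal ((f x - f (h + x))\<^sup>2) * indicator V x * indicator V (h + x) \<partial>lborel \<partial>lborel)"
      by (rule lborel_pair.Fubini'[symmetric]) measurable
    also have "\<dots> \<le> (\<integral>\<^sup>+h. ennreal ((2 * R)\<^sup>2 * ?E) * indicator (cball (0::'a) (2 * R)) h \<partial>lborel)"
    proof (intro nn_integral_mono)
      fix h :: 'a
      \<comment> \<open>The points whose translate by \<open>h\<close> also lies in
        \<open>V\<close>; by convexity the segment between the two does as well.\<close>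
      let ?V = "V \<inter> {x. x + h \<in> V}"
      have "open {x. x + h \<in> V}"
        using open_vimage[OF V(2) continuous_on_add[OF continuous_on_id continuous_on_const], of h]
        by (simp add: vimage_def)
      then have oV: "open ?V" using V(2) by auto
      have "(\<integral>\<^sup>+x. ennreal ((f x - f (h + x))\<^sup>2) * indicator V x * indicator V (h + x) \<partial>lborel) =
          (\<integral>\<^sup>+x\<in>?V. ennreal ((f (x + h) - f x)\<^sup>2) \<partial>lborel)"
        by (intro nn_integral_cong) (auto simp: indicator_def power2_commute add.commute)
      also have "\<dots> \<le> ennreal ((2 * R)\<^sup>2 * ?E) * indicator (cball 0 (2 * R)) h"
      proof (cases "?V = {}")
        case False
        then obtain x where "x \<in> V" "x + h \<in> V" by auto
        then have h: "norm h \<le> 2 * R"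
          using R(2)[of x] R(2)[of "x + h"] norm_triangle_ineq4[of "x + h" x] by simp
        have "(\<integral>\<^sup>+x\<in>?V. ennreal ((f (x + h) - f x)\<^sup>2) \<partial>lborel) \<le> ennreal ((norm h)\<^sup>2 * ?E)"
        proof (rule translation_estimate[OF fg oV])
          fix x and s :: real assume "x \<in> ?V" "0 \<le> s" "s \<le> 1"
          then have "(1 - s) *\<^sub>R x + s *\<^sub>R (x + h) \<in> V"
            using V(1) by (intro convexD_alt) auto
          then show "x + s *\<^sub>R h \<in> \<Omega>" using V(4) by (auto simp: algebra_simps)
        qed
        also have "\<dots> \<le> ennreal ((2 * R)\<^sup>2 * ?E)"
          using h E by (intro ennreal_leI mult_right_mono power_mono) auto
        finally show ?thesis using h by simp
      qed simp
      finally show "(\<integral>\<^sup>+x. ennreal ((f x - f (h + x))\<^sup>2) * indicator V x * indicator V (h + x) \<partial>lborel)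
          \<le> ennreal ((2 * R)\<^sup>2 * ?E) * indicator (cball 0 (2 * R)) h" .
    qed
    also have "\<dots> = ennreal ((2 * R)\<^sup>2 * ?E) * ennreal B"
      by (simp add: nn_integral_cmult_indicator B)
    also have "\<dots> = ennreal ((2 * R)\<^sup>2 * ?E * B)"
      by (rule ennreal_mult[symmetric]) (use E in \<open>auto simp: B_def\<close>)
    finally have I: "(\<integral>\<^sup>+y\<in>V. I y \<partial>lborel) \<le> ennreal ((2 * R)\<^sup>2 * ?E * B)" .
    define K where "K = (2 * R)\<^sup>2 * ?E * B"
    have K: "K \<ge> 0" unfolding K_def B_def using E by simp
    \<comment> \<open>If \<open>I\<close> exceeded its average bound everywhere on \<open>V\<close>,
      its integral would be strictly larger than \<open>K\<close>, as \<open>V\<close> has positive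
      measure.\<close>
    have "\<exists>y\<in>V. I y \<le> ennreal (K / m)"
    proof (rule ccontr)
      assume "\<not> (\<exists>y\<in>V. I y \<le> ennreal (K / m))"
      then have gt: "\<And>y. y \<in> V \<Longrightarrow> ennreal (K / m) < I y" by (auto simp: not_le)
      have KV: "(\<integral>\<^sup>+y. ennreal (K / m) * indicator V y \<partial>lborel) = ennreal K"
        using m K by (simp add: nn_integral_cmult_indicator mfin ennreal_mult[symmetric])
      have "(\<integral>\<^sup>+y. ennreal (K / m) * indicator V y \<partial>lborel) < (\<integral>\<^sup>+y\<in>V. I y \<partial>lborel)"
      proof (rule nn_integral_less)
        show "AE y in lborel. ennreal (K / m) * indicator V y \<le> I y * indicator V y"
          using gt by (auto simp: indicator_def less_imp_le)
        show "\<not> (AE y in lborel. I y * indicator V y \<le> ennreal (K / m) * indicator V y)"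
        proof
          assume "AE y in lborel. I y * indicator V y \<le> ennreal (K / m) * indicator V y"
          then have "AE y in lborel. y \<notin> V"
          proof eventually_elim
            case (elim y)
            then show ?case using gt[of y] by (auto simp: indicator_def not_le[symmetric])
          qed
          then have "emeasure lborel V = 0"
            using AE_iff_measurable[of V lborel "\<lambda>y. y \<notin> V"] by simp
          then show False using m mfin by simp
        qed
      qed (use KV in auto)
      then show False using I KV by (simp add: K_def)
    qed
    moreover have "K / m = (2 * R)\<^sup>2 * B / m * ?E" by (simp add: K_def)
    ultimately show ?thesis unfolding I_def by auto
  qed
  then show ?thesis
    unfolding poincare_set_def poincare_const_def using m by (intro conjI exI[of _ "(2 * R)\<^sup>2 * B / m"]) (auto simp: B_def)
qed

text \<open>The overlap is open and nonempty, so it has positive measure; there both constants are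
  close to \<open>f\<close>, hence to each other. The constant of \<open>S\<close> can then be used
  on \<open>T\<close> as well.\<close>

lemma poincare_set_Un:
  fixes \<Omega> :: "'a::euclidean_space set"
  assumes S: "poincare_set \<Omega> S" and T: "poincare_set \<Omega> T"
    and "open S" "open T" "bounded S" "bounded T" and ne: "S \<inter> T \<noteq> {}"
  shows "poincare_set \<Omega> (S \<union> T)"
proof -
  obtain C1 where [measurable]: "S \<in> sets borel" and C1: "C1 \<ge> 0" "poincare_const \<Omega> S C1"
    using S unfolding poincare_set_def by blast
  obtain C2 where [measurable]: "T \<in> sets borel" and C2: "C2 \<ge> 0" "poincare_const \<Omega> T C2"
    using T unfolding poincare_set_def by blast
  define m where "m = measure lborel (S \<inter> T)"
  have mfin: "emeasure lborel (S \<inter> T) = ennreal m"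
    unfolding m_def
    by (rule emeasure_eq_ennreal_measure) (use emeasure_bounded_finite[OF bounded_Int[OF disjI1[OF \<open>bounded S\<close>], of T]] in auto)
  have m: "m > 0"
    using open_not_negligible[of "S \<inter> T"] mfin assms
    by (auto simp: negligible_iff_null_sets null_sets_completion_iff null_sets_def m_def zero_less_measure_iff open_Int)
  define B where "B = measure lborel T"
  have B: "emeasure lborel T = ennreal B"
    unfolding B_def by (rule emeasure_eq_ennreal_measure) (use emeasure_bounded_finite[OF \<open>bounded T\<close>] in auto)
  have B0: "B \<ge> 0" by (simp add: B_def)
  \<comment> \<open>\<open>C1\<close> is the cost on \<open>S\<close>. On \<open>T\<close>,
    replacing \<open>c2\<close> by \<open>c1\<close> costs \<open>2 * C2\<close> plus twice the
    squared difference of the constants times the measure \<open>B\<close> of \<open>T\<close>; the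
    overlap bounds that squared difference by \<open>(2 * C1 + 2 * C2) / m\<close> times the
    gradient term.\<close>
  define C where "C = C1 + 2 * C2 + 2 * ((2 * C1 + 2 * C2) / m * B)"
  have C0: "C \<ge> 0" unfolding C_def using C1(1) C2(1) m B0 by simp
  have "\<exists>c. (\<integral>\<^sup>+x\<in>S \<union> T. ennreal ((f x - c)\<^sup>2) \<partial>lborel) \<le> ennreal (C * (LINT x|lborel. (norm (g x))\<^sup>2))"
    if fg: "borel_weak_gradient \<Omega> f g" for f g
  proof -
    have [measurable]: "f \<in> borel_measurable borel" using fg unfolding borel_weak_gradient_def by blast
    let ?E = "LINT x|lborel. (norm (g x))\<^sup>2"
    have E: "?E \<ge> 0" by simp
    obtain c1 where c1: "(\<integral>\<^sup>+x\<in>S. ennreal ((f x - c1)\<^sup>2) \<partial>lborel) \<le> ennreal (C1 * ?E)"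
      using C1(2) fg unfolding poincare_const_def by blast
    obtain c2 where c2: "(\<integral>\<^sup>+x\<in>T. ennreal ((f x - c2)\<^sup>2) \<partial>lborel) \<le> ennreal (C2 * ?E)"
      using C2(2) fg unfolding poincare_const_def by blast
    have "ennreal ((c1 - c2)\<^sup>2 * m) = (\<integral>\<^sup>+x. ennreal ((c1 - c2)\<^sup>2) * indicator (S \<inter> T) x \<partial>lborel)"
      using m by (simp add: nn_integral_cmult_indicator mfin ennreal_mult)
    also have "\<dots> \<le> (\<integral>\<^sup>+x. (2 * (ennreal ((f x - c1)\<^sup>2) * indicator S x) + 2 * (ennreal ((f x - c2)\<^sup>2) * indicator T x)) \<partial>lborel)"
    proof (intro nn_integral_mono)
      fix x show "ennreal ((c1 - c2)\<^sup>2) * indicator (S \<inter> T) x \<le>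
          2 * (ennreal ((f x - c1)\<^sup>2) * indicator S x) + 2 * (ennreal ((f x - c2)\<^sup>2) * indicator T x)"
        using ennreal_power2_diff_le[of c1 c2 "f x"] by (auto simp: indicator_def power2_commute[of c1 "f x"])
    qed
    also have "\<dots> = 2 * (\<integral>\<^sup>+x\<in>S. ennreal ((f x - c1)\<^sup>2) \<partial>lborel) + 2 * (\<integral>\<^sup>+x\<in>T. ennreal ((f x - c2)\<^sup>2) \<partial>lborel)"
      by (simp add: nn_integral_add nn_integral_cmult)
    also have "\<dots> \<le> 2 * ennreal (C1 * ?E) + 2 * ennreal (C2 * ?E)"
      by (intro add_mono mult_left_mono c1 c2) auto
    also have "\<dots> = ennreal (2 * (C1 * ?E)) + ennreal (2 * (C2 * ?E))"
      using C1(1) C2(1) E by (simp only: ennreal_2_mult mult_nonneg_nonneg)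
    also have "\<dots> = ennreal (2 * (C1 * ?E) + 2 * (C2 * ?E))"
      by (rule ennreal_plus[symmetric]) (use C1(1) C2(1) E in auto)
    also have "2 * (C1 * ?E) + 2 * (C2 * ?E) = (2 * C1 + 2 * C2) * ?E"
      by (simp only: distrib_right mult.assoc)
    finally have "(c1 - c2)\<^sup>2 * m \<le> (2 * C1 + 2 * C2) * ?E"
      using C1(1) C2(1) E by (subst (asm) ennreal_le_iff) auto
    then have cc: "(c1 - c2)\<^sup>2 * B \<le> (2 * C1 + 2 * C2) / m * B * ?E"
      using m B0 mult_right_mono[of "(c1 - c2)\<^sup>2" "(2 * C1 + 2 * C2) * ?E / m" B]
      by (simp add: pos_le_divide_eq mult_ac)
    have "(\<integral>\<^sup>+x\<in>S \<union> T. ennreal ((f x - c1)\<^sup>2) \<partial>lborel) \<le>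
      (\<integral>\<^sup>+x. (ennreal ((f x - c1)\<^sup>2) * indicator S x + (2 * (ennreal ((f x - c2)\<^sup>2) * indicator T x) +
         2 * (ennreal ((c1 - c2)\<^sup>2) * indicator T x))) \<partial>lborel)"
    proof (intro nn_integral_mono)
      fix x show "ennreal ((f x - c1)\<^sup>2) * indicator (S \<union> T) x \<le>
          ennreal ((f x - c1)\<^sup>2) * indicator S x + (2 * (ennreal ((f x - c2)\<^sup>2) * indicator T x) +
         2 * (ennreal ((c1 - c2)\<^sup>2) * indicator T x))"
        using ennreal_power2_diff_le[of "f x" c1 c2] by (auto simp: indicator_def power2_commute[of c1 c2])
    qed
    also have "\<dots> = (\<integral>\<^sup>+x\<in>S. ennreal ((f x - c1)\<^sup>2) \<partial>lborel) + (2 * (\<integral>\<^sup>+x\<in>T. ennreal ((f x - c2)\<^sup>2) \<partial>lborel) +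
        2 * (ennreal ((c1 - c2)\<^sup>2) * ennreal B))"
      by (simp add: nn_integral_add nn_integral_cmult B nn_integral_cmult_indicator)
    also have "\<dots> \<le> ennreal (C1 * ?E) + (2 * ennreal (C2 * ?E) + 2 * ennreal ((2 * C1 + 2 * C2) / m * B * ?E))"
      using cc B0 by (intro add_mono mult_left_mono c1 c2) (auto simp: ennreal_leI simp flip: ennreal_mult)
    also have "\<dots> = ennreal (C1 * ?E) + (ennreal (2 * (C2 * ?E)) + ennreal (2 * ((2 * C1 + 2 * C2) / m * B * ?E)))"
    proof -
      have "0 \<le> C2 * ?E" "0 \<le> (2 * C1 + 2 * C2) / m * B * ?E"
        using C1(1) C2(1) E m B0 by (auto intro!: mult_nonneg_nonneg divide_nonneg_pos)
      then show ?thesis by (simp only: ennreal_2_mult)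
    qed
    also have "\<dots> = ennreal (C1 * ?E + (2 * (C2 * ?E) + 2 * ((2 * C1 + 2 * C2) / m * B * ?E)))"
    proof -
      have "0 \<le> C1 * ?E" "0 \<le> 2 * (C2 * ?E)" "0 \<le> 2 * ((2 * C1 + 2 * C2) / m * B * ?E)"
        using C1(1) C2(1) E m B0 by (auto intro!: mult_nonneg_nonneg divide_nonneg_pos)
      then show ?thesis by (simp only: ennreal_plus add_nonneg_nonneg)
    qed
    also have "C1 * ?E + (2 * (C2 * ?E) + 2 * ((2 * C1 + 2 * C2) / m * B * ?E)) = C * ?E"
      unfolding C_def by (simp only: distrib_right mult.assoc add.assoc)
    finally show ?thesis by blast
  qed
  then show ?thesis unfolding poincare_set_def poincare_const_def using C0 by (intro conjI exI[of _ C]) auto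
qed

text \<open>Take a maximal subfamily whose union satisfies the inequality. If it is proper,
  connectedness yields another member that meets its union, and adding that member contradicts
  maximality.\<close>

lemma poincare_set_Union:
  fixes \<Omega> :: "'a::euclidean_space set"
  assumes fin: "finite \<G>" and G: "\<And>G. G \<in> \<G> \<Longrightarrow> open G \<and> bounded G \<and> G \<noteq> {} \<and> poincare_set \<Omega> G"
    and "\<G> \<noteq> {}" and conn: "connected (\<Union>\<G>)"
  shows "poincare_set \<Omega> (\<Union>\<G>)"
proof -
  let ?J = "{J. J \<subseteq> \<G> \<and> J \<noteq> {} \<and> poincare_set \<Omega> (\<Union>J)}"
  have "finite ?J" using fin by simp
  moreover from \<open>\<G> \<noteq> {}\<close> obtain G0 where "G0 \<in> \<G>" by blast
  then have "{G0} \<in> ?J" using G by auto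
  ultimately obtain J where J: "J \<in> ?J" "\<And>K. K \<in> ?J \<Longrightarrow> J \<subseteq> K \<Longrightarrow> J = K"
    using finite_has_maximal[of ?J] by (metis (no_types, lifting) empty_iff)
  show ?thesis
  proof (cases "J = \<G>")
    case True
    then show ?thesis using J by auto
  next
    case False
    let ?U = "\<Union>J" and ?W = "\<Union>(\<G> - J)"
    have JG: "J \<subseteq> \<G>" "J \<noteq> {}" "poincare_set \<Omega> ?U" using J(1) by auto
    have "open ?U" "open ?W" using G JG by (auto intro!: open_Union)
    moreover have "?U \<inter> \<Union>\<G> \<noteq> {}" "?W \<inter> \<Union>\<G> \<noteq> {}" using G JG False by blast+
    moreover have "\<Union>\<G> \<subseteq> ?U \<union> ?W" by auto
    ultimately have "?U \<inter> ?W \<inter> \<Union>\<G> \<noteq> {}" using connectedD[OF conn] by blast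
    then obtain G1 where G1: "G1 \<in> \<G> - J" "?U \<inter> G1 \<noteq> {}" by blast
    have "bounded ?U" using JG G fin by (intro bounded_Union) (auto intro: finite_subset)
    then have "poincare_set \<Omega> (?U \<union> G1)"
      using JG G1 G \<open>open ?U\<close> by (intro poincare_set_Un) auto
    then have "insert G1 J \<in> ?J" using G1 JG by (auto simp: Un_commute)
    then show ?thesis using J(2)[of "insert G1 J"] G1 by auto
  qed
qed

section \<open>The inequality up to a Lipschitz boundary\<close>

lemma orthonormal_expansion_2:
  fixes e1 e2 x :: "real^2"
  assumes "norm e1 = 1" "norm e2 = 1" "e1 \<bullet> e2 = 0"
  shows "x = (x \<bullet> e1) *\<^sub>R e1 + (x \<bullet> e2) *\<^sub>R e2"
proof (rule ccontr)
  define w where "w = x - ((x \<bullet> e1) *\<^sub>R e1 + (x \<bullet> e2) *\<^sub>R e2)"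
  assume "\<not> ?thesis"
  then have w: "w \<noteq> 0" by (simp add: w_def)
  have e: "e1 \<bullet> e1 = 1" "e2 \<bullet> e2 = 1" "e2 \<bullet> e1 = 0"
    using assms by (simp_all add: dot_square_norm inner_commute)
  have o: "w \<bullet> e1 = 0" "w \<bullet> e2 = 0"
    unfolding w_def by (simp_all add: inner_diff_left inner_add_left e assms(3))
  have ne: "e1 \<noteq> e2" "w \<noteq> e1" "w \<noteq> e2" "e1 \<noteq> 0" "e2 \<noteq> 0"
    using e o assms by auto
  \<comment> \<open>A nonzero remainder would be orthogonal to both axes and give three independent
    vectors in the plane.\<close>
  have "independent {e1, e2, w}"
  proof (rule pairwise_orthogonal_independent)
    show "pairwise orthogonal {e1, e2, w}"
      using o e assms(3) by (auto simp: pairwise_def orthogonal_def inner_commute)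
    show "0 \<notin> {e1, e2, w}" using ne w by auto
  qed
  then have "card {e1, e2, w} \<le> DIM(real^2)" by (rule independent_bound[THEN conjunct2])
  then show False using ne by auto
qed

text \<open>Below the graph lies a rectangle contained in \<open>\<Omega>\<close>, which is convex.
  The part of \<open>\<Omega>\<close> in a small rectangle around \<open>p\<close> moves into it
  under a downward translation, and moving downwards never crosses the graph.\<close>

lemma poincare_set_near_boundary:
  fixes \<Omega> :: "(real^2) set"
  assumes \<Omega>: "open \<Omega>" "bounded \<Omega>" and p: "p \<in> frontier \<Omega>"
    and e: "norm e1 = 1" "norm e2 = 1" "e1 \<bullet> e2 = 0" and "r > 0" "h > 0"
    and lip: "L-lipschitz_on UNIV (\<phi> :: real \<Rightarrow> real)"
    and chart: "\<And>s y. \<bar>s\<bar> < r \<Longrightarrow> \<bar>y\<bar> < h \<Longrightarrow> p + s *\<^sub>R e1 + y *\<^sub>R e2 \<in> \<Omega> \<longleftrightarrow> y < \<phi> s"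
  shows "\<exists>N. open N \<and> p \<in> N \<and> poincare_set \<Omega> (N \<inter> \<Omega>)"
proof -
  have L: "L \<ge> 0" "\<And>s t. \<bar>\<phi> s - \<phi> t\<bar> \<le> L * \<bar>s - t\<bar>"
    using lip unfolding lipschitz_on_def by (auto simp: dist_real_def)
  have ee: "e1 \<bullet> e1 = 1" "e2 \<bullet> e2 = 1" "e2 \<bullet> e1 = 0"
    using e by (simp_all add: dot_square_norm inner_commute)
  have expand: "x = p + ((x - p) \<bullet> e1) *\<^sub>R e1 + ((x - p) \<bullet> e2) *\<^sub>R e2" for x
    using orthonormal_expansion_2[OF e, of "x - p"] by (simp add: algebra_simps)
  have in\<Omega>: "x \<in> \<Omega> \<longleftrightarrow> (x - p) \<bullet> e2 < \<phi> ((x - p) \<bullet> e1)"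
    if "\<bar>(x - p) \<bullet> e1\<bar> < r" "\<bar>(x - p) \<bullet> e2\<bar> < h" for x
    using chart[OF that] expand[of x] by simp
  \<comment> \<open>If the graph passed strictly below \<open>p\<close>, no point of
    \<open>\<Omega>\<close> could be close to \<open>p\<close>.\<close>
  have \<phi>0: "\<phi> 0 \<ge> 0"
  proof (rule ccontr)
    assume "\<not> ?thesis"
    then have neg: "\<phi> 0 < 0" by simp
    \<comment> \<open>For coordinates smaller than \<open>\<delta>\<close> the graph is below
      \<open>\<phi> 0 + L * \<delta>\<close>, which is at most \<open>- \<delta>\<close>.\<close>
    define \<delta> where "\<delta> = min (min r h) (- \<phi> 0 / (1 + L))"
    have \<delta>: "\<delta> > 0"
      using \<open>r > 0\<close> \<open>h > 0\<close> divide_neg_pos[OF neg, of "1 + L"] L(1) by (simp add: \<delta>_def)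
    have \<delta>': "\<delta> * (1 + L) \<le> - \<phi> 0"
    proof -
      have "\<delta> \<le> - \<phi> 0 / (1 + L)" by (simp add: \<delta>_def)
      then show ?thesis using L by (subst (asm) pos_le_divide_eq) auto
    qed
    have "p \<in> closure \<Omega>" using p by (simp add: frontier_def)
    then obtain x where x: "x \<in> \<Omega>" "dist x p < \<delta>" using \<delta> closure_approachable by blast
    have b: "\<bar>(x - p) \<bullet> e1\<bar> < \<delta>" "\<bar>(x - p) \<bullet> e2\<bar> < \<delta>"
      using x(2) Cauchy_Schwarz_ineq2[of "x - p" e1] Cauchy_Schwarz_ineq2[of "x - p" e2] e
      by (auto simp: dist_norm)
    then have "(x - p) \<bullet> e2 < \<phi> ((x - p) \<bullet> e1)" using in\<Omega> x(1) by (simp add: \<delta>_def)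
    also have "\<phi> ((x - p) \<bullet> e1) \<le> \<phi> 0 + L * \<bar>(x - p) \<bullet> e1\<bar>"
      using L(2)[of "(x - p) \<bullet> e1" 0] by auto
    also have "L * \<bar>(x - p) \<bullet> e1\<bar> \<le> L * \<delta>" using b L(1) by (intro mult_left_mono) auto
    finally show False using b(2) \<delta>' by (simp add: algebra_simps)
  qed
  \<comment> \<open>Over this width the graph falls by at most \<open>3 * h / 8\<close>, so heights
    below \<open>- 3 * h / 8\<close> lie under it. The denominator \<open>1 + L\<close> stays
    positive when \<open>L\<close> is 0.\<close>
  define r' where "r' = min r (3 * h / 8 / (1 + L))"
  have r': "r' > 0" "r' \<le> r" using \<open>r > 0\<close> \<open>h > 0\<close> L by (auto simp: r'_def)
  have Lr: "L * r' \<le> 3 * h / 8"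
  proof -
    have "r' \<le> 3 * h / 8 / (1 + L)" by (simp add: r'_def)
    then have "r' * (1 + L) \<le> 3 * h / 8" using L(1) by (subst (asm) pos_le_divide_eq) auto
    then show ?thesis using r' by (simp add: algebra_simps)
  qed
  let ?strip = "\<lambda>a b. {x. \<bar>(x - p) \<bullet> e1\<bar> < r' \<and> a < (x - p) \<bullet> e2 \<and> (x - p) \<bullet> e2 < b}"
  have ostrip: "open (?strip a b)" for a b
    by (intro open_Collect_conj open_Collect_less continuous_intros)
  \<comment> \<open>The two rectangles have the same shape: lowering \<open>?N\<close> by
    \<open>h / 2\<close> turns heights between \<open>- h / 4\<close> and \<open>h / 8\<close> into
    those between \<open>- 3 * h / 4\<close> and \<open>- 3 * h / 8\<close>, still inside the
    chart.\<close>
  let ?R = "?strip (- 3 * h / 4) (- 3 * h / 8)" and ?N = "?strip (- h / 4) (h / 8)"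
  have R\<Omega>: "?R \<subseteq> \<Omega>"
  proof
    fix x assume x: "x \<in> ?R"
    have "\<phi> 0 \<le> \<phi> ((x - p) \<bullet> e1) + L * \<bar>(x - p) \<bullet> e1\<bar>"
      using L(2)[of 0 "(x - p) \<bullet> e1"] by auto
    moreover have "L * \<bar>(x - p) \<bullet> e1\<bar> \<le> L * r'" using x L(1) by (intro mult_left_mono) auto
    ultimately have "(x - p) \<bullet> e2 < \<phi> ((x - p) \<bullet> e1)" using \<phi>0 Lr x by auto
    then show "x \<in> \<Omega>" using x r' \<open>h > 0\<close> by (subst in\<Omega>) auto
  qed
  have "poincare_set \<Omega> ?R"
  proof (rule poincare_set_convex[OF _ ostrip _ R\<Omega>])
    have "?R = {x. e1 \<bullet> x < r' + p \<bullet> e1} \<inter> {x. e1 \<bullet> x > - r' + p \<bullet> e1} \<inter>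
        ({x. e2 \<bullet> x > - 3 * h / 4 + p \<bullet> e2} \<inter> {x. e2 \<bullet> x < - 3 * h / 8 + p \<bullet> e2})"
      by (auto simp: inner_diff_right inner_commute[of _ e1] inner_commute[of _ e2] abs_less_iff)
    then show "convex ?R" by (simp only: convex_Int convex_halfspace_lt convex_halfspace_gt)
    show "bounded ?R" using \<Omega>(2) R\<Omega> by (rule bounded_subset)
  qed
  then have "poincare_set \<Omega> (?N \<inter> \<Omega>)"
  proof (rule poincare_set_translate[where d = "(- h / 2) *\<^sub>R e2"])
    show "open (?N \<inter> \<Omega>)" using ostrip \<Omega>(1) by (intro open_Int)
    fix x assume x: "x \<in> ?N \<inter> \<Omega>"
    have c: "(x + a *\<^sub>R e2 - p) \<bullet> e1 = (x - p) \<bullet> e1" "(x + a *\<^sub>R e2 - p) \<bullet> e2 = (x - p) \<bullet> e2 + a" for a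
      by (simp_all add: inner_diff_left inner_add_left ee)
    show "x + (- h / 2) *\<^sub>R e2 \<in> ?R" using x \<open>h > 0\<close> unfolding mem_Collect_eq c by auto
    fix s :: real assume s: "0 \<le> s" "s \<le> 1"
    let ?a = "s * (- h / 2)"
    have a: "?a \<le> 0" "?a \<ge> - h / 2" using s \<open>h > 0\<close> by (auto simp: mult_le_0_iff mult_left_le_one_le)
    have "(x - p) \<bullet> e2 < \<phi> ((x - p) \<bullet> e1)" using x r' \<open>h > 0\<close> by (subst in\<Omega>[symmetric]) auto
    note below = this
    have k: "\<bar>(x - p) \<bullet> e1\<bar> < r'" "- h / 4 < (x - p) \<bullet> e2" "(x - p) \<bullet> e2 < h / 8" using x by auto
    have "\<bar>(x + ?a *\<^sub>R e2 - p) \<bullet> e1\<bar> < r" unfolding c using k r' by linarith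
    moreover have "\<bar>(x + ?a *\<^sub>R e2 - p) \<bullet> e2\<bar> < h" unfolding c using k a \<open>h > 0\<close> by linarith
    moreover have "(x + ?a *\<^sub>R e2 - p) \<bullet> e2 < \<phi> ((x + ?a *\<^sub>R e2 - p) \<bullet> e1)"
      unfolding c using below a by linarith
    ultimately have "x + ?a *\<^sub>R e2 \<in> \<Omega>" using in\<Omega> by blast
    then show "x + s *\<^sub>R ((- h / 2) *\<^sub>R e2) \<in> \<Omega>" by simp
  qed
  moreover have "p \<in> ?N" using r' \<open>h > 0\<close> by auto
  ultimately show ?thesis using ostrip by blast
qed

text \<open>Interior points have a ball, boundary points the neighbourhood from the chart.
  Compactness of the closure leaves finitely many, and connectedness of the domain glues
  them.\<close>

lemma poincare_set_lipschitz_domain: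
  assumes "lipschitz_domain \<Omega>"
  shows "poincare_set \<Omega> \<Omega>"
proof -
  have \<Omega>: "open \<Omega>" "connected \<Omega>" "bounded \<Omega>" "\<Omega> \<noteq> {}"
    using assms unfolding lipschitz_domain_def by blast+
  have "\<exists>N. open N \<and> p \<in> N \<and> poincare_set \<Omega> (N \<inter> \<Omega>)" if p: "p \<in> closure \<Omega>" for p
  proof (cases "p \<in> \<Omega>")
    case True
    then obtain \<epsilon> where "\<epsilon> > 0" "ball p \<epsilon> \<subseteq> \<Omega>" using \<Omega>(1) open_contains_ball by blast
    then show ?thesis
      by (intro exI[of _ "ball p \<epsilon>"]) (auto simp: Int_absorb2 intro!: poincare_set_convex)
  next
    case False
    with p have p: "p \<in> frontier \<Omega>" using \<Omega>(1) by (simp add: frontier_def interior_open)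
    have "\<exists>e1 e2 r h \<phi> L. norm e1 = 1 \<and> norm e2 = 1 \<and> e1 \<bullet> e2 = 0 \<and> r > 0 \<and> h > 0 \<and>
        L-lipschitz_on UNIV (\<phi> :: real \<Rightarrow> real) \<and>
        (\<forall>s y. \<bar>s\<bar> < r \<longrightarrow> \<bar>y\<bar> < h \<longrightarrow> (p + s *\<^sub>R e1 + y *\<^sub>R e2 \<in> \<Omega> \<longleftrightarrow> y < \<phi> s))"
      using assms p unfolding lipschitz_domain_def by (elim conjE) (erule bspec)
    then show ?thesis
    proof (elim exE conjE)
      fix e1 e2 r h \<phi> L
      assume *: "norm e1 = 1" "norm e2 = 1" "e1 \<bullet> e2 = 0" "r > 0" "h > 0" "L-lipschitz_on UNIV (\<phi> :: real \<Rightarrow> real)"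
        "\<forall>s y. \<bar>s\<bar> < r \<longrightarrow> \<bar>y\<bar> < h \<longrightarrow> (p + s *\<^sub>R e1 + y *\<^sub>R e2 \<in> \<Omega> \<longleftrightarrow> y < \<phi> s)"
      show ?thesis
        by (rule poincare_set_near_boundary[OF \<Omega>(1,3) p *(1-6)]) (rule *(7)[rule_format])
    qed
  qed
  then obtain N where N: "\<And>p. p \<in> closure \<Omega> \<Longrightarrow> open (N p) \<and> p \<in> N p \<and> poincare_set \<Omega> (N p \<inter> \<Omega>)"
    by metis
  have "compact (closure \<Omega>)" using \<Omega>(3) by simp
  moreover have "\<And>p. p \<in> closure \<Omega> \<Longrightarrow> open (N p)" using N by blast
  moreover have "closure \<Omega> \<subseteq> (\<Union>p\<in>closure \<Omega>. N p)" using N by blast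
  ultimately obtain P where P: "P \<subseteq> closure \<Omega>" "finite P" "closure \<Omega> \<subseteq> (\<Union>p\<in>P. N p)"
    by (rule compactE_image)
  have Un: "\<Union>((\<lambda>p. N p \<inter> \<Omega>) ` P) = \<Omega>" using P(3) closure_subset[of \<Omega>] by blast
  have "poincare_set \<Omega> (\<Union>((\<lambda>p. N p \<inter> \<Omega>) ` P))"
  proof (rule poincare_set_Union)
    show "connected (\<Union>((\<lambda>p. N p \<inter> \<Omega>) ` P))" unfolding Un by (rule \<Omega>(2))
    show "(\<lambda>p. N p \<inter> \<Omega>) ` P \<noteq> {}" using Un \<Omega>(4) by auto
    fix G assume "G \<in> (\<lambda>p. N p \<inter> \<Omega>) ` P"
    then obtain q where q: "q \<in> P" "G = N q \<inter> \<Omega>" by blast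
    then have "q \<in> closure \<Omega>" using P(1) by blast
    \<comment> \<open>Gluing requires nonempty pieces; an open neighbourhood of a point of the
      closure meets \<open>\<Omega>\<close>.\<close>
    with N[of q] have "N q \<inter> \<Omega> \<noteq> {}"
      using open_Int_closure_eq_empty[of "N q" \<Omega>] by blast
    then show "open G \<and> bounded G \<and> G \<noteq> {} \<and> poincare_set \<Omega> G"
      using N[OF \<open>q \<in> closure \<Omega>\<close>] \<Omega> q by (auto intro: open_Int bounded_Int)
  qed (use P(2) in simp)
  then show ?thesis unfolding Un .
qed

section \<open>Square-integrable functions\<close>

text \<open>Values in any Euclidean space allow functions, gradients, Jacobians and pairs of them to
  be treated alike, each with its own inner product.\<close>

definition square_integrable :: "'a measure \<Rightarrow> ('a \<Rightarrow> 'b::euclidean_space) \<Rightarrow> bool" where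
  "square_integrable M f \<longleftrightarrow> f \<in> borel_measurable M \<and> integrable M (\<lambda>x. (norm (f x))\<^sup>2)"

lemma square_integrable_inner:
  assumes "square_integrable M f" "square_integrable M g"
  shows "integrable M (\<lambda>x. f x \<bullet> g x)"
proof (rule Bochner_Integration.integrable_bound)
  show "integrable M (\<lambda>x. (norm (f x))\<^sup>2 + (norm (g x))\<^sup>2)"
    using assms by (simp add: square_integrable_def)
  show "AE x in M. norm (f x \<bullet> g x) \<le> norm ((norm (f x))\<^sup>2 + (norm (g x))\<^sup>2)"
  proof (intro AE_I2)
    fix x
    have "\<bar>f x \<bullet> g x\<bar> \<le> norm (f x) * norm (g x)" by (rule Cauchy_Schwarz_ineq2)
    moreover have "2 * (norm (f x) * norm (g x)) \<le> (norm (f x))\<^sup>2 + (norm (g x))\<^sup>2"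
      using zero_le_power2[of "norm (f x) - norm (g x)"] by (simp add: power2_eq_square algebra_simps)
    moreover have "0 \<le> norm (f x) * norm (g x)" by simp
    ultimately show "norm (f x \<bullet> g x) \<le> norm ((norm (f x))\<^sup>2 + (norm (g x))\<^sup>2)"
      unfolding real_norm_def by linarith
  qed
  show "(\<lambda>x. f x \<bullet> g x) \<in> borel_measurable M"
    using assms unfolding square_integrable_def by (auto intro: borel_measurable_inner)
qed

lemma square_integrable_scaleR:
  assumes "square_integrable M f"
  shows "square_integrable M (\<lambda>x. c *\<^sub>R f x)"
  using assms unfolding square_integrable_def by (auto simp: power_mult_distrib)

lemma square_integrable_add:
  assumes "square_integrable M f" "square_integrable M g"
  shows "square_integrable M (\<lambda>x. f x + g x)"
proof -
  have "(norm (f x + g x))\<^sup>2 = (norm (f x))\<^sup>2 + 2 * (f x \<bullet> g x) + (norm (g x))\<^sup>2" for x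
    by (simp add: power2_norm_eq_inner inner_add_left inner_add_right inner_commute)
  then show ?thesis
    using assms square_integrable_inner[OF assms] unfolding square_integrable_def
    by (auto intro: borel_measurable_add)
qed

lemma square_integrable_diff:
  assumes "square_integrable M f" "square_integrable M g"
  shows "square_integrable M (\<lambda>x. f x - g x)"
  using square_integrable_add[OF assms(1) square_integrable_scaleR[OF assms(2), of "-1"]] by simp

lemma square_integrable_diff_norm:
  assumes f: "square_integrable M f" and g: "square_integrable M g"
  shows "(LINT x|M. (norm (f x - g x))\<^sup>2) =
    (LINT x|M. (norm (f x))\<^sup>2) - 2 * (LINT x|M. f x \<bullet> g x) + (LINT x|M. (norm (g x))\<^sup>2)"
proof -
  have "(norm (f x - g x))\<^sup>2 = (norm (f x))\<^sup>2 - 2 * (f x \<bullet> g x) + (norm (g x))\<^sup>2" for x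
    by (simp add: power2_norm_eq_inner inner_diff_left inner_diff_right inner_commute)
  then show ?thesis
    using f g square_integrable_inner[OF f g] by (simp add: square_integrable_def)
qed

lemma Cauchy_Schwarz_integral:
  assumes f: "square_integrable M f" and g: "square_integrable M g"
  shows "\<bar>LINT x|M. f x \<bullet> g x\<bar> \<le> sqrt (LINT x|M. (norm (f x))\<^sup>2) * sqrt (LINT x|M. (norm (g x))\<^sup>2)"
proof -
  let ?A = "LINT x|M. (norm (f x))\<^sup>2" and ?B = "LINT x|M. f x \<bullet> g x" and ?C = "LINT x|M. (norm (g x))\<^sup>2"
  have AC: "?A \<ge> 0" "?C \<ge> 0" by simp_all
  have q: "0 \<le> ?A - 2 * t * ?B + t\<^sup>2 * ?C" for t
  proof -
    have "0 \<le> (LINT x|M. (norm (f x - t *\<^sub>R g x))\<^sup>2)" by simp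
    also have "\<dots> = ?A - 2 * (LINT x|M. f x \<bullet> (t *\<^sub>R g x)) + (LINT x|M. (norm (t *\<^sub>R g x))\<^sup>2)"
      by (rule square_integrable_diff_norm[OF f square_integrable_scaleR[OF g]])
    finally show ?thesis by (simp add: power_mult_distrib)
  qed
  have "?B\<^sup>2 \<le> ?A * ?C"
  proof (cases "?C = 0")
    case True
    have "?B = 0"
    proof (rule ccontr)
      assume B: "?B \<noteq> 0"
      \<comment> \<open>With \<open>?C = 0\<close> the quadratic is affine in \<open>t\<close>; this
        \<open>t\<close> would give it the value \<open>- ?A - 2\<close>.\<close>
      have "0 \<le> ?A - 2 * ((?A + 1) / ?B) * ?B" using q[of "(?A + 1) / ?B"] True by simp
      then show False using B AC by simp
    qed
    then show ?thesis using True by simp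
  next
    case False
    then have C: "?C > 0" using AC(2) by (simp only: less_le) auto
    have "0 \<le> ?A - 2 * (?B / ?C) * ?B + (?B / ?C)\<^sup>2 * ?C" by (rule q)
    also have "\<dots> = ?A - ?B\<^sup>2 / ?C" using C by (simp add: power2_eq_square field_simps)
    finally show ?thesis using C by (simp add: field_simps)
  qed
  then have "sqrt (?B\<^sup>2) \<le> sqrt (?A * ?C)" by (rule real_sqrt_le_mono)
  then show ?thesis by (simp add: real_sqrt_mult)
qed

lemma square_integrable_norm_triangle:
  assumes f: "square_integrable M f" and g: "square_integrable M g"
  shows "sqrt (LINT x|M. (norm (f x + g x))\<^sup>2) \<le>
    sqrt (LINT x|M. (norm (f x))\<^sup>2) + sqrt (LINT x|M. (norm (g x))\<^sup>2)"
proof -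
  let ?A = "LINT x|M. (norm (f x))\<^sup>2" and ?C = "LINT x|M. (norm (g x))\<^sup>2"
  have mg: "square_integrable M (\<lambda>x. - g x)" using square_integrable_scaleR[OF g, of "-1"] by simp
  have "(LINT x|M. (norm (f x + g x))\<^sup>2) = ?A + 2 * (LINT x|M. f x \<bullet> g x) + ?C"
    using square_integrable_diff_norm[OF f mg] by simp
  also have "\<dots> \<le> ?A + 2 * (sqrt ?A * sqrt ?C) + ?C"
    using Cauchy_Schwarz_integral[OF f g] by simp
  also have "\<dots> = (sqrt ?A + sqrt ?C)\<^sup>2" by (simp add: power2_sum)
  finally have "sqrt (LINT x|M. (norm (f x + g x))\<^sup>2) \<le> sqrt ((sqrt ?A + sqrt ?C)\<^sup>2)"
    by (rule real_sqrt_le_mono)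
  then show ?thesis by simp
qed

lemma power2_norm_vec_eq_sum:
  fixes v :: "'b::euclidean_space^'n"
  shows "(norm v)\<^sup>2 = (\<Sum>i\<in>UNIV. (norm (v $ i))\<^sup>2)"
  unfolding power2_norm_eq_inner inner_vec_def ..

lemma square_integrable_iff_nth:
  fixes f :: "'a \<Rightarrow> 'b::euclidean_space^'n"
  shows "square_integrable M f \<longleftrightarrow> (\<forall>i. square_integrable M (\<lambda>x. f x $ i))"
proof
  assume f: "square_integrable M f"
  show "\<forall>i. square_integrable M (\<lambda>x. f x $ i)"
  proof
    fix i
    have m: "(\<lambda>x. f x $ i) \<in> borel_measurable M"
      using f unfolding square_integrable_def by (auto intro: borel_measurable_continuous_on simp: continuous_on_component)
    have "integrable M (\<lambda>x. (norm (f x $ i))\<^sup>2)"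
    proof (rule Bochner_Integration.integrable_bound)
      show "integrable M (\<lambda>x. (norm (f x))\<^sup>2)" using f by (simp add: square_integrable_def)
      show "AE x in M. norm ((norm (f x $ i))\<^sup>2) \<le> norm ((norm (f x))\<^sup>2)"
        using power_mono[OF Finite_Cartesian_Product.norm_nth_le, of _ i 2] by auto
    qed (use m in measurable)
    then show "square_integrable M (\<lambda>x. f x $ i)" using m by (simp add: square_integrable_def)
  qed
next
  assume f: "\<forall>i. square_integrable M (\<lambda>x. f x $ i)"
  have "f \<in> borel_measurable M"
    using f unfolding square_integrable_def borel_measurable_euclidean_space[of f]
    by (auto simp: Basis_vec_def inner_axis intro: borel_measurable_inner)
  then show "square_integrable M f"
    using f by (auto simp: square_integrable_def power2_norm_vec_eq_sum)
qed

lemma square_integrable_Pair: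
  assumes "square_integrable M f" "square_integrable M g"
  shows "square_integrable M (\<lambda>x. (f x, g x))"
  using assms unfolding square_integrable_def norm_Pair by (auto intro: borel_measurable_Pair)

lemma (in finite_measure) square_integrable_const: "square_integrable M (\<lambda>x. c)"
  unfolding square_integrable_def by simp

lemma (in finite_measure) square_integrable_imp_integrable:
  fixes f :: "'a \<Rightarrow> 'b::euclidean_space"
  assumes "square_integrable M f"
  shows "integrable M f"
proof (rule Bochner_Integration.integrable_bound)
  show "integrable M (\<lambda>x. 1 + (norm (f x))\<^sup>2)" using assms by (simp add: square_integrable_def)
  show "AE x in M. norm (f x) \<le> norm (1 + (norm (f x))\<^sup>2)"
  proof (intro AE_I2)
    fix x
    have "2 * norm (f x) \<le> 1 + (norm (f x))\<^sup>2"
      using zero_le_power2[of "norm (f x) - 1"] by (simp add: power2_diff)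
    then have "norm (f x) \<le> 1 + (norm (f x))\<^sup>2" using norm_ge_zero[of "f x"] by linarith
    then show "norm (f x) \<le> norm (1 + (norm (f x))\<^sup>2)" by simp
  qed
qed (use assms in \<open>simp add: square_integrable_def\<close>)

text \<open>In the expansion of \<open>(f - m) + (m - c)\<close> the cross term integrates to 0.
  This converts the Poincare inequality with a free constant into the one with the mean.\<close>

lemma (in finite_measure) mean_minimizes:
  fixes f :: "'a \<Rightarrow> real"
  assumes f: "square_integrable M f" and m: "m * measure M (space M) = (LINT x|M. f x)"
  shows "(LINT x|M. (f x - m)\<^sup>2) \<le> (LINT x|M. (f x - c)\<^sup>2)"
proof -
  have fi: "integrable M f" using f by (rule square_integrable_imp_integrable)
  have f2: "integrable M (\<lambda>x. (f x - m)\<^sup>2)"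
    using square_integrable_diff[OF f square_integrable_const[of m]] by (simp add: square_integrable_def)
  have "(LINT x|M. f x - m) = 0" using fi m by (simp add: mult.commute)
  then have "(LINT x|M. (f x - m)\<^sup>2) \<le> (LINT x|M. (f x - m)\<^sup>2) + 2 * (m - c) * (LINT x|M. f x - m) + measure M (space M) * (m - c)\<^sup>2"
    by simp
  also have "\<dots> = (LINT x|M. (f x - m)\<^sup>2 + 2 * (m - c) * (f x - m) + (m - c)\<^sup>2)"
    using fi f2 by simp
  also have "\<dots> = (LINT x|M. (f x - c)\<^sup>2)"
    by (intro Bochner_Integration.integral_cong refl) (simp add: power2_eq_square algebra_simps)
  finally show ?thesis .
qed

section \<open>Between Lebesgue measure on the domain and Borel functions on the whole space\<close>

lemma
  fixes k :: "'a::euclidean_space \<Rightarrow> real"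
  assumes \<Omega>: "\<Omega> \<in> sets lebesgue" and k: "k \<in> borel_measurable (lebesgue_on \<Omega>)"
    and k' [measurable]: "k' \<in> borel_measurable borel"
    and ae: "AE x in lborel. (if x \<in> \<Omega> then k x else 0) = k' x"
  shows integrable_lebesgue_on_lborel: "integrable (lebesgue_on \<Omega>) k \<longleftrightarrow> integrable lborel k'"
    and integral_lebesgue_on_lborel: "(LINT x|lebesgue_on \<Omega>. k x) = (LINT x|lborel. k' x)"
proof -
  let ?k = "\<lambda>x. if x \<in> \<Omega> then k x else 0"
  have m: "?k \<in> borel_measurable lebesgue" using k \<Omega> by (simp add: borel_measurable_if)
  have m': "k' \<in> borel_measurable lebesgue" using k' by (intro measurable_completion) simp
  have ae': "AE x in lebesgue. ?k x = k' x" using ae by (rule AE_completion)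
  have "integrable (lebesgue_on \<Omega>) k \<longleftrightarrow> integrable lebesgue ?k"
    by (rule Lebesgue_Measure.integrable_restrict_UNIV[OF \<Omega>, symmetric])
  also have "\<dots> \<longleftrightarrow> integrable lebesgue k'" by (rule integrable_cong_AE[OF m m' ae'])
  also have "\<dots> \<longleftrightarrow> integrable lborel k'" by (rule integrable_completion) simp
  finally show "integrable (lebesgue_on \<Omega>) k \<longleftrightarrow> integrable lborel k'" .
  have "(LINT x|lebesgue_on \<Omega>. k x) = (LINT x|lebesgue. ?k x)"
    by (rule Lebesgue_Measure.integral_restrict_UNIV[OF \<Omega>, symmetric])
  also have "\<dots> = (LINT x|lebesgue. k' x)" by (rule integral_cong_AE[OF m m' ae'])
  also have "\<dots> = (LINT x|lborel. k' x)" by (rule integral_completion) simp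
  finally show "(LINT x|lebesgue_on \<Omega>. k x) = (LINT x|lborel. k' x)" .
qed

lemma lebesgue_on_ex_borel:
  fixes f :: "'a::euclidean_space \<Rightarrow> real"
  assumes "\<Omega> \<in> sets lebesgue" "f \<in> borel_measurable (lebesgue_on \<Omega>)"
  obtains f' where "f' \<in> borel_measurable borel" "AE x in lborel. (if x \<in> \<Omega> then f x else 0) = f' x"
proof -
  have "(\<lambda>x. if x \<in> \<Omega> then f x else 0) \<in> borel_measurable lebesgue"
    using assms by (simp add: borel_measurable_if)
  from completion_ex_borel_measurable_real[OF this] show ?thesis using that by auto
qed

section \<open>Sobolev functions on a bounded open set\<close>

lemma AE_lebesgue_on_iff:
  assumes "\<Omega> \<in> sets lebesgue"
  shows "(AE x in lebesgue_on \<Omega>. P x) \<longleftrightarrow> (AE x in lborel. x \<in> \<Omega> \<longrightarrow> P x)"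
  using assms by (simp add: AE_restrict_space_iff AE_completion_iff)

locale bounded_open_domain =
  fixes \<Omega> :: "(real^2) set"
  assumes open_domain: "open \<Omega>" and bounded_domain: "bounded \<Omega>"
begin

abbreviation M where "M \<equiv> lebesgue_on \<Omega>"

lemma sets_domain [simp]: "\<Omega> \<in> sets lebesgue"
  using open_domain by (simp add: borel_open)

sublocale finite_measure M
  using lmeasurable_open[OF bounded_domain open_domain] by (rule finite_measure_lebesgue_on)

lemma L2_iff: "f \<in> L2 \<Omega> \<longleftrightarrow> square_integrable M f"
  by (simp add: L2_def square_integrable_def)

lemma continuous_measurable: "continuous_on UNIV (\<phi> :: real^2 \<Rightarrow> real) \<Longrightarrow> \<phi> \<in> borel_measurable M"
  by (rule continuous_imp_measurable_on_sets_lebesgue) (auto intro: continuous_on_subset)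

lemma bounded_continuous_square_integrable:
  fixes \<phi> :: "real^2 \<Rightarrow> real"
  assumes c: "continuous_on UNIV \<phi>" and b: "\<And>x. \<bar>\<phi> x\<bar> \<le> B"
  shows "square_integrable M \<phi>"
  unfolding square_integrable_def
proof
  show m: "\<phi> \<in> borel_measurable M" using c by (rule continuous_measurable)
  show "integrable M (\<lambda>x. (norm (\<phi> x))\<^sup>2)"
  proof (rule integrable_const_bound)
    show "AE x in M. norm ((norm (\<phi> x))\<^sup>2) \<le> B\<^sup>2"
      using b power_mono[of "\<bar>\<phi> x\<bar>" B 2 for x] by auto
  qed (use m in measurable)
qed

lemma test_function_square_integrable:
  assumes "test_function \<Omega> \<phi> \<phi>'"
  shows "square_integrable M \<phi>" "square_integrable M (\<lambda>x. \<phi>' x $ i)"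
proof -
  obtain B where B: "\<And>x. \<bar>\<phi> x\<bar> \<le> B" "\<And>x. norm (\<phi>' x) \<le> B" "B \<ge> 0"
    and c: "continuous_on UNIV \<phi>" "continuous_on UNIV \<phi>'"
    using test_function_bounded[OF assms] by metis
  show "square_integrable M \<phi>" using c(1) B(1) by (rule bounded_continuous_square_integrable)
  show "square_integrable M (\<lambda>x. \<phi>' x $ i)"
    using c(2) order_trans[OF component_le_norm_cart B(2)]
    by (intro bounded_continuous_square_integrable continuous_intros)
qed

lemma integrable_mult_square_integrable:
  fixes f g :: "real^2 \<Rightarrow> real"
  assumes "square_integrable M f" "square_integrable M g"
  shows "integrable M (\<lambda>x. f x * g x)"
  using square_integrable_inner[OF assms] by simp

lemma du_bois_reymond_lebesgue_on:
  fixes k :: "real^2 \<Rightarrow> real"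
  assumes k: "square_integrable M k"
    and test: "\<And>\<phi> \<phi>'. test_function \<Omega> \<phi> \<phi>' \<Longrightarrow> (LINT x|M. k x * \<phi> x) = 0"
  shows "AE x in M. k x = 0"
proof -
  have km: "k \<in> borel_measurable M" and ki: "integrable M k"
    using k square_integrable_imp_integrable[OF k] by (auto simp: square_integrable_def)
  obtain k' where k' [measurable]: "k' \<in> borel_measurable borel"
    and ae: "AE x in lborel. (if x \<in> \<Omega> then k x else 0) = k' x"
    using lebesgue_on_ex_borel[OF sets_domain km] .
  have "AE x in lborel. x \<in> \<Omega> \<longrightarrow> k' x = 0"
  proof (rule du_bois_reymond[OF open_domain])
    show "integrable lborel k'"
      using integrable_lebesgue_on_lborel[OF sets_domain km k' ae] ki by blast
    fix \<phi> \<phi>' assume t: "test_function \<Omega> \<phi> \<phi>'"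
    then have c: "continuous_on UNIV \<phi>" using test_function_bounded by metis
    then have [measurable]: "\<phi> \<in> borel_measurable borel" by (rule borel_measurable_continuous_onI)
    have "(LINT x|M. k x * \<phi> x) = (LINT x|lborel. k' x * \<phi> x)"
    proof (rule integral_lebesgue_on_lborel)
      show "(\<lambda>x. k x * \<phi> x) \<in> borel_measurable M"
        using km continuous_measurable[OF c] by (rule borel_measurable_times)
      show "AE x in lborel. (if x \<in> \<Omega> then k x * \<phi> x else 0) = k' x * \<phi> x"
        using ae by eventually_elim auto
    qed auto
    then show "(LINT x|lborel. k' x * \<phi> x) = 0" using test[OF t] by simp
  qed
  then show ?thesis unfolding AE_lebesgue_on_iff[OF sets_domain]
    using ae by eventually_elim auto
qed

section \<open>Linearity and uniqueness of weak gradients\<close>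

lemma weak_gradient_iff:
  "weak_gradient \<Omega> f g \<longleftrightarrow> square_integrable M g \<and>
     (\<forall>\<phi> \<phi>'. test_function \<Omega> \<phi> \<phi>' \<longrightarrow>
        (\<forall>i. (LINT x|M. f x * \<phi>' x $ i) = - (LINT x|M. g x $ i * \<phi> x)))"
  unfolding weak_gradient_def L2_iff square_integrable_iff_nth ..

lemma weak_gradient_diff:
  assumes "f1 \<in> L2 \<Omega>" "f2 \<in> L2 \<Omega>" "weak_gradient \<Omega> f1 g1" "weak_gradient \<Omega> f2 g2"
  shows "weak_gradient \<Omega> (\<lambda>x. f1 x - f2 x) (\<lambda>x. g1 x - g2 x)"
  unfolding weak_gradient_iff
proof (intro conjI allI impI)
  have g: "square_integrable M g1" "square_integrable M g2"
    using assms by (auto simp: weak_gradient_iff)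
  then show "square_integrable M (\<lambda>x. g1 x - g2 x)" by (rule square_integrable_diff)
  fix \<phi> \<phi>' i assume t: "test_function \<Omega> \<phi> \<phi>'"
  note si = test_function_square_integrable[OF t]
  have gi: "square_integrable M (\<lambda>x. g1 x $ i)" "square_integrable M (\<lambda>x. g2 x $ i)"
    using g by (simp_all add: square_integrable_iff_nth)
  have "(LINT x|M. (f1 x - f2 x) * \<phi>' x $ i) = (LINT x|M. f1 x * \<phi>' x $ i) - (LINT x|M. f2 x * \<phi>' x $ i)"
    using assms(1,2)[unfolded L2_iff, THEN integrable_mult_square_integrable, OF si(2)]
    by (simp add: left_diff_distrib)
  also have "\<dots> = - (LINT x|M. g1 x $ i * \<phi> x) + (LINT x|M. g2 x $ i * \<phi> x)"
    using assms(3,4) t by (simp add: weak_gradient_iff)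
  also have "\<dots> = - (LINT x|M. (g1 x - g2 x) $ i * \<phi> x)"
    using gi[THEN integrable_mult_square_integrable, OF si(1)] by (simp add: left_diff_distrib)
  finally show "(LINT x|M. (f1 x - f2 x) * \<phi>' x $ i) = - (LINT x|M. (g1 x - g2 x) $ i * \<phi> x)" .
qed

lemma weak_gradient_scale:
  assumes "weak_gradient \<Omega> f g"
  shows "weak_gradient \<Omega> (\<lambda>x. c * f x) (\<lambda>x. c *\<^sub>R g x)"
  using assms by (auto simp: weak_gradient_iff mult.assoc intro: square_integrable_scaleR)

text \<open>The gradient of a test function vanishes outside \<open>\<Omega>\<close>, so its
  integral over \<open>\<Omega>\<close> is the integral over the plane, which is 0.\<close>

lemma weak_gradient_const: "weak_gradient \<Omega> (\<lambda>x. c) (\<lambda>x. 0)"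
  unfolding weak_gradient_iff
proof (intro conjI allI impI)
  show "square_integrable M (\<lambda>x. 0 :: real^2)" by (simp add: square_integrable_def)
  fix \<phi> \<phi>' i assume t: "test_function \<Omega> \<phi> \<phi>'"
  have c: "continuous_on UNIV \<phi>'" and z: "\<And>x. x \<notin> \<Omega> \<Longrightarrow> \<phi>' x = 0"
    using test_function_bounded[OF t] by metis+
  have "(LINT x|M. \<phi>' x $ i) = (LINT x|lborel. \<phi>' x $ i)"
  proof (rule integral_lebesgue_on_lborel)
    show "(\<lambda>x. \<phi>' x $ i) \<in> borel_measurable M" "(\<lambda>x. \<phi>' x $ i) \<in> borel_measurable borel"
      using c by (auto intro!: continuous_measurable borel_measurable_continuous_onI continuous_intros)
  qed (use z in auto)
  also have "\<dots> = 0"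
    using integral_test_function_gradient[OF t, of "axis i 1"] by (simp add: inner_axis)
  finally show "(LINT x|M. c * \<phi>' x $ i) = - (LINT x|M. 0 $ i * \<phi> x)" by simp
qed

text \<open>\<open>grad\<close> is a choice of representative. By this uniqueness its values agree
  almost everywhere with any weak gradient that is computed by hand, which is how linearity passes
  to \<open>grad\<close> and \<open>jacobian\<close>.\<close>

lemma weak_gradient_unique:
  assumes "weak_gradient \<Omega> f g1" "weak_gradient \<Omega> f g2"
  shows "AE x in M. g1 x = g2 x"
proof -
  have "AE x in M. g1 x $ i - g2 x $ i = 0" for i
  proof (rule du_bois_reymond_lebesgue_on)
    have g: "square_integrable M (\<lambda>x. g1 x $ i)" "square_integrable M (\<lambda>x. g2 x $ i)"
      using assms by (auto simp: weak_gradient_iff square_integrable_iff_nth)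
    then show "square_integrable M (\<lambda>x. g1 x $ i - g2 x $ i)" by (rule square_integrable_diff)
    fix \<phi> \<phi>' assume t: "test_function \<Omega> \<phi> \<phi>'"
    have "(LINT x|M. f x * \<phi>' x $ i) = - (LINT x|M. g1 x $ i * \<phi> x)"
      "(LINT x|M. f x * \<phi>' x $ i) = - (LINT x|M. g2 x $ i * \<phi> x)"
      using assms t unfolding weak_gradient_iff by blast+
    then have "(LINT x|M. g1 x $ i * \<phi> x) = (LINT x|M. g2 x $ i * \<phi> x)" by linarith
    then show "(LINT x|M. (g1 x $ i - g2 x $ i) * \<phi> x) = 0"
      using g[THEN integrable_mult_square_integrable, OF test_function_square_integrable(1)[OF t]]
      by (simp add: left_diff_distrib)
  qed
  then have "AE x in M. \<forall>i. g1 x $ i - g2 x $ i = 0" by (simp add: AE_all_countable)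
  then show ?thesis by eventually_elim (simp add: vec_eq_iff)
qed

lemma H1_weak_gradient: "f \<in> H1 \<Omega> \<Longrightarrow> weak_gradient \<Omega> f (grad \<Omega> f)"
  unfolding H1_def grad_def by (auto intro: someI[of "weak_gradient \<Omega> f"])

lemma H1_L2: "f \<in> H1 \<Omega> \<Longrightarrow> f \<in> L2 \<Omega>"
  by (simp add: H1_def)

lemma H1I: "f \<in> L2 \<Omega> \<Longrightarrow> weak_gradient \<Omega> f g \<Longrightarrow> f \<in> H1 \<Omega>"
  by (auto simp: H1_def)

lemma grad_AE_eq: "weak_gradient \<Omega> f g \<Longrightarrow> AE x in M. grad \<Omega> f x = g x"
  by (rule weak_gradient_unique[of f]) (auto simp: grad_def intro: someI[of "weak_gradient \<Omega> f"])

lemma H1_diff: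
  assumes "f1 \<in> H1 \<Omega>" "f2 \<in> H1 \<Omega>"
  shows "(\<lambda>x. f1 x - f2 x) \<in> H1 \<Omega>" "AE x in M. grad \<Omega> (\<lambda>x. f1 x - f2 x) x = grad \<Omega> f1 x - grad \<Omega> f2 x"
proof -
  have w: "weak_gradient \<Omega> (\<lambda>x. f1 x - f2 x) (\<lambda>x. grad \<Omega> f1 x - grad \<Omega> f2 x)"
    using assms by (intro weak_gradient_diff H1_L2 H1_weak_gradient)
  show "(\<lambda>x. f1 x - f2 x) \<in> H1 \<Omega>"
    using assms[THEN H1_L2] by (intro H1I[OF _ w]) (auto simp: L2_iff intro: square_integrable_diff)
  show "AE x in M. grad \<Omega> (\<lambda>x. f1 x - f2 x) x = grad \<Omega> f1 x - grad \<Omega> f2 x"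
    using w by (rule grad_AE_eq)
qed

lemma H1_scale:
  assumes "f \<in> H1 \<Omega>"
  shows "(\<lambda>x. c * f x) \<in> H1 \<Omega>" "AE x in M. grad \<Omega> (\<lambda>x. c * f x) x = c *\<^sub>R grad \<Omega> f x"
proof -
  have w: "weak_gradient \<Omega> (\<lambda>x. c * f x) (\<lambda>x. c *\<^sub>R grad \<Omega> f x)"
    using assms by (intro weak_gradient_scale H1_weak_gradient)
  show "(\<lambda>x. c * f x) \<in> H1 \<Omega>"
    using assms square_integrable_scaleR[of M f c] by (intro H1I[OF _ w]) (auto simp: L2_iff dest: H1_L2)
  show "AE x in M. grad \<Omega> (\<lambda>x. c * f x) x = c *\<^sub>R grad \<Omega> f x"
    using w by (rule grad_AE_eq)
qed

lemma H1_const: "(\<lambda>x. c) \<in> H1 \<Omega>" "AE x in M. grad \<Omega> (\<lambda>x. c) x = 0"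
  using H1I[OF _ weak_gradient_const] grad_AE_eq[OF weak_gradient_const]
  by (auto simp: L2_iff square_integrable_const)

section \<open>The spaces of pairs as spaces of square-integrable functions\<close>

lemma X0_iff: "u \<in> X0 \<Omega> \<longleftrightarrow> square_integrable M u"
  by (simp add: X0_def L2_iff square_integrable_iff_nth)

lemma X1_X0: "u \<in> X1 \<Omega> \<Longrightarrow> u \<in> X0 \<Omega>"
  by (simp add: X1_def X0_def H1_L2)

lemma norm_X0_eq:
  assumes "u \<in> X0 \<Omega>"
  shows "norm_X0 \<Omega> u = sqrt (LINT x|M. (norm (u x))\<^sup>2)"
proof -
  have "square_integrable M (\<lambda>x. u x $ i)" for i
    using assms by (simp add: X0_iff square_integrable_iff_nth)
  then have "integrable M (\<lambda>x. (u x $ i)\<^sup>2)" for i by (simp add: square_integrable_def)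
  then show ?thesis
    by (simp add: norm_X0_def norm_L2_def power2_norm_vec_eq_sum sum_2)
qed

lemma jacobian_square_integrable:
  assumes "u \<in> X1 \<Omega>"
  shows "square_integrable M (jacobian \<Omega> u)"
proof -
  have "square_integrable M (\<lambda>x. jacobian \<Omega> u x $ i)" for i
    using assms H1_weak_gradient[of "\<lambda>x. u x $ i"] by (simp add: X1_def jacobian_def weak_gradient_iff)
  then show ?thesis by (simp add: square_integrable_iff_nth[of M "jacobian \<Omega> u"])
qed

text \<open>Mapping \<open>u\<close> to the pair of \<open>u\<close> and its Jacobian turns the norm
  of \<open>X1\<close> into an \<open>L2\<close> norm, so its triangle inequality is that of
  square-integrable functions.\<close>

lemma norm_X1_eq:
  assumes u: "u \<in> X1 \<Omega>"
  shows "norm_X1 \<Omega> u = sqrt (LINT x|M. (norm (u x, jacobian \<Omega> u x))\<^sup>2)"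
proof -
  have "integrable M (\<lambda>x. (norm (u x))\<^sup>2)" and J: "integrable M (\<lambda>x. (norm (jacobian \<Omega> u x))\<^sup>2)"
    using X1_X0[OF u] jacobian_square_integrable[OF u] by (simp_all add: X0_iff square_integrable_def)
  then have "(LINT x|M. (norm (u x, jacobian \<Omega> u x))\<^sup>2) =
      (LINT x|M. (norm (u x))\<^sup>2) + (LINT x|M. (norm (jacobian \<Omega> u x))\<^sup>2)"
    by (simp add: norm_Pair)
  also have "(LINT x|M. (norm (u x))\<^sup>2) = (norm_X0 \<Omega> u)\<^sup>2"
    using norm_X0_eq[OF X1_X0[OF u]] by simp
  also have "(LINT x|M. (norm (jacobian \<Omega> u x))\<^sup>2) =
      (LINT x|M. (norm (grad \<Omega> (\<lambda>y. u y $ 1) x))\<^sup>2) + (LINT x|M. (norm (grad \<Omega> (\<lambda>y. u y $ 2) x))\<^sup>2)"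
  proof -
    have "integrable M (\<lambda>x. (norm (grad \<Omega> (\<lambda>y. u y $ i) x))\<^sup>2)" for i
      using u H1_weak_gradient[of "\<lambda>x. u x $ i"] by (simp add: X1_def weak_gradient_iff square_integrable_def)
    then show ?thesis by (simp add: power2_norm_vec_eq_sum sum_2 jacobian_def)
  qed
  finally show ?thesis
    by (simp add: norm_X1_def norm_H1_def norm_X0_def algebra_simps)
qed

lemma X1_pair_square_integrable: "u \<in> X1 \<Omega> \<Longrightarrow> square_integrable M (\<lambda>x. (u x, jacobian \<Omega> u x))"
  using X1_X0 jacobian_square_integrable by (intro square_integrable_Pair) (auto simp: X0_iff)

lemma X1_diff:
  assumes "u \<in> X1 \<Omega>" "v \<in> X1 \<Omega>"
  shows "u - v \<in> X1 \<Omega>" "AE x in M. jacobian \<Omega> (u - v) x = jacobian \<Omega> u x - jacobian \<Omega> v x"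
proof -
  show "u - v \<in> X1 \<Omega>" using assms H1_diff(1) by (auto simp: X1_def fun_diff_def)
  have "AE x in M. \<forall>i. grad \<Omega> (\<lambda>x. u x $ i - v x $ i) x = grad \<Omega> (\<lambda>x. u x $ i) x - grad \<Omega> (\<lambda>x. v x $ i) x"
    using assms H1_diff(2) by (auto simp: X1_def AE_all_countable)
  then show "AE x in M. jacobian \<Omega> (u - v) x = jacobian \<Omega> u x - jacobian \<Omega> v x"
    by eventually_elim (simp add: jacobian_def fun_diff_def vec_eq_iff)
qed

lemma X1_const: "(\<lambda>x. c) \<in> X1 \<Omega>" "AE x in M. jacobian \<Omega> (\<lambda>x. c) x = 0"
proof -
  show "(\<lambda>x. c) \<in> X1 \<Omega>" using H1_const(1) by (simp add: X1_def)
  have "AE x in M. \<forall>i. grad \<Omega> (\<lambda>x. c $ i) x = 0"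
    using H1_const(2) by (simp add: AE_all_countable)
  then show "AE x in M. jacobian \<Omega> (\<lambda>x. c) x = 0"
    by eventually_elim (simp add: jacobian_def vec_eq_iff)
qed

lemma norm_X1_nonneg: "norm_X1 \<Omega> u \<ge> 0"
  by (simp add: norm_X1_def)

lemma norm_X1_diff_eq:
  assumes "u \<in> X1 \<Omega>" "v \<in> X1 \<Omega>"
  shows "norm_X1 \<Omega> (u - v) = sqrt (LINT x|M. (norm ((u x, jacobian \<Omega> u x) - (v x, jacobian \<Omega> v x)))\<^sup>2)"
proof -
  have "(LINT x|M. (norm ((u - v) x, jacobian \<Omega> (u - v) x))\<^sup>2) =
      (LINT x|M. (norm ((u x, jacobian \<Omega> u x) - (v x, jacobian \<Omega> v x)))\<^sup>2)"
  proof (rule integral_cong_AE)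
    show "AE x in M. (norm ((u - v) x, jacobian \<Omega> (u - v) x))\<^sup>2 =
        (norm ((u x, jacobian \<Omega> u x) - (v x, jacobian \<Omega> v x)))\<^sup>2"
      using X1_diff(2)[OF assms] by eventually_elim simp
    show "(\<lambda>x. (norm ((u - v) x, jacobian \<Omega> (u - v) x))\<^sup>2) \<in> borel_measurable M"
      using X1_pair_square_integrable[OF X1_diff(1)[OF assms]] by (auto simp: square_integrable_def)
    show "(\<lambda>x. (norm ((u x, jacobian \<Omega> u x) - (v x, jacobian \<Omega> v x)))\<^sup>2) \<in> borel_measurable M"
      using square_integrable_diff[OF assms[THEN X1_pair_square_integrable]]
      by (auto simp: square_integrable_def)
  qed
  then show ?thesis using norm_X1_eq[OF X1_diff(1)[OF assms]] by simp
qed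

lemma norm_X1_diff_commute:
  assumes "u \<in> X1 \<Omega>" "v \<in> X1 \<Omega>"
  shows "norm_X1 \<Omega> (u - v) = norm_X1 \<Omega> (v - u)"
  unfolding norm_X1_diff_eq[OF assms] norm_X1_diff_eq[OF assms(2,1)]
  by (subst norm_minus_commute) (rule refl)

lemma norm_X1_diff_triangle:
  assumes "u \<in> X1 \<Omega>" "v \<in> X1 \<Omega>" "w \<in> X1 \<Omega>"
  shows "norm_X1 \<Omega> (u - w) \<le> norm_X1 \<Omega> (u - v) + norm_X1 \<Omega> (v - w)"
proof -
  note p = assms[THEN X1_pair_square_integrable]
  show ?thesis
    using square_integrable_norm_triangle[OF square_integrable_diff[OF p(1,2)] square_integrable_diff[OF p(2,3)]]
    unfolding norm_X1_diff_eq[OF assms(1,3)] norm_X1_diff_eq[OF assms(1,2)] norm_X1_diff_eq[OF assms(2,3)]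
    by simp
qed

lemma norm_X1_diff_zero:
  assumes "u \<in> X1 \<Omega>"
  shows "norm_X1 \<Omega> (u - (\<lambda>x. 0)) = norm_X1 \<Omega> u"
  by (simp add: fun_diff_def)

section \<open>Functionals on the Sobolev space\<close>

lemma norm_H1_scale:
  assumes "f \<in> H1 \<Omega>"
  shows "norm_H1 \<Omega> (\<lambda>x. c * f x) = \<bar>c\<bar> * norm_H1 \<Omega> f"
proof -
  have "(LINT x|M. (norm (grad \<Omega> (\<lambda>x. c * f x) x))\<^sup>2) = (LINT x|M. (norm (c *\<^sub>R grad \<Omega> f x))\<^sup>2)"
  proof (rule integral_cong_AE)
    show "AE x in M. (norm (grad \<Omega> (\<lambda>x. c * f x) x))\<^sup>2 = (norm (c *\<^sub>R grad \<Omega> f x))\<^sup>2"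
      using H1_scale(2)[OF assms, of c] by eventually_elim simp
    show "(\<lambda>x. (norm (grad \<Omega> (\<lambda>x. c * f x) x))\<^sup>2) \<in> borel_measurable M"
      using H1_weak_gradient[OF H1_scale(1)[OF assms]]
      by (auto simp: weak_gradient_iff square_integrable_def)
    show "(\<lambda>x. (norm (c *\<^sub>R grad \<Omega> f x))\<^sup>2) \<in> borel_measurable M"
      using square_integrable_scaleR[of M "grad \<Omega> f" c] H1_weak_gradient[OF assms]
      by (auto simp: weak_gradient_iff square_integrable_def)
  qed
  then have "(norm_L2 \<Omega> (\<lambda>x. c * f x))\<^sup>2 + (LINT x|M. (norm (grad \<Omega> (\<lambda>x. c * f x) x))\<^sup>2) =
      c\<^sup>2 * ((norm_L2 \<Omega> f)\<^sup>2 + (LINT x|M. (norm (grad \<Omega> f x))\<^sup>2))"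
    by (simp add: norm_L2_def power_mult_distrib distrib_left)
  then show ?thesis by (simp add: norm_H1_def real_sqrt_mult)
qed

text \<open>Evaluation at a fixed function is continuous for the dual norm, with a constant that
  does not depend on the functional. This is what makes \<open>t\<close> to \<open>F t w\<close>
  measurable for a Bochner function \<open>F\<close>.\<close>

lemma H1_dual_bound:
  assumes f: "f \<in> H1 \<Omega>"
  shows "\<exists>c. \<forall>F\<in>H1_dual \<Omega>. \<bar>F f\<bar> \<le> c * norm_H1_dual \<Omega> F"
proof (intro exI ballI)
  \<comment> \<open>Dividing by the norm plus 1 puts \<open>f\<close> in the unit ball even if its
    norm is 0.\<close>
  define c where "c = norm_H1 \<Omega> f + 1"
  have n: "norm_H1 \<Omega> f \<ge> 0" by (simp add: norm_H1_def)
  then have c: "c > 0" by (simp add: c_def)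
  fix F assume "F \<in> H1_dual \<Omega>"
  then obtain K where lin: "\<And>c f. f \<in> H1 \<Omega> \<Longrightarrow> F (\<lambda>x. c * f x) = c * F f"
    and K: "\<And>f. f \<in> H1 \<Omega> \<Longrightarrow> \<bar>F f\<bar> \<le> K * norm_H1 \<Omega> f"
    unfolding H1_dual_def by blast
  let ?g = "\<lambda>x. (1 / c) * f x"
  have g: "?g \<in> H1 \<Omega>" "norm_H1 \<Omega> ?g \<le> 1"
    using H1_scale(1)[OF f, of "1 / c"] norm_H1_scale[OF f, of "1 / c"] c n by (auto simp: c_def)
  have bdd: "bdd_above ((\<lambda>f. \<bar>F f\<bar>) ` {f \<in> H1 \<Omega>. norm_H1 \<Omega> f \<le> 1})"
  proof (rule bdd_aboveI2)
    fix f assume f: "f \<in> {f \<in> H1 \<Omega>. norm_H1 \<Omega> f \<le> 1}"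
    then have "\<bar>F f\<bar> \<le> K * norm_H1 \<Omega> f" using K by blast
    also have "\<dots> \<le> \<bar>K\<bar> * 1"
      using f by (intro mult_mono) (auto simp: norm_H1_def)
    finally show "\<bar>F f\<bar> \<le> \<bar>K\<bar>" by simp
  qed
  have Fg: "\<bar>F ?g\<bar> \<le> norm_H1_dual \<Omega> F"
    unfolding norm_H1_dual_def by (rule cSUP_upper[OF _ bdd]) (use g in auto)
  have "F f = c * F ?g" using lin[OF f, of "1 / c"] c by simp
  then show "\<bar>F f\<bar> \<le> c * norm_H1_dual \<Omega> F"
    using mult_left_mono[OF Fg, of c] c by (simp add: abs_mult)
qed

lemma H1_dual_diff:
  assumes "F \<in> H1_dual \<Omega>" "G \<in> H1_dual \<Omega>"
  shows "F - G \<in> H1_dual \<Omega>"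
proof -
  obtain K L where K: "\<forall>f\<in>H1 \<Omega>. \<bar>F f\<bar> \<le> K * norm_H1 \<Omega> f" and L: "\<forall>f\<in>H1 \<Omega>. \<bar>G f\<bar> \<le> L * norm_H1 \<Omega> f"
    using assms unfolding H1_dual_def by blast
  have "\<forall>f\<in>H1 \<Omega>. \<bar>F f - G f\<bar> \<le> (K + L) * norm_H1 \<Omega> f"
  proof
    fix f assume "f \<in> H1 \<Omega>"
    then have "\<bar>F f\<bar> \<le> K * norm_H1 \<Omega> f" "\<bar>G f\<bar> \<le> L * norm_H1 \<Omega> f" using K L by auto
    then show "\<bar>F f - G f\<bar> \<le> (K + L) * norm_H1 \<Omega> f" by (simp add: distrib_right)
  qed
  then show ?thesis using assms unfolding H1_dual_def fun_diff_def
    by (auto simp: right_diff_distrib)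
qed

end

section \<open>Difference quotients in time\<close>

text \<open>The integral of a backward difference telescopes: only the integrals over the intervals
  of length \<open>h\<close> that end at \<open>d\<close> and at \<open>c\<close> remain. Divided by
  \<open>h\<close>, these tend to the values of a continuous \<open>\<phi>\<close> at the two
  ends.\<close>

lemma integral_difference_shift:
  fixes \<phi> :: "real \<Rightarrow> real"
  assumes \<phi>: "continuous_on {0..T} \<phi>" and "0 \<le> h" "h \<le> c" "c \<le> d" "d \<le> T"
  defines "\<Phi> \<equiv> \<lambda>x. integral {0..x} \<phi>"
  shows "integrable (lebesgue_on {c..d}) (\<lambda>t. \<phi> t - \<phi> (t - h))"
    and "(LINT t|lebesgue_on {c..d}. \<phi> t - \<phi> (t - h)) = (\<Phi> d - \<Phi> (d - h)) - (\<Phi> c - \<Phi> (c - h))"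
proof -
  have c1: "continuous_on {c..d} \<phi>" using assms by (intro continuous_on_subset[OF \<phi>]) auto
  have c2: "continuous_on {c..d} (\<lambda>t. \<phi> (t - h))"
    by (rule continuous_on_compose2[OF \<phi>]) (use assms in \<open>auto intro!: continuous_intros\<close>)
  show i: "integrable (lebesgue_on {c..d}) (\<lambda>t. \<phi> t - \<phi> (t - h))"
    using c1 c2 by (intro continuous_imp_integrable_real continuous_intros)
  have comb: "integral {x..y} \<phi> = \<Phi> y - \<Phi> x" if "0 \<le> x" "x \<le> y" "y \<le> T" for x y
  proof -
    have "\<phi> integrable_on {0..y}"
      using that by (intro integrable_continuous_real continuous_on_subset[OF \<phi>]) auto
    then have "integral {0..x} \<phi> + integral {x..y} \<phi> = integral {0..y} \<phi>"
      using that by (intro Henstock_Kurzweil_Integration.integral_combine) auto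
    then show ?thesis by (simp add: \<Phi>_def)
  qed
  have "(LINT t|lebesgue_on {c..d}. \<phi> t - \<phi> (t - h)) = integral {c..d} (\<lambda>t. \<phi> t - \<phi> (t - h))"
    using i by (rule lebesgue_integral_eq_integral) simp
  also have "\<dots> = integral {c..d} \<phi> - integral {c..d} (\<lambda>t. \<phi> (t - h))"
    using c1 c2 by (intro Henstock_Kurzweil_Integration.integral_diff integrable_continuous_real)
  also have "integral {c..d} (\<lambda>t. \<phi> (t - h)) = integral {c - h..d - h} \<phi>"
    using integral_shift_real_ivl[of "c - h" "- h" "d - h" \<phi>] by simp
  finally show "(LINT t|lebesgue_on {c..d}. \<phi> t - \<phi> (t - h)) = (\<Phi> d - \<Phi> (d - h)) - (\<Phi> c - \<Phi> (c - h))"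
    using comb[of c d] comb[of "c - h" "d - h"] assms by simp
qed

lemma left_difference_quotient_tendsto:
  fixes \<phi> :: "real \<Rightarrow> real"
  assumes \<phi>: "continuous_on {0..T} \<phi>" and x: "0 < x" "x \<le> T"
    and h: "\<And>n. 0 < h n" "\<And>n. h n \<le> x" "h \<longlonglongrightarrow> 0"
  shows "(\<lambda>n. (integral {0..x} \<phi> - integral {0..x - h n} \<phi>) / h n) \<longlonglongrightarrow> \<phi> x"
proof -
  let ?\<Phi> = "\<lambda>x. integral {0..x} \<phi>"
  have "(?\<Phi> has_real_derivative \<phi> x) (at x within {0..T})"
    using x by (intro integral_has_real_derivative[OF \<phi>]) auto
  then have lim: "((\<lambda>y. (?\<Phi> y - ?\<Phi> x) / (y - x)) \<longlongrightarrow> \<phi> x) (at x within {0..T})"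
    by (simp add: has_field_derivative_iff)
  have "(\<lambda>n. x - h n) \<longlonglongrightarrow> x - 0" using h(3) by (intro tendsto_intros)
  moreover have "x - h n \<in> {0..T} - {x}" for n
    using h(1)[of n] h(2)[of n] x by auto
  ultimately have "filterlim (\<lambda>n. x - h n) (at x within {0..T}) sequentially"
    by (auto simp: filterlim_at)
  from filterlim_compose[OF lim this]
  have "(\<lambda>n. (?\<Phi> (x - h n) - ?\<Phi> x) / (x - h n - x)) \<longlonglongrightarrow> \<phi> x" .
  moreover have "(?\<Phi> (x - h n) - ?\<Phi> x) / (x - h n - x) = (?\<Phi> x - ?\<Phi> (x - h n)) / h n" for n
    using h(1)[of n] by (simp add: divide_simps)
  ultimately show ?thesis by simp
qed

lemma integral_difference_quotient_tendsto:
  fixes \<phi> :: "real \<Rightarrow> real"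
  assumes \<phi>: "continuous_on {0..T} \<phi>" and cd: "0 < c" "c \<le> d" "d \<le> T"
    and h: "\<And>n. 0 < h n" "\<And>n. h n \<le> c" "h \<longlonglongrightarrow> 0"
  shows "(\<lambda>n. LINT t|lebesgue_on {c..d}. (\<phi> t - \<phi> (t - h n)) / h n) \<longlonglongrightarrow> \<phi> d - \<phi> c"
proof -
  let ?\<Phi> = "\<lambda>x. integral {0..x} \<phi>"
  have "(\<lambda>n. (?\<Phi> d - ?\<Phi> (d - h n)) / h n - (?\<Phi> c - ?\<Phi> (c - h n)) / h n) \<longlonglongrightarrow> \<phi> d - \<phi> c"
    using cd h order_trans[OF h(2) cd(2)]
    by (intro tendsto_diff left_difference_quotient_tendsto[OF \<phi>]) auto
  moreover have "(LINT t|lebesgue_on {c..d}. (\<phi> t - \<phi> (t - h n)) / h n) =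
      (?\<Phi> d - ?\<Phi> (d - h n)) / h n - (?\<Phi> c - ?\<Phi> (c - h n)) / h n" for n
    using integral_difference_shift(2)[OF \<phi> less_imp_le[OF h(1)] h(2) cd(2,3), of n]
    by (simp add: diff_divide_distrib[symmetric])
  ultimately show ?thesis by simp
qed

section \<open>Real functions with square-integrable derivative\<close>

lemma square_integrable_subinterval:
  fixes g :: "real \<Rightarrow> real"
  assumes "square_integrable (lebesgue_on {a..b}) g" "{c..d} \<subseteq> {a..b}"
  shows "square_integrable (lebesgue_on {c..d}) g"
  unfolding square_integrable_def
proof
  show "g \<in> borel_measurable (lebesgue_on {c..d})"
    by (rule measurable_restrict_mono[of g lebesgue "{a..b}"]) (use assms in \<open>auto simp: square_integrable_def\<close>)
  show "integrable (lebesgue_on {c..d}) (\<lambda>x. (norm (g x))\<^sup>2)"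
    by (rule integrable_subinterval[of a b]) (use assms in \<open>auto simp: square_integrable_def\<close>)
qed

lemma finite_measure_lebesgue_on_Icc: "finite_measure (lebesgue_on {a..b::real})"
  by (rule finite_measure_lebesgue_on) (metis interval_cbox lmeasurable_cbox)

lemma square_integrable_imp_integrable_Icc:
  fixes g :: "real \<Rightarrow> real"
  assumes "square_integrable (lebesgue_on {a..b}) g"
  shows "integrable (lebesgue_on {a..b}) g"
  using finite_measure.square_integrable_imp_integrable[OF finite_measure_lebesgue_on_Icc assms] .

lemma square_integrable_continuous_Icc:
  fixes g :: "real \<Rightarrow> real"
  assumes "continuous_on {a..b} g"
  shows "square_integrable (lebesgue_on {a..b}) g"
proof -
  have "integrable (lebesgue_on {a..b}) (\<lambda>x. (g x)\<^sup>2)"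
    using assms by (intro continuous_imp_integrable_real continuous_intros)
  moreover have "g \<in> borel_measurable (lebesgue_on {a..b})"
    using assms by (intro continuous_imp_measurable_on_sets_lebesgue) auto
  ultimately show ?thesis by (simp add: square_integrable_def)
qed

text \<open>The Sobolev space \<open>H1\<close> of the interval in integrated form:
  \<open>\<Gamma>\<close> is the absolutely continuous representative and \<open>g\<close> its
  derivative.\<close>

locale square_integrable_primitive =
  fixes T :: real and \<Gamma> g :: "real \<Rightarrow> real"
  assumes sq: "square_integrable (lebesgue_on {0..T}) g"
    and primitive: "\<And>r t. 0 \<le> r \<Longrightarrow> r \<le> t \<Longrightarrow> t \<le> T \<Longrightarrow> \<Gamma> t - \<Gamma> r = (LINT \<tau>|lebesgue_on {r..t}. g \<tau>)"
begin

lemma continuous: "continuous_on {0..T} \<Gamma>"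
proof -
  have "continuous_on {0..T} (\<lambda>t. \<Gamma> 0 + (LINT \<tau>|lebesgue_on {0..t}. g \<tau>))"
    using square_integrable_imp_integrable_Icc[OF sq]
    by (intro continuous_intros indefinite_integral_continuous_real)
  moreover have "\<Gamma> 0 + (LINT \<tau>|lebesgue_on {0..t}. g \<tau>) = \<Gamma> t" if "t \<in> {0..T}" for t
    using primitive[of 0 t] that by simp
  ultimately show ?thesis using continuous_on_cong by (metis (no_types, lifting))
qed

lemma continuous_difference_quotient:
  assumes "0 < h" "h \<le> a" "b \<le> T"
  shows "continuous_on {a..b} (\<lambda>t. (\<Gamma> t - \<Gamma> (t - h)) / h)"
  using assms
  by (intro continuous_intros continuous_on_compose2[OF continuous]) auto

lemma difference_power2_le:
  assumes "0 \<le> h" "h \<le> t" "t \<le> T"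
  shows "(\<Gamma> t - \<Gamma> (t - h))\<^sup>2 \<le> h * (LINT \<tau>|lebesgue_on {t - h..t}. (g \<tau>)\<^sup>2)"
proof -
  let ?M = "lebesgue_on {t - h..t}"
  have g: "square_integrable ?M g" by (rule square_integrable_subinterval[OF sq]) (use assms in auto)
  have 1: "square_integrable ?M (\<lambda>_. 1 :: real)"
    by (rule finite_measure.square_integrable_const[OF finite_measure_lebesgue_on_Icc])
  have "\<bar>\<Gamma> t - \<Gamma> (t - h)\<bar> = \<bar>LINT \<tau>|?M. 1 * g \<tau>\<bar>"
    using primitive[of "t - h" t] assms by simp
  also have "\<dots> \<le> sqrt (LINT \<tau>|?M. (norm (1 :: real))\<^sup>2) * sqrt (LINT \<tau>|?M. (norm (g \<tau>))\<^sup>2)"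
    using Cauchy_Schwarz_integral[OF 1 g] by simp
  also have "(LINT \<tau>|?M. (norm (1 :: real))\<^sup>2) = h"
    using assms by (simp add: measure_restrict_space)
  finally have "\<bar>\<Gamma> t - \<Gamma> (t - h)\<bar>\<^sup>2 \<le> (sqrt h * sqrt (LINT \<tau>|?M. (g \<tau>)\<^sup>2))\<^sup>2"
    by (intro power_mono) auto
  then show ?thesis using assms by (simp add: power_mult_distrib)
qed

text \<open>Difference quotients are bounded in \<open>L2\<close> by the derivative, uniformly in
  \<open>h\<close>. Pointwise Cauchy-Schwarz leaves the difference quotient of the primitive
  \<open>P\<close> of the squared derivative; its integral telescopes to averages of
  \<open>P\<close> near the ends, and \<open>P\<close> is nonnegative and nondecreasing.\<close>

lemma integral_difference_quotient_power2_le: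
  assumes h: "0 < h" "h \<le> a" and ab: "a \<le> b" "b \<le> T"
  shows "(LINT t|lebesgue_on {a..b}. ((\<Gamma> t - \<Gamma> (t - h)) / h)\<^sup>2) \<le> (LINT t|lebesgue_on {0..T}. (g t)\<^sup>2)"
proof -
  define P where "P t = (LINT \<tau>|lebesgue_on {0..t}. (g \<tau>)\<^sup>2)" for t
  have g2: "integrable (lebesgue_on {0..T}) (\<lambda>t. (g t)\<^sup>2)" using sq by (simp add: square_integrable_def)
  have P: "continuous_on {0..T} P" unfolding P_def using g2 by (rule indefinite_integral_continuous_real)
  have Pdiff: "P t - P r = (LINT \<tau>|lebesgue_on {r..t}. (g \<tau>)\<^sup>2)" if "0 \<le> r" "r \<le> t" "t \<le> T" for r t
    using integral_combine[OF integrable_subinterval[OF g2], of 0 t r] that by (simp add: P_def)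
  have P0: "P t \<ge> 0" for t by (simp add: P_def)
  have PT: "P t \<le> P T" if "0 \<le> t" "t \<le> T" for t
  proof -
    have "(LINT \<tau>|lebesgue_on {t..T}. (g \<tau>)\<^sup>2) \<ge> 0" by simp
    then show ?thesis using Pdiff[of t T] that by linarith
  qed
  have Pint: "P integrable_on {x..y}" if "0 \<le> x" "y \<le> T" for x y
    using that by (intro integrable_continuous_real continuous_on_subset[OF P]) auto
  have IP: "integral {0..y} P - integral {0..y - h} P = integral {y - h..y} P" if "h \<le> y" "y \<le> T" for y
    using Henstock_Kurzweil_Integration.integral_combine[of 0 "y - h" y P] Pint[of 0 y] that h by simp
  have "(LINT t|lebesgue_on {a..b}. ((\<Gamma> t - \<Gamma> (t - h)) / h)\<^sup>2) \<le> (LINT t|lebesgue_on {a..b}. (P t - P (t - h)) / h)"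
  proof (rule integral_mono)
    show "integrable (lebesgue_on {a..b}) (\<lambda>t. ((\<Gamma> t - \<Gamma> (t - h)) / h)\<^sup>2)"
      using continuous_difference_quotient[OF h ab(2)]
      by (intro continuous_imp_integrable_real continuous_on_power)
    show "integrable (lebesgue_on {a..b}) (\<lambda>t. (P t - P (t - h)) / h)"
      using integral_difference_shift(1)[OF P less_imp_le[OF h(1)] h(2) ab] by simp
    fix t assume "t \<in> space (lebesgue_on {a..b})"
    then have t: "h \<le> t" "t \<le> T" using h ab by auto
    then have "(\<Gamma> t - \<Gamma> (t - h))\<^sup>2 \<le> h * (P t - P (t - h))"
      using difference_power2_le[of h t] Pdiff[of "t - h" t] h by simp
    then show "((\<Gamma> t - \<Gamma> (t - h)) / h)\<^sup>2 \<le> (P t - P (t - h)) / h"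
      using h by (simp add: power_divide power2_eq_square[of h] field_simps)
  qed
  also have "\<dots> = (integral {b - h..b} P - integral {a - h..a} P) / h"
    using integral_difference_shift(2)[OF P less_imp_le[OF h(1)] h(2) ab] IP[of a] IP[of b] h ab by simp
  also have "\<dots> \<le> (h * P T) / h"
  proof (rule divide_right_mono)
    have "integral {b - h..b} P \<le> integral {b - h..b} (\<lambda>_. P T)"
      using h ab PT by (intro Henstock_Kurzweil_Integration.integral_le Pint) auto
    moreover have "integral {a - h..a} P \<ge> 0"
      using h ab P0 by (intro Henstock_Kurzweil_Integration.integral_nonneg Pint) auto
    ultimately show "integral {b - h..b} P - integral {a - h..a} P \<le> h * P T" using h by simp
  qed (use h in simp)
  also have "\<dots> = P T" using h by simp
  finally show ?thesis by (simp add: P_def)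
qed

end

text \<open>Convergence on boxes spreads to all measurable sets. The \<open>L2\<close> bound
  \<open>K\<close> makes integrals over sets of small measure small uniformly in \<open>n\<close>,
  which is what a countable disjoint union needs; \<open>full\<close> serves the
  complements.\<close>

lemma weak_limit_on_lebesgue_sets:
  fixes q :: "nat \<Rightarrow> 'a::euclidean_space \<Rightarrow> real"
  assumes S: "S \<in> lmeasurable"
    and q: "\<And>n. square_integrable (lebesgue_on S) (q n)" and f: "square_integrable (lebesgue_on S) f"
    and qK: "\<And>n. (LINT x|lebesgue_on S. (q n x)\<^sup>2) \<le> K" and fK: "(LINT x|lebesgue_on S. (f x)\<^sup>2) \<le> K"
    and full: "(\<lambda>n. LINT x|lebesgue_on S. q n x) \<longlonglongrightarrow> (LINT x|lebesgue_on S. f x)"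
    and box: "\<And>c d. (\<lambda>n. LINT x|lebesgue_on S. indicator (box c d) x * q n x) \<longlonglongrightarrow>
      (LINT x|lebesgue_on S. indicator (box c d) x * f x)"
    and A: "A \<in> sets lebesgue"
  shows "(\<lambda>n. LINT x|lebesgue_on S. indicator A x * q n x) \<longlonglongrightarrow> (LINT x|lebesgue_on S. indicator A x * f x)"
proof -
  let ?M = "lebesgue_on S"
  interpret finite_measure ?M using S by (rule finite_measure_lebesgue_on)
  have Slb: "S \<in> sets lebesgue" using S by auto
  have ind: "indicator B \<in> borel_measurable ?M" if "B \<in> sets lebesgue" for B
    using that by (intro measurable_restrict_space1) simp
  have sqi: "square_integrable ?M (indicator B :: 'a \<Rightarrow> real)" if "B \<in> sets lebesgue" for B
    unfolding square_integrable_def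
  proof
    have "(\<lambda>x. (norm (indicator B x :: real))\<^sup>2) = indicator B" by (auto simp: indicator_def)
    moreover have "integrable ?M (indicator B :: 'a \<Rightarrow> real)"
      by (rule integrable_const_bound[of _ 1]) (use ind[OF that] in auto)
    ultimately show "integrable ?M (\<lambda>x. (norm (indicator B x :: real))\<^sup>2)" by simp
  qed (rule ind[OF that])
  have prodi: "integrable ?M (\<lambda>x. indicator B x * p x)"
    if "B \<in> sets lebesgue" "square_integrable ?M p" for B and p :: "'a \<Rightarrow> real"
    using square_integrable_inner[OF sqi[OF that(1)] that(2)] by simp
  have bound: "\<bar>LINT x|?M. indicator B x * p x\<bar> \<le> sqrt (measure ?M (B \<inter> S)) * sqrt K"
    if "B \<in> sets lebesgue" "square_integrable ?M p" "(LINT x|?M. (p x)\<^sup>2) \<le> K" for B and p :: "'a \<Rightarrow> real"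
  proof -
    have "\<bar>LINT x|?M. indicator B x * p x\<bar> \<le> sqrt (LINT x|?M. (norm (indicator B x :: real))\<^sup>2) * sqrt (LINT x|?M. (norm (p x))\<^sup>2)"
      using Cauchy_Schwarz_integral[OF sqi[OF that(1)] that(2)] by simp
    also have "(LINT x|?M. (norm (indicator B x :: real))\<^sup>2) = (LINT x|?M. indicator (B \<inter> S) x)"
      by (intro Bochner_Integration.integral_cong refl) (auto simp: indicator_def)
    also have "\<dots> = measure ?M (B \<inter> S)" by (simp add: Int_absorb2)
    also have "sqrt (measure ?M (B \<inter> S)) * sqrt (LINT x|?M. (norm (p x))\<^sup>2) \<le> sqrt (measure ?M (B \<inter> S)) * sqrt K"
      using that(3) by (intro mult_left_mono) auto
    finally show ?thesis .
  qed
  have K: "K \<ge> 0" using order_trans[OF _ fK, of 0] by simp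
  have borel: "(\<lambda>n. LINT x|?M. indicator B x * q n x) \<longlonglongrightarrow> (LINT x|?M. indicator B x * f x)"
    if "B \<in> sets borel" for B
  proof -
    have stable: "Int_stable (range (\<lambda>(a, b). box a b :: 'a set))"
      by (auto simp: Int_stable_def box_Int_box)
    have closed: "range (\<lambda>(a, b). box a b :: 'a set) \<subseteq> Pow UNIV" by simp
    have "B \<in> sigma_sets UNIV (range (\<lambda>(a, b). box a b))"
      using that unfolding borel_eq_box by simp
    from stable closed this show ?thesis
    proof (induction rule: sigma_sets_induct_disjoint)
      case (basic B)
      then show ?case using box by auto
    next
      case empty
      then show ?case by simp
    next
      case (compl B)
      then have "B \<in> sets borel" unfolding borel_eq_box by simp
      then have B: "B \<in> sets lebesgue" by simp
      have "(LINT x|?M. indicator (UNIV - B) x * p x) = (LINT x|?M. p x) - (LINT x|?M. indicator B x * p x)"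
        if p: "square_integrable ?M p" for p :: "'a \<Rightarrow> real"
      proof -
        have "(LINT x|?M. indicator (UNIV - B) x * p x) = (LINT x|?M. p x - indicator B x * p x)"
          by (intro Bochner_Integration.integral_cong refl) (auto simp: indicator_def)
        then show ?thesis using square_integrable_imp_integrable[OF p] prodi[OF B p] by simp
      qed
      then show ?case using tendsto_diff[OF full compl.IH] q f by simp
    next
      case (union B)
      have Bb: "B i \<in> sets borel" for i
        using union(2) unfolding borel_eq_box by auto
      then have B: "B i \<in> sets lebesgue" for i by simp
      have disj: "B i \<inter> B j = {}" if "i \<noteq> j" for i j
        using union(1) that by (simp add: disjoint_family_on_def)
      let ?U = "\<Union>i. B i"
      \<comment> \<open>The tail of the disjoint union: its measure tends to 0, so it is negligible
        for all \<open>q n\<close> and for \<open>f\<close> at once.\<close>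
      define C where "C m = (\<Union>i\<in>{m..}. B i)" for m
      have C: "C m \<in> sets lebesgue" for m unfolding C_def using B by auto
      have split: "(LINT x|?M. indicator ?U x * p x) = (\<Sum>i<m. LINT x|?M. indicator (B i) x * p x) + (LINT x|?M. indicator (C m) x * p x)"
        if p: "square_integrable ?M p" for p :: "'a \<Rightarrow> real" and m
      proof -
        have eq: "(indicator ?U x :: real) = (\<Sum>i<m. indicator (B i) x) + indicator (C m) x" for x
        proof -
          have "disjoint_family_on B {..<m}" using union(1) by (auto simp: disjoint_family_on_def)
          then have "(\<Sum>i<m. indicator (B i) x) = (indicator (\<Union>i<m. B i) x :: real)"
            by (simp add: indicator_UN_disjoint)
          moreover have "?U = (\<Union>i<m. B i) \<union> C m"
          proof (intro set_eqI iffI)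
            fix x assume "x \<in> ?U"
            then obtain i where "x \<in> B i" by blast
            then show "x \<in> (\<Union>i<m. B i) \<union> C m" by (cases "i < m") (auto simp: C_def)
          qed (auto simp: C_def)
          moreover have "(\<Union>i<m. B i) \<inter> C m = {}"
          proof -
            have False if "i < m" "m \<le> j" "x \<in> B i" "x \<in> B j" for i j x
              using disj[of i j] that by auto
            then show ?thesis by (auto simp: C_def)
          qed
          ultimately show ?thesis by (auto simp: indicator_def)
        qed
        have "(LINT x|?M. indicator ?U x * p x) = (LINT x|?M. (\<Sum>i<m. indicator (B i) x * p x) + indicator (C m) x * p x)"
          by (simp only: eq distrib_right sum_distrib_right)
        also have "\<dots> = (LINT x|?M. (\<Sum>i<m. indicator (B i) x * p x)) + (LINT x|?M. indicator (C m) x * p x)"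
          using prodi[OF B p] prodi[OF C p]
          by (intro Bochner_Integration.integral_add Bochner_Integration.integrable_sum)
        also have "(LINT x|?M. (\<Sum>i<m. indicator (B i) x * p x)) = (\<Sum>i<m. LINT x|?M. indicator (B i) x * p x)"
          using prodi[OF B p] by (intro Bochner_Integration.integral_sum)
        finally show ?thesis .
      qed
      have "(\<lambda>m. measure ?M (C m \<inter> S)) \<longlonglongrightarrow> measure ?M (\<Inter>m. C m \<inter> S)"
      proof (rule finite_Lim_measure_decseq)
        show "range (\<lambda>m. C m \<inter> S) \<subseteq> sets ?M"
          using C Slb by (auto simp: sets_restrict_space)
        show "decseq (\<lambda>m. C m \<inter> S)" unfolding C_def by (intro decseq_SucI) force
      qed
      moreover have "(\<Inter>m. C m \<inter> S) = {}"
      proof -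
        have "x \<notin> (\<Inter>m. C m)" for x
        proof (cases "\<exists>i. x \<in> B i")
          case True
          then obtain i where "x \<in> B i" by blast
          then have "x \<notin> B j" if "Suc i \<le> j" for j using disj[of i j] that by auto
          then have "x \<notin> C (Suc i)" by (auto simp: C_def)
          then show ?thesis by blast
        qed (auto simp: C_def)
        then show ?thesis by blast
      qed
      ultimately have "(\<lambda>m. measure ?M (C m \<inter> S)) \<longlonglongrightarrow> 0" by simp
      from tendsto_mult_right[OF tendsto_real_sqrt[OF this], of "sqrt K"] have Clim: "(\<lambda>m. sqrt (measure ?M (C m \<inter> S)) * sqrt K) \<longlonglongrightarrow> 0"
        by simp
      show ?case
      proof (rule LIMSEQ_I)
        fix e :: real assume e: "e > 0"
        obtain m where m: "sqrt (measure ?M (C m \<inter> S)) * sqrt K < e / 3"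
          using order_tendstoD(2)[OF Clim, of "e / 3"] e by (auto simp: eventually_sequentially)
        have "(\<lambda>n. \<Sum>i<m. LINT x|?M. indicator (B i) x * q n x) \<longlonglongrightarrow> (\<Sum>i<m. LINT x|?M. indicator (B i) x * f x)"
          by (intro tendsto_sum union)
        from LIMSEQ_D[OF this, of "e / 3"] e obtain N where N: "\<And>n. n \<ge> N \<Longrightarrow> norm ((\<Sum>i<m. LINT x|?M. indicator (B i) x * q n x) - (\<Sum>i<m. LINT x|?M. indicator (B i) x * f x)) < e / 3"
          by auto
        show "\<exists>no. \<forall>n\<ge>no. norm ((LINT x|?M. indicator ?U x * q n x) - (LINT x|?M. indicator ?U x * f x)) < e"
        proof (intro exI allI impI)
          fix n assume n: "N \<le> n"
          have "\<bar>LINT x|?M. indicator (C m) x * q n x\<bar> < e / 3" "\<bar>LINT x|?M. indicator (C m) x * f x\<bar> < e / 3"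
            by (rule le_less_trans[OF bound[OF C q qK] m] le_less_trans[OF bound[OF C f fK] m])+
          then show "norm ((LINT x|?M. indicator ?U x * q n x) - (LINT x|?M. indicator ?U x * f x)) < e"
            using N[OF n] unfolding split[OF q, of n m] split[OF f, of m] real_norm_def by linarith
        qed
      qed
    qed
  qed
  \<comment> \<open>A Lebesgue set is a Borel set up to a null set, which no integral sees.\<close>
  obtain B N N' where B: "A = B \<union> N" "N \<subseteq> N'" "N' \<in> null_sets lborel" "B \<in> sets lborel"
    using A by (rule sets_completionE)
  have "AE x in lborel. x \<notin> N'" using B(3) by (rule AE_not_in)
  then have ae: "AE x in ?M. indicator A x = (indicator B x :: real)"
    unfolding AE_lebesgue_on_iff[OF Slb] by eventually_elim (use B in \<open>auto simp: indicator_def\<close>)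
  have "(LINT x|?M. indicator A x * p x) = (LINT x|?M. indicator B x * p x)"
    if "square_integrable ?M p" for p :: "'a \<Rightarrow> real"
  proof (rule integral_cong_AE)
    have p: "p \<in> borel_measurable ?M" using that by (simp add: square_integrable_def)
    show "(\<lambda>x. indicator A x * p x) \<in> borel_measurable ?M" using p ind[OF A] by (rule borel_measurable_times[rotated])
    show "(\<lambda>x. indicator B x * p x) \<in> borel_measurable ?M"
      using p ind[of B] B(4) by (intro borel_measurable_times) auto
  qed (use ae in eventually_elim, simp)
  then show ?thesis using borel[of B] B(4) q f by simp
qed

section \<open>The abstract energy inequality\<close>

lemma AE_lebesgue_on_subset:
  assumes "AE x in lebesgue_on T. P x" "S \<subseteq> T" "S \<in> sets lebesgue" "T \<in> sets lebesgue"
  shows "AE x in lebesgue_on S. P x"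
  using assms unfolding AE_lebesgue_on_iff[OF assms(3)] AE_lebesgue_on_iff[OF assms(4)]
  by (auto elim!: eventually_mono)

lemma integral_indicator_box_Icc:
  fixes p :: "real \<Rightarrow> real"
  assumes p: "p \<in> borel_measurable (lebesgue_on {a..b})"
  shows "(LINT t|lebesgue_on {a..b}. indicator (box c d) t * p t) =
    (if max a c \<le> min b d then LINT t|lebesgue_on {max a c..min b d}. p t else 0)"
proof (cases "max a c \<le> min b d")
  case True
  let ?I = "{max a c..min b d}"
  have "(LINT t|lebesgue_on {a..b}. indicator (box c d) t * p t) =
      (LINT t|lebesgue_on {a..b}. (if t \<in> ?I then p t else 0))"
  proof (rule integral_cong_AE)
    have "indicator (box c d) \<in> borel_measurable (lebesgue_on {a..b})"
      by (intro measurable_restrict_space1 borel_measurable_indicator) (simp add: borel_open)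
    then show "(\<lambda>t. indicator (box c d) t * p t) \<in> borel_measurable (lebesgue_on {a..b})"
      using p by (rule borel_measurable_times)
    have "p \<in> borel_measurable (lebesgue_on ?I)"
      by (rule measurable_restrict_mono[OF p]) auto
    then show "(\<lambda>t. if t \<in> ?I then p t else 0) \<in> borel_measurable (lebesgue_on {a..b})"
      by (subst borel_measurable_if_lebesgue_on) auto
    have "AE t in lborel. t \<noteq> max a c" "AE t in lborel. t \<noteq> min b d" by (rule AE_lborel_singleton)+
    then show "AE t in lebesgue_on {a..b}. indicator (box c d) t * p t = (if t \<in> ?I then p t else 0)"
      by (subst AE_lebesgue_on_iff, simp, eventually_elim) (auto simp: indicator_def)
  qed
  also have "\<dots> = (LINT t|lebesgue_on ?I. p t)"
    by (rule Lebesgue_Measure.integral_restrict) auto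
  finally show ?thesis using True by simp
next
  case False
  then have "(LINT t|lebesgue_on {a..b}. indicator (box c d) t * p t) = (LINT t|lebesgue_on {a..b}. 0)"
    by (intro Bochner_Integration.integral_cong refl) (auto simp: indicator_def)
  then show ?thesis unfolding if_not_P[OF False] by simp
qed

text \<open>On a box the integral runs over a subinterval, where the telescoped limit is the
  increment of \<open>\<Gamma>\<close>, that is the integral of \<open>g\<close>. The bound on
  difference quotients extends this to \<open>A\<close>. Since \<open>a > 0\<close>, the shifted
  times stay in the interval.\<close>

lemma (in square_integrable_primitive) difference_quotient_weak_limit:
  assumes ab: "0 < a" "a \<le> b" "b \<le> T"
    and h: "\<And>n. 0 < h n" "\<And>n. h n \<le> a" "h \<longlonglongrightarrow> 0" and A: "A \<in> sets lebesgue"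
  shows "(\<lambda>n. LINT t|lebesgue_on {a..b}. indicator A t * ((\<Gamma> t - \<Gamma> (t - h n)) / h n)) \<longlonglongrightarrow>
    (LINT t|lebesgue_on {a..b}. indicator A t * g t)"
proof (rule weak_limit_on_lebesgue_sets[OF _ _ _ _ _ _ _ A])
  show "{a..b} \<in> lmeasurable" by (metis interval_cbox lmeasurable_cbox)
  show q: "square_integrable (lebesgue_on {a..b}) (\<lambda>t. (\<Gamma> t - \<Gamma> (t - h n)) / h n)" for n
    by (intro square_integrable_continuous_Icc continuous_difference_quotient h ab)
  show g: "square_integrable (lebesgue_on {a..b}) g"
    by (rule square_integrable_subinterval[OF sq]) (use ab in auto)
  show "(LINT t|lebesgue_on {a..b}. ((\<Gamma> t - \<Gamma> (t - h n)) / h n)\<^sup>2) \<le> (LINT t|lebesgue_on {0..T}. (g t)\<^sup>2)" for n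
    by (intro integral_difference_quotient_power2_le h ab)
  show "(LINT t|lebesgue_on {a..b}. (g t)\<^sup>2) \<le> (LINT t|lebesgue_on {0..T}. (g t)\<^sup>2)"
    by (rule integral_mono_lebesgue_on_AE) (use ab sq in \<open>auto simp: square_integrable_def\<close>)
  show "(\<lambda>n. LINT t|lebesgue_on {a..b}. (\<Gamma> t - \<Gamma> (t - h n)) / h n) \<longlonglongrightarrow> (LINT t|lebesgue_on {a..b}. g t)"
    using integral_difference_quotient_tendsto[OF continuous ab h] primitive[of a b] ab by simp
  fix c d
  let ?c = "max a c" and ?d = "min b d"
  show "(\<lambda>n. LINT t|lebesgue_on {a..b}. indicator (box c d) t * ((\<Gamma> t - \<Gamma> (t - h n)) / h n)) \<longlonglongrightarrow>
      (LINT t|lebesgue_on {a..b}. indicator (box c d) t * g t)"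
  proof (cases "?c \<le> ?d")
    case True
    have "(\<lambda>n. LINT t|lebesgue_on {?c..?d}. (\<Gamma> t - \<Gamma> (t - h n)) / h n) \<longlonglongrightarrow> \<Gamma> ?d - \<Gamma> ?c"
      using ab h True by (intro integral_difference_quotient_tendsto[OF continuous]) (auto simp: le_max_iff_disj)
    also have "\<Gamma> ?d - \<Gamma> ?c = (LINT t|lebesgue_on {?c..?d}. g t)"
      using ab True by (intro primitive) auto
    finally show ?thesis
      using True q g by (subst (1 2) integral_indicator_box_Icc) (auto simp: square_integrable_def)
  next
    case False
    then show ?thesis
      using q g by (subst (1 2) integral_indicator_box_Icc) (auto simp: square_integrable_def)
  qed
qed

text \<open>In the application \<open>\<Gamma> v t\<close> is the \<open>L\<^sup>2\<close> inner product of \<open>u t\<close> with \<open>v\<close>, \<open>F v\<close> is its time derivative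
  and \<open>\<phi> t\<close> is the squared norm of \<open>u t\<close>. The bound \<open>G\<close> avoids the measurability of \<open>\<lambda>t. F (u t) t\<close>.\<close>

lemma energy_inequality:
  fixes u :: "real \<Rightarrow> 'v::minus" and s :: "nat \<Rightarrow> real \<Rightarrow> 'v"
    and \<Gamma> F :: "'v \<Rightarrow> real \<Rightarrow> real" and N :: "'v \<Rightarrow> real" and n G \<phi> :: "real \<Rightarrow> real"
  assumes ab: "0 < a" "a \<le> b" "b \<le> T"
    and \<phi>: "continuous_on {0..T} \<phi>"
    and \<phi>_le: "\<And>t r. t \<in> {0..T} \<Longrightarrow> r \<in> {0..T} \<Longrightarrow> u t \<in> V \<Longrightarrow>
      \<phi> t - \<phi> r \<le> 2 * (\<Gamma> (u t) t - \<Gamma> (u t) r)"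
    and V_diff: "\<And>x y. x \<in> V \<Longrightarrow> y \<in> V \<Longrightarrow> x - y \<in> V"
    and \<Gamma>_diff: "\<And>x y t. x \<in> V \<Longrightarrow> y \<in> V \<Longrightarrow> t \<in> {0..T} \<Longrightarrow> \<Gamma> (x - y) t = \<Gamma> x t - \<Gamma> y t"
    and \<Gamma>: "\<And>v. v \<in> V \<Longrightarrow> square_integrable_primitive T (\<Gamma> v) (F v)"
    and F_bound: "AE t in lebesgue_on {0..T}. \<forall>v\<in>V. \<bar>F v t\<bar> \<le> n t * N v"
    and F_diff: "AE t in lebesgue_on {0..T}. \<forall>x\<in>V. \<forall>y\<in>V. F (x - y) t = F x t - F y t"
    and n: "square_integrable (lebesgue_on {0..T}) n"
    and N: "\<And>v. N v \<ge> 0"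
    and u: "AE t in lebesgue_on {0..T}. u t \<in> V"
    and s: "\<And>k. simple_function (lebesgue_on {0..T}) (s k)" "\<And>k t. t \<in> {0..T} \<Longrightarrow> s k t \<in> V"
    and us: "\<And>k. square_integrable (lebesgue_on {0..T}) (\<lambda>t. N (u t - s k t))"
    and us_lim: "(\<lambda>k. LINT t|lebesgue_on {0..T}. (N (u t - s k t))\<^sup>2) \<longlonglongrightarrow> 0"
    and G: "integrable (lebesgue_on {0..T}) G" "AE t in lebesgue_on {0..T}. F (u t) t \<le> G t"
  shows "\<phi> b - \<phi> a \<le> 2 * (LINT t|lebesgue_on {a..b}. G t)"
proof -
  let ?M = "lebesgue_on {a..b}" and ?L = "lebesgue_on {0..T}"
  \<comment> \<open>Steps of at most \<open>a\<close> keep \<open>t - h m\<close> nonnegative for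
    every \<open>t\<close> in \<open>{a..b}\<close>.\<close>
  define h where "h m = a / real (Suc m)" for m
  have h: "0 < h m" "h m \<le> a" for m
    using ab by (auto simp: h_def divide_le_eq mult_le_cancel_left1)
  have h0: "h \<longlonglongrightarrow> 0"
    unfolding h_def using LIMSEQ_Suc[OF lim_const_over_n[of a]] by simp
  have sub: "{a..b} \<subseteq> {0..T}" using ab by auto
  have AE_sub: "AE t in ?M. P t" if "AE t in ?L. P t" for P
    by (rule AE_lebesgue_on_subset[OF that sub]) auto
  define R where "R = (LINT t|?L. (n t)\<^sup>2)"
  define E where "E k = (LINT t|?L. (N (u t - s k t))\<^sup>2)" for k
  \<comment> \<open>The primitive of \<open>n\<close> dominates the increments of all
    \<open>\<Gamma> v\<close> simultaneously, up to the factor \<open>N v\<close>. This allows a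
    test element that depends on \<open>t\<close>.\<close>
  define Nn where "Nn t = (LINT \<tau>|lebesgue_on {0..t}. n \<tau>)" for t
  have ni: "integrable ?L n" by (rule square_integrable_imp_integrable_Icc[OF n])
  have Nn_diff: "Nn t - Nn r = (LINT \<tau>|lebesgue_on {r..t}. n \<tau>)" if "0 \<le> r" "r \<le> t" "t \<le> T" for r t
    using integral_combine[OF integrable_subinterval[OF ni], of 0 t r] that by (simp add: Nn_def)
  interpret Nn: square_integrable_primitive T Nn n
    by unfold_locales (use n Nn_diff in auto)
  have \<Gamma>_bound: "\<bar>\<Gamma> v t - \<Gamma> v (t - h m)\<bar> \<le> N v * (Nn t - Nn (t - h m))"
    if v: "v \<in> V" and t: "t \<in> {a..b}" for v t m
  proof -
    interpret square_integrable_primitive T "\<Gamma> v" "F v" using \<Gamma>[OF v] .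
    have t': "0 \<le> t - h m" "t - h m \<le> t" "t \<le> T" using t h[of m] ab by auto
    then have ss: "{t - h m..t} \<subseteq> {0..T}" by auto
    have "\<bar>\<Gamma> v t - \<Gamma> v (t - h m)\<bar> = \<bar>LINT \<tau>|lebesgue_on {t - h m..t}. F v \<tau>\<bar>"
      using primitive[OF t'] by simp
    also have "\<dots> \<le> (LINT \<tau>|lebesgue_on {t - h m..t}. \<bar>F v \<tau>\<bar>)" by (rule integral_abs_bound)
    also have "\<dots> \<le> (LINT \<tau>|lebesgue_on {t - h m..t}. n \<tau> * N v)"
    proof (rule integral_mono_AE)
      show "integrable (lebesgue_on {t - h m..t}) (\<lambda>\<tau>. \<bar>F v \<tau>\<bar>)"
        using integrable_subinterval[OF square_integrable_imp_integrable_Icc[OF sq] ss] by simp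
      show "integrable (lebesgue_on {t - h m..t}) (\<lambda>\<tau>. n \<tau> * N v)"
        using integrable_subinterval[OF ni ss] by simp
      have "AE \<tau> in lebesgue_on {t - h m..t}. \<forall>v\<in>V. \<bar>F v \<tau>\<bar> \<le> n \<tau> * N v"
        by (rule AE_lebesgue_on_subset[OF F_bound ss]) auto
      then show "AE \<tau> in lebesgue_on {t - h m..t}. \<bar>F v \<tau>\<bar> \<le> n \<tau> * N v"
        by eventually_elim (use v in auto)
    qed
    also have "\<dots> = N v * (Nn t - Nn (t - h m))" using Nn_diff[OF t'] by simp
    finally show ?thesis .
  qed
  \<comment> \<open>Half of the error comes from replacing \<open>u t\<close> by
    \<open>s k t\<close> in the difference quotients, the other half from returning to
    \<open>u t\<close> in the limit.\<close>
  have est: "\<phi> b - \<phi> a \<le> 2 * (LINT t|?M. G t) + 4 * (sqrt R * sqrt (E k))" for k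
  proof -
    define W where "W = s k ` {0..T}"
    define A where "A v = {t \<in> {0..T}. s k t = v}" for v
    have W: "finite W" "\<And>v. v \<in> W \<Longrightarrow> v \<in> V"
      using s(1)[of k] s(2)[of _ k] by (auto simp: W_def simple_function_def)
    have A: "A v \<in> sets lebesgue" for v
    proof (cases "v \<in> W")
      case True
      then have "s k -` {v} \<inter> {0..T} \<in> sets ?L"
        using s(1)[of k] by (auto simp: W_def simple_function_def)
      moreover have "s k -` {v} \<inter> {0..T} = A v" by (auto simp: A_def)
      ultimately show ?thesis by (simp add: sets_restrict_space_iff)
    next
      case False
      then have "A v = {}" by (auto simp: A_def W_def)
      then show ?thesis by simp
    qed
    \<comment> \<open>On the measurable set \<open>A v\<close> the moving test element is the fixed
      \<open>v\<close>; a simple function has only finitely many such values.\<close>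
    have pick: "(\<Sum>v\<in>W. indicator (A v) t * p v) = p (s k t)" if "t \<in> {0..T}" for t and p :: "'v \<Rightarrow> real"
    proof -
      have "(\<Sum>v\<in>W. indicator (A v) t * p v) = (\<Sum>v\<in>W. if s k t = v then p v else 0)"
        using that by (intro sum.cong refl) (auto simp: A_def)
      then show ?thesis using W(1) that by (simp add: W_def)
    qed
    let ?dq = "\<lambda>m v t. (\<Gamma> v t - \<Gamma> v (t - h m)) / h m"
    let ?A = "\<lambda>m t. (Nn t - Nn (t - h m)) / h m"
    let ?e = "\<lambda>t. N (u t - s k t)"
    have e: "square_integrable ?M ?e" by (rule square_integrable_subinterval[OF us sub])
    have n': "square_integrable ?M n" by (rule square_integrable_subinterval[OF n sub])
    have eE: "(LINT t|?M. (?e t)\<^sup>2) \<le> E k" unfolding E_def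
      by (rule integral_mono_lebesgue_on_AE) (use sub us[of k] in \<open>auto simp: square_integrable_def\<close>)
    have nR: "(LINT t|?M. (n t)\<^sup>2) \<le> R" unfolding R_def
      by (rule integral_mono_lebesgue_on_AE) (use sub n in \<open>auto simp: square_integrable_def\<close>)
    \<comment> \<open>Used for \<open>p\<close> the difference quotient of \<open>Nn\<close> and for
      \<open>p = n\<close>, which obey the same bound \<open>R\<close>.\<close>
    have CS: "(LINT t|?M. p t * ?e t) \<le> sqrt R * sqrt (E k)"
      if p: "square_integrable ?M p" and pR: "(LINT t|?M. (p t)\<^sup>2) \<le> R" for p
    proof -
      have "(LINT t|?M. p t * ?e t) \<le> sqrt (LINT t|?M. (p t)\<^sup>2) * sqrt (LINT t|?M. (?e t)\<^sup>2)"
        using Cauchy_Schwarz_integral[OF p e] by simp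
      also have "\<dots> \<le> sqrt R * sqrt (E k)" using pR eE by (intro mult_mono) (auto simp: R_def)
      finally show ?thesis .
    qed
    have ind: "integrable ?M (\<lambda>t. indicator (A v) t * p t)" if "integrable ?M p" for v and p :: "real \<Rightarrow> real"
    proof -
      have "(indicator (A v) :: real \<Rightarrow> real) \<in> borel_measurable ?M"
        using A[of v] by (intro measurable_restrict_space1) simp
      then have "(\<lambda>t. indicator (A v) t * p t) \<in> borel_measurable ?M"
        by (rule borel_measurable_times[OF _ borel_measurable_integrable[OF that]])
      then show ?thesis
        by (rule Bochner_Integration.integrable_bound[OF that]) (auto simp: indicator_def)
    qed
    have sqA: "square_integrable ?M (?A m)" for m
      by (intro square_integrable_continuous_Icc Nn.continuous_difference_quotient h ab)
    have dqi: "integrable ?M (?dq m v)" if "v \<in> V" for m v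
      by (intro continuous_imp_integrable_real square_integrable_primitive.continuous_difference_quotient[OF \<Gamma>[OF that]] h ab)
    have step: "(LINT t|?M. (\<phi> t - \<phi> (t - h m)) / h m) \<le>
        (\<Sum>v\<in>W. 2 * (LINT t|?M. indicator (A v) t * ?dq m v t)) + 2 * (sqrt R * sqrt (E k))" for m
    proof -
      have i1: "integrable ?M (\<lambda>t. \<Sum>v\<in>W. 2 * (indicator (A v) t * ?dq m v t))"
        using W(2) by (intro Bochner_Integration.integrable_sum integrable_mult_right ind dqi)
      have i2: "integrable ?M (\<lambda>t. ?A m t * ?e t)"
        using square_integrable_inner[OF sqA e] by simp
      have "(LINT t|?M. (\<phi> t - \<phi> (t - h m)) / h m) \<le>
          (LINT t|?M. (\<Sum>v\<in>W. 2 * (indicator (A v) t * ?dq m v t)) + 2 * (?A m t * ?e t))"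
      proof (rule integral_mono_AE)
        show "integrable ?M (\<lambda>t. (\<phi> t - \<phi> (t - h m)) / h m)"
          using integral_difference_shift(1)[OF \<phi> less_imp_le[OF h(1)] h(2) ab(2,3)] by simp
        show "integrable ?M (\<lambda>t. (\<Sum>v\<in>W. 2 * (indicator (A v) t * ?dq m v t)) + 2 * (?A m t * ?e t))"
          using i1 i2 by (intro Bochner_Integration.integrable_add integrable_mult_right)
        have "AE t in ?M. t \<in> {a..b}" by (rule AE_I2) simp
        then show "AE t in ?M. (\<phi> t - \<phi> (t - h m)) / h m \<le>
            (\<Sum>v\<in>W. 2 * (indicator (A v) t * ?dq m v t)) + 2 * (?A m t * ?e t)"
          using AE_sub[OF u]
        proof eventually_elim
          case (elim t)
          have t: "t \<in> {0..T}" "t - h m \<in> {0..T}" using elim sub h[of m] ab by auto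
          let ?v = "u t - s k t"
          have v: "?v \<in> V" "s k t \<in> V" using V_diff elim s(2) t by auto
          \<comment> \<open>The simple part will converge as \<open>h\<close> tends to 0; the
            remainder is bounded through \<open>Nn\<close> independently of
            \<open>h\<close>.\<close>
          have "\<Gamma> (u t) t - \<Gamma> (u t) (t - h m) =
              (\<Gamma> (s k t) t - \<Gamma> (s k t) (t - h m)) + (\<Gamma> ?v t - \<Gamma> ?v (t - h m))"
            using \<Gamma>_diff[OF elim(2) v(2) t(1)] \<Gamma>_diff[OF elim(2) v(2) t(2)] by simp
          then have "\<phi> t - \<phi> (t - h m) \<le>
              2 * (\<Gamma> (s k t) t - \<Gamma> (s k t) (t - h m)) + 2 * ((Nn t - Nn (t - h m)) * ?e t)"
            using \<phi>_le[OF t elim(2)] \<Gamma>_bound[OF v(1) elim(1), of m] by (simp add: mult.commute)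
          then have "(\<phi> t - \<phi> (t - h m)) / h m \<le>
              (2 * (\<Gamma> (s k t) t - \<Gamma> (s k t) (t - h m)) + 2 * ((Nn t - Nn (t - h m)) * ?e t)) / h m"
            using h(1)[of m] by (intro divide_right_mono) auto
          also have "\<dots> = 2 * ?dq m (s k t) t + 2 * (?A m t * ?e t)"
            by (simp add: add_divide_distrib)
          also have "2 * ?dq m (s k t) t = (\<Sum>v\<in>W. 2 * (indicator (A v) t * ?dq m v t))"
            using pick[OF t(1), of "\<lambda>v. ?dq m v t"] by (simp only: sum_distrib_left[symmetric])
          finally show ?case .
        qed
      qed
      also have "\<dots> = (\<Sum>v\<in>W. 2 * (LINT t|?M. indicator (A v) t * ?dq m v t)) + 2 * (LINT t|?M. ?A m t * ?e t)"
      proof -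
        have "(LINT t|?M. (\<Sum>v\<in>W. 2 * (indicator (A v) t * ?dq m v t)) + 2 * (?A m t * ?e t)) =
            (LINT t|?M. (\<Sum>v\<in>W. 2 * (indicator (A v) t * ?dq m v t))) + (LINT t|?M. 2 * (?A m t * ?e t))"
          using i1 i2 by (intro Bochner_Integration.integral_add integrable_mult_right)
        also have "(LINT t|?M. (\<Sum>v\<in>W. 2 * (indicator (A v) t * ?dq m v t))) =
            (\<Sum>v\<in>W. LINT t|?M. 2 * (indicator (A v) t * ?dq m v t))"
          using W(2) by (intro Bochner_Integration.integral_sum integrable_mult_right ind dqi)
        finally show ?thesis by simp
      qed
      also have "(LINT t|?M. ?A m t * ?e t) \<le> sqrt R * sqrt (E k)"
        using Nn.integral_difference_quotient_power2_le[OF h ab(2,3)] by (intro CS sqA) (simp add: R_def)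
      finally show ?thesis by simp
    qed
    have "\<phi> b - \<phi> a \<le> (\<Sum>v\<in>W. 2 * (LINT t|?M. indicator (A v) t * F v t)) + 2 * (sqrt R * sqrt (E k))"
    proof (rule LIMSEQ_le)
      show "(\<lambda>m. LINT t|?M. (\<phi> t - \<phi> (t - h m)) / h m) \<longlonglongrightarrow> \<phi> b - \<phi> a"
        by (rule integral_difference_quotient_tendsto[OF \<phi> ab h h0])
      show "(\<lambda>m. (\<Sum>v\<in>W. 2 * (LINT t|?M. indicator (A v) t * ?dq m v t)) + 2 * (sqrt R * sqrt (E k))) \<longlonglongrightarrow>
          (\<Sum>v\<in>W. 2 * (LINT t|?M. indicator (A v) t * F v t)) + 2 * (sqrt R * sqrt (E k))"
        using W(2) by (intro tendsto_add tendsto_const tendsto_sum tendsto_mult_left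
            square_integrable_primitive.difference_quotient_weak_limit[OF \<Gamma> ab h h0 A])
    qed (use step in blast)
    also have "(\<Sum>v\<in>W. 2 * (LINT t|?M. indicator (A v) t * F v t)) \<le> 2 * (LINT t|?M. G t + n t * ?e t)"
    proof -
      have Fi: "integrable ?M (F v)" if "v \<in> V" for v
        using square_integrable_imp_integrable_Icc[OF square_integrable_subinterval[OF square_integrable_primitive.sq[OF \<Gamma>[OF that]] sub]] .
      have "(\<Sum>v\<in>W. 2 * (LINT t|?M. indicator (A v) t * F v t)) =
          2 * (LINT t|?M. (\<Sum>v\<in>W. indicator (A v) t * F v t))"
        using W(2) by (subst Bochner_Integration.integral_sum) (auto intro!: ind Fi simp: sum_distrib_left)
      also have "(LINT t|?M. (\<Sum>v\<in>W. indicator (A v) t * F v t)) \<le> (LINT t|?M. G t + n t * ?e t)"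
      proof (rule integral_mono_AE)
        show "integrable ?M (\<lambda>t. \<Sum>v\<in>W. indicator (A v) t * F v t)"
          using W(2) by (intro Bochner_Integration.integrable_sum ind Fi)
        show "integrable ?M (\<lambda>t. G t + n t * ?e t)"
          using integrable_subinterval[OF G(1) sub] square_integrable_inner[OF n' e] by simp
        have "AE t in ?M. t \<in> {a..b}" by (rule AE_I2) simp
        then show "AE t in ?M. (\<Sum>v\<in>W. indicator (A v) t * F v t) \<le> G t + n t * ?e t"
          using AE_sub[OF u] AE_sub[OF F_diff] AE_sub[OF F_bound] AE_sub[OF G(2)]
        proof eventually_elim
          case (elim t)
          have t: "t \<in> {0..T}" using elim(1) sub by auto
          have v: "u t - s k t \<in> V" "s k t \<in> V" using V_diff elim(2) s(2) t by auto
          \<comment> \<open>Back from the simple function to \<open>u t\<close>, where ellipticity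
            enters through \<open>G\<close>; the difference costs \<open>n t\<close> times the
            approximation error.\<close>
          have "F (s k t) t = F (u t) t - F (u t - s k t) t" using elim(2,3) v by simp
          also have "\<dots> \<le> G t + n t * ?e t" using elim(4,5) v(1) by fastforce
          finally show ?case using pick[OF t, of "\<lambda>v. F v t"] by simp
        qed
      qed
      finally show ?thesis by simp
    qed
    also have "(LINT t|?M. G t + n t * ?e t) = (LINT t|?M. G t) + (LINT t|?M. n t * ?e t)"
      using integrable_subinterval[OF G(1) sub] square_integrable_inner[OF n' e] by simp
    also have "(LINT t|?M. n t * ?e t) \<le> sqrt R * sqrt (E k)" by (rule CS[OF n' nR])
    finally show ?thesis by simp
  qed
  have "(\<lambda>k. 2 * (LINT t|?M. G t) + 4 * (sqrt R * sqrt (E k))) \<longlonglongrightarrow> 2 * (LINT t|?M. G t) + 4 * (sqrt R * sqrt 0)"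
    unfolding E_def by (intro tendsto_intros us_lim)
  then show ?thesis using est by (intro LIMSEQ_le_const) auto
qed

section \<open>The Poincare inequality in the Sobolev space\<close>

context bounded_open_domain
begin

text \<open>Extension by zero is harmless because the relation is tested only with functions
  supported in \<open>\<Omega>\<close>; no derivative across the boundary is claimed.\<close>

lemma ex_borel_weak_gradient:
  assumes f: "f \<in> L2 \<Omega>" and g: "weak_gradient \<Omega> f g"
  obtains f' g' where "borel_weak_gradient \<Omega> f' g'"
    and "AE x in lborel. (if x \<in> \<Omega> then f x else 0) = f' x"
    and "AE x in lborel. (if x \<in> \<Omega> then g x else 0) = g' x"
proof -
  have fsq: "square_integrable M f" and gsq: "square_integrable M g"
    using f g by (auto simp: L2_iff weak_gradient_iff)
  have fm: "f \<in> borel_measurable M" and gm: "g \<in> borel_measurable M"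
    using fsq gsq by (auto simp: square_integrable_def)
  obtain f' where f' [measurable]: "f' \<in> borel_measurable borel"
    and ff: "AE x in lborel. (if x \<in> \<Omega> then f x else 0) = f' x"
    using lebesgue_on_ex_borel[OF sets_domain fm] .
  have "\<exists>h. h \<in> borel_measurable borel \<and> (AE x in lborel. (if x \<in> \<Omega> then g x $ i else 0) = h x)" for i
  proof -
    have "(\<lambda>x. g x $ i) \<in> borel_measurable M"
      using gsq by (simp add: square_integrable_iff_nth square_integrable_def)
    from lebesgue_on_ex_borel[OF sets_domain this] show ?thesis by blast
  qed
  then have "\<exists>H. \<forall>i. H i \<in> borel_measurable borel \<and> (AE x in lborel. (if x \<in> \<Omega> then g x $ i else 0) = H i x)"
    by (intro choice) blast
  then obtain H where H: "\<And>i. H i \<in> borel_measurable borel"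
      "\<And>i. AE x in lborel. (if x \<in> \<Omega> then g x $ i else 0) = H i x"
    by blast
  define g' where "g' x = (\<chi> i. H i x)" for x
  have g' [measurable]: "g' \<in> borel_measurable borel"
    unfolding borel_measurable_euclidean_space[of g'] using H(1)
    by (auto simp: Basis_vec_def inner_axis g'_def)
  have "AE x in lborel. \<forall>i. (if x \<in> \<Omega> then g x $ i else 0) = H i x"
    using H(2) by (simp add: AE_all_countable)
  then have gg: "AE x in lborel. (if x \<in> \<Omega> then g x else 0) = g' x"
    by eventually_elim (auto simp: vec_eq_iff g'_def split: if_splits)
  \<comment> \<open>The condition \<open>p x 0 0 = 0\<close> makes both sides agree off
    \<open>\<Omega>\<close>, where the representatives vanish almost everywhere.\<close>
  have transfer: "integrable M (\<lambda>x. p x (f x) (g x)) \<longleftrightarrow> integrable lborel (\<lambda>x. p x (f' x) (g' x))"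
      "(LINT x|M. p x (f x) (g x)) = (LINT x|lborel. p x (f' x) (g' x))"
    if "(\<lambda>x. p x (f x) (g x)) \<in> borel_measurable M" "(\<lambda>x. p x (f' x) (g' x)) \<in> borel_measurable borel"
      and "\<And>x. p x 0 0 = 0" for p :: "real^2 \<Rightarrow> real \<Rightarrow> real^2 \<Rightarrow> real"
  proof -
    have ae: "AE x in lborel. (if x \<in> \<Omega> then p x (f x) (g x) else 0) = p x (f' x) (g' x)"
      using ff gg
    proof eventually_elim
      case (elim x)
      then show ?case using that(3)[of x] by (cases "x \<in> \<Omega>") auto
    qed
    show "integrable M (\<lambda>x. p x (f x) (g x)) \<longleftrightarrow> integrable lborel (\<lambda>x. p x (f' x) (g' x))"
      by (rule integrable_lebesgue_on_lborel[OF sets_domain that(1,2) ae])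
    show "(LINT x|M. p x (f x) (g x)) = (LINT x|lborel. p x (f' x) (g' x))"
      by (rule integral_lebesgue_on_lborel[OF sets_domain that(1,2) ae])
  qed
  have "borel_weak_gradient \<Omega> f' g'"
    unfolding borel_weak_gradient_def
  proof (intro conjI allI impI)
    show "integrable lborel f'"
      using transfer(1)[of "\<lambda>x y z. y"] square_integrable_imp_integrable[OF fsq] fm by simp
    have "integrable lborel (\<lambda>x. norm (g' x))"
      using transfer(1)[of "\<lambda>x y z. norm z"] integrable_norm[OF square_integrable_imp_integrable[OF gsq]] gm by simp
    then show "integrable lborel g'" by (subst (asm) integrable_norm_iff) auto
    show "integrable lborel (\<lambda>x. (norm (g' x))\<^sup>2)"
      using transfer(1)[of "\<lambda>x y z. (norm z)\<^sup>2"] gsq by (auto simp: square_integrable_def)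
    fix \<phi> \<phi>' h assume t: "test_function \<Omega> \<phi> \<phi>'"
    note si = test_function_square_integrable[OF t]
    have c: "continuous_on UNIV \<phi>" "continuous_on UNIV \<phi>'" using test_function_bounded[OF t] by metis+
    have [measurable]: "\<phi> \<in> borel_measurable borel" "\<phi>' \<in> borel_measurable borel"
      using c by (auto intro: borel_measurable_continuous_onI)
    have hsum: "v \<bullet> h = (\<Sum>i\<in>UNIV. v $ i * h $ i)" for v :: "real^2"
      by (simp add: inner_vec_def)
    have fi: "integrable M (\<lambda>x. f x * \<phi>' x $ i)" for i
      by (rule integrable_mult_square_integrable[OF fsq si(2)])
    have gi: "integrable M (\<lambda>x. g x $ i * \<phi> x)" for i
      using gsq by (intro integrable_mult_square_integrable si(1)) (simp add: square_integrable_iff_nth)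
    have e1: "f x * (\<phi>' x \<bullet> h) = (\<Sum>i\<in>UNIV. h $ i * (f x * \<phi>' x $ i))"
      and e2: "(g x \<bullet> h) * \<phi> x = (\<Sum>i\<in>UNIV. h $ i * (g x $ i * \<phi> x))" for x
      by (simp_all add: hsum sum_distrib_left sum_distrib_right mult_ac)
    have m1: "(\<lambda>x. f x * (\<phi>' x \<bullet> h)) \<in> borel_measurable M"
      unfolding e1 by (intro borel_measurable_integrable Bochner_Integration.integrable_sum integrable_mult_right fi)
    have m2: "(\<lambda>x. (g x \<bullet> h) * \<phi> x) \<in> borel_measurable M"
      unfolding e2 by (intro borel_measurable_integrable Bochner_Integration.integrable_sum integrable_mult_right gi)
    have "(LINT x|lborel. f' x * (\<phi>' x \<bullet> h)) = (LINT x|M. f x * (\<phi>' x \<bullet> h))"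
      using transfer(2)[of "\<lambda>x y z. y * (\<phi>' x \<bullet> h)"] m1 by simp
    also have "\<dots> = (\<Sum>i\<in>UNIV. h $ i * (LINT x|M. f x * \<phi>' x $ i))"
      unfolding e1 using fi by (subst Bochner_Integration.integral_sum) auto
    also have "\<dots> = (\<Sum>i\<in>UNIV. h $ i * - (LINT x|M. g x $ i * \<phi> x))"
      using g t by (simp add: weak_gradient_iff)
    also have "\<dots> = - (LINT x|M. (g x \<bullet> h) * \<phi> x)"
      unfolding e2 using gi by (subst Bochner_Integration.integral_sum) (auto simp: sum_negf)
    also have "(LINT x|M. (g x \<bullet> h) * \<phi> x) = (LINT x|lborel. (g' x \<bullet> h) * \<phi> x)"
      using transfer(2)[of "\<lambda>x y z. (z \<bullet> h) * \<phi> x"] m2 by simp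
    finally show "(LINT x|lborel. f' x * (\<phi>' x \<bullet> h)) = - (LINT x|lborel. (g' x \<bullet> h) * \<phi> x)" .
  qed (rule f' g')+
  then show ?thesis using that ff gg by blast
qed

lemma measure_domain_pos:
  assumes "\<Omega> \<noteq> {}"
  shows "measure lebesgue \<Omega> > 0"
proof -
  have "emeasure lebesgue \<Omega> \<noteq> 0"
    using open_not_negligible[OF open_domain assms] by (auto simp: negligible_iff_null_sets null_sets_def)
  then show ?thesis
    using lmeasurable_open[OF bounded_domain open_domain]
    by (simp add: measure_def enn2real_positive_iff fmeasurable_def less_top zero_less_iff_neq_zero)
qed

lemma poincare_inequality:
  assumes "lipschitz_domain \<Omega>"
  shows "\<exists>C\<ge>0. \<forall>f\<in>H1 \<Omega>. (LINT x|M. (f x - mean \<Omega> f)\<^sup>2) \<le> C * (LINT x|M. (norm (grad \<Omega> f x))\<^sup>2)"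
proof -
  have ne: "\<Omega> \<noteq> {}" using assms by (simp add: lipschitz_domain_def)
  have [measurable]: "\<Omega> \<in> sets borel" using open_domain by simp
  obtain C where C: "C \<ge> 0" "poincare_const \<Omega> \<Omega> C"
    using poincare_set_lipschitz_domain[OF assms] unfolding poincare_set_def by blast
  have "(LINT x|M. (f x - mean \<Omega> f)\<^sup>2) \<le> C * (LINT x|M. (norm (grad \<Omega> f x))\<^sup>2)" if f: "f \<in> H1 \<Omega>" for f
  proof -
    let ?g = "grad \<Omega> f"
    have fL2: "f \<in> L2 \<Omega>" and wg: "weak_gradient \<Omega> f ?g" using f by (simp_all add: H1_L2 H1_weak_gradient)
    have fsq: "square_integrable M f" and gsq: "square_integrable M ?g"
      using fL2 wg by (auto simp: L2_iff weak_gradient_iff)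
    obtain f' g' where b: "borel_weak_gradient \<Omega> f' g'"
      and ff: "AE x in lborel. (if x \<in> \<Omega> then f x else 0) = f' x"
      and gg: "AE x in lborel. (if x \<in> \<Omega> then ?g x else 0) = g' x"
      using ex_borel_weak_gradient[OF fL2 wg] .
    have [measurable]: "f' \<in> borel_measurable borel" "g' \<in> borel_measurable borel"
      using b by (auto simp: borel_weak_gradient_def)
    have E: "(LINT x|M. (norm (?g x))\<^sup>2) = (LINT x|lborel. (norm (g' x))\<^sup>2)"
    proof (rule integral_lebesgue_on_lborel)
      show "(\<lambda>x. (norm (?g x))\<^sup>2) \<in> borel_measurable M"
        using gsq by (auto simp: square_integrable_def)
      show "AE x in lborel. (if x \<in> \<Omega> then (norm (?g x))\<^sup>2 else 0) = (norm (g' x))\<^sup>2"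
        using gg by eventually_elim (auto split: if_splits)
    qed auto
    obtain c where c: "(\<integral>\<^sup>+x\<in>\<Omega>. ennreal ((f' x - c)\<^sup>2) \<partial>lborel) \<le> ennreal (C * (LINT x|lborel. (norm (g' x))\<^sup>2))"
      using C(2) b unfolding poincare_const_def by blast
    have fc: "integrable M (\<lambda>x. (f x - c)\<^sup>2)"
      using square_integrable_diff[OF fsq square_integrable_const[of c]] by (simp add: square_integrable_def)
    have k: "AE x in lborel. (if x \<in> \<Omega> then (f x - c)\<^sup>2 else 0) = (f' x - c)\<^sup>2 * indicator \<Omega> x"
      using ff by eventually_elim auto
    have k': "(\<lambda>x. (f' x - c)\<^sup>2 * indicator \<Omega> x) \<in> borel_measurable borel" by measurable
    have "ennreal (LINT x|M. (f x - c)\<^sup>2) = ennreal (LINT x|lborel. (f' x - c)\<^sup>2 * indicator \<Omega> x)"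
      using integral_lebesgue_on_lborel[OF sets_domain borel_measurable_integrable[OF fc] k' k] by simp
    also have "\<dots> = (\<integral>\<^sup>+x. ennreal ((f' x - c)\<^sup>2 * indicator \<Omega> x) \<partial>lborel)"
      using integrable_lebesgue_on_lborel[OF sets_domain borel_measurable_integrable[OF fc] k' k] fc
      by (intro nn_integral_eq_integral[symmetric]) auto
    also have "\<dots> = (\<integral>\<^sup>+x\<in>\<Omega>. ennreal ((f' x - c)\<^sup>2) \<partial>lborel)"
      by (intro nn_integral_cong) (auto simp: indicator_def)
    finally have "ennreal (LINT x|M. (f x - c)\<^sup>2) \<le> ennreal (C * (LINT x|M. (norm (?g x))\<^sup>2))"
      using c E by simp
    then have le: "(LINT x|M. (f x - c)\<^sup>2) \<le> C * (LINT x|M. (norm (?g x))\<^sup>2)"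
      using C(1) by (subst (asm) ennreal_le_iff) auto
    have "mean \<Omega> f * measure M (space M) = (LINT x|M. f x)"
      using measure_domain_pos[OF ne] by (simp add: mean_def measure_restrict_space)
    then have "(LINT x|M. (f x - mean \<Omega> f)\<^sup>2) \<le> (LINT x|M. (f x - c)\<^sup>2)"
      by (rule mean_minimizes[OF fsq])
    then show ?thesis using le by simp
  qed
  then show ?thesis using C(1) by blast
qed

lemma poincare_inequality_X1:
  assumes "lipschitz_domain \<Omega>"
  shows "\<exists>C\<ge>0. \<forall>u\<in>X1 \<Omega>. (LINT x|M. (norm (u x - mean_vec \<Omega> u))\<^sup>2) \<le> C * (LINT x|M. (norm (jacobian \<Omega> u x))\<^sup>2)"
proof -
  obtain C where C: "C \<ge> 0" "\<forall>f\<in>H1 \<Omega>. (LINT x|M. (f x - mean \<Omega> f)\<^sup>2) \<le> C * (LINT x|M. (norm (grad \<Omega> f x))\<^sup>2)"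
    using poincare_inequality[OF assms] by blast
  have "(LINT x|M. (norm (u x - mean_vec \<Omega> u))\<^sup>2) \<le> C * (LINT x|M. (norm (jacobian \<Omega> u x))\<^sup>2)" if u: "u \<in> X1 \<Omega>" for u
  proof -
    have ui: "(\<lambda>x. u x $ i) \<in> H1 \<Omega>" for i using u by (simp add: X1_def)
    have i1: "integrable M (\<lambda>x. (u x $ i - mean \<Omega> (\<lambda>x. u x $ i))\<^sup>2)" for i
      using square_integrable_diff[OF _ square_integrable_const[of "mean \<Omega> (\<lambda>x. u x $ i)"], of "\<lambda>x. u x $ i"] H1_L2[OF ui[of i]]
      by (simp add: L2_iff square_integrable_def[of M "\<lambda>x. _ x - _"])
    have i2: "integrable M (\<lambda>x. (norm (grad \<Omega> (\<lambda>y. u y $ i) x))\<^sup>2)" for i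
      using H1_weak_gradient[OF ui] by (simp add: weak_gradient_iff square_integrable_def)
    have "(LINT x|M. (norm (u x - mean_vec \<Omega> u))\<^sup>2) = (\<Sum>i\<in>UNIV. LINT x|M. (u x $ i - mean \<Omega> (\<lambda>x. u x $ i))\<^sup>2)"
      using i1 by (simp add: power2_norm_vec_eq_sum mean_vec_def)
    also have "\<dots> \<le> (\<Sum>i\<in>UNIV. C * (LINT x|M. (norm (grad \<Omega> (\<lambda>y. u y $ i) x))\<^sup>2))"
      using bspec[OF C(2) ui] by (intro sum_mono)
    also have "\<dots> = C * (LINT x|M. (norm (jacobian \<Omega> u x))\<^sup>2)"
      using i2 by (simp add: power2_norm_vec_eq_sum jacobian_def sum_distrib_left)
    finally show ?thesis .
  qed
  then show ?thesis using C(1) by blast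
qed

end

section \<open>Simple approximation in Bochner spaces\<close>

text \<open>Lebesgue measure is complete, so the limit may be altered on the null set where
  convergence fails.\<close>

lemma borel_measurable_lebesgue_on_AE_limit:
  fixes f :: "nat \<Rightarrow> 'a::euclidean_space \<Rightarrow> real"
  assumes S: "S \<in> sets lebesgue" and f: "\<And>n. f n \<in> borel_measurable (lebesgue_on S)"
    and lim: "AE x in lebesgue_on S. (\<lambda>n. f n x) \<longlonglongrightarrow> g x"
  shows "g \<in> borel_measurable (lebesgue_on S)"
proof -
  have "(\<lambda>x. lim (\<lambda>n. f n x)) \<in> borel_measurable (lebesgue_on S)"
    using f by (rule borel_measurable_lim_metric)
  then have m: "(\<lambda>x. if x \<in> S then lim (\<lambda>n. f n x) else 0) \<in> borel_measurable lebesgue"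
    using S by (simp add: borel_measurable_if)
  have "AE x in lborel. x \<in> S \<longrightarrow> (\<lambda>n. f n x) \<longlonglongrightarrow> g x"
    using lim by (simp add: AE_lebesgue_on_iff[OF S])
  then have "AE x in lebesgue. x \<in> S \<longrightarrow> (\<lambda>n. f n x) \<longlonglongrightarrow> g x" by (rule AE_completion)
  then have "AE x in lebesgue. (if x \<in> S then lim (\<lambda>n. f n x) else 0) = (if x \<in> S then g x else 0)"
    by eventually_elim (auto dest: limI)
  from borel_measurable_AE[OF m this] show ?thesis using S by (simp add: borel_measurable_if)
qed

text \<open>The Bochner space provides simple functions that converge only almost everywhere.
  Resetting them to \<open>z\<close>, the zero of the space, where their norm exceeds twice that of
  \<open>u\<close> makes the error at most three times the norm of \<open>u\<close>, so convergence
  also holds in \<open>L2\<close>.\<close>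

lemma L2_bochner_simple_approximation:
  fixes u :: "real \<Rightarrow> 'v::minus"
  assumes u: "L2_bochner T V N u"
    and N: "\<And>x. N x \<ge> 0"
    and triangle: "\<And>x y z. x \<in> V \<Longrightarrow> y \<in> V \<Longrightarrow> z \<in> V \<Longrightarrow> N (x - z) \<le> N (x - y) + N (y - z)"
    and commute: "\<And>x y. x \<in> V \<Longrightarrow> y \<in> V \<Longrightarrow> N (x - y) = N (y - x)"
    and zero: "z \<in> V" "\<And>x. x \<in> V \<Longrightarrow> N (x - z) = N x" "N z = 0"
  obtains s where "\<And>k. simple_function (lebesgue_on {0..T}) (s k)" "\<And>k t. t \<in> {0..T} \<Longrightarrow> s k t \<in> V"
    "\<And>k. square_integrable (lebesgue_on {0..T}) (\<lambda>t. N (u t - s k t))"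
    "(\<lambda>k. LINT t|lebesgue_on {0..T}. (N (u t - s k t))\<^sup>2) \<longlonglongrightarrow> 0"
proof -
  let ?M = "lebesgue_on {0..T}"
  obtain s0 where s0: "\<And>n. simple_function ?M (s0 n)" "\<And>n t. t \<in> {0..T} \<Longrightarrow> s0 n t \<in> V"
    and ae: "AE t in ?M. u t \<in> V \<and> (\<lambda>n. N (s0 n t - u t)) \<longlonglongrightarrow> 0"
    and u2: "integrable ?M (\<lambda>t. (N (u t))\<^sup>2)"
    using u unfolding L2_bochner_def by blast
  have aeT: "AE t in ?M. t \<in> {0..T}" by (rule AE_I2) simp
  have meas: "(\<lambda>t. N (u t - x t)) \<in> borel_measurable ?M"
    if x: "simple_function ?M x" "\<And>t. t \<in> {0..T} \<Longrightarrow> x t \<in> V" for x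
  proof (rule borel_measurable_lebesgue_on_AE_limit[where f = "\<lambda>n t. N (s0 n t - x t)"])
    show "(\<lambda>t. N (s0 n t - x t)) \<in> borel_measurable ?M" for n
      by (intro borel_measurable_simple_function simple_function_compose2[OF s0(1) x(1)])
    show "AE t in ?M. (\<lambda>n. N (s0 n t - x t)) \<longlonglongrightarrow> N (u t - x t)"
      using ae aeT
    proof eventually_elim
      case (elim t)
      then have V: "u t \<in> V" "x t \<in> V" "\<And>n. s0 n t \<in> V" using x s0 by auto
      have "norm (N (s0 n t - x t) - N (u t - x t)) \<le> N (s0 n t - u t)" for n
        using triangle[OF V(3)[of n] V(1,2)] triangle[OF V(1) V(3)[of n] V(2)] commute[OF V(1) V(3)[of n]]
        unfolding real_norm_def by linarith
      then have "(\<lambda>n. N (s0 n t - x t) - N (u t - x t)) \<longlonglongrightarrow> 0"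
        by (intro Lim_null_comparison[OF _ conjunct2[OF elim(1)]] always_eventually allI)
      then show ?case by (rule LIM_zero_cancel)
    qed
  qed auto
  have cz: "simple_function ?M (\<lambda>_. z)" by simp
  \<comment> \<open>Almost everywhere equal to \<open>N (u t)\<close>, but in a form to which
    \<open>meas\<close> applies.\<close>
  define nu where "nu t = N (u t - z)" for t
  have nu_m: "nu \<in> borel_measurable ?M" unfolding nu_def by (rule meas[OF cz zero(1)])
  have nu0: "nu t \<ge> 0" for t by (simp add: nu_def N)
  have nu2: "integrable ?M (\<lambda>t. (nu t)\<^sup>2)"
  proof (rule Bochner_Integration.integrable_bound[OF u2])
    show "(\<lambda>t. (nu t)\<^sup>2) \<in> borel_measurable ?M" using nu_m by (rule borel_measurable_power)
    show "AE t in ?M. norm ((nu t)\<^sup>2) \<le> norm ((N (u t))\<^sup>2)"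
      using ae by eventually_elim (simp add: nu_def zero(2))
  qed
  \<comment> \<open>The factor 2 leaves room: where \<open>nu t > 0\<close>, convergence puts
    \<open>s0 k t\<close> within \<open>nu t\<close> of \<open>u t\<close>, so its norm is
    eventually below the threshold and the truncation is inactive.\<close>
  define s where "s k t = (if N (s0 k t - z) \<le> 2 * nu t then s0 k t else z)" for k t
  have s_simple: "simple_function ?M (s k)" for k
    unfolding s_def
  proof (rule simple_function_If[OF s0(1) cz])
    have "(\<lambda>t. N (s0 k t - z)) \<in> borel_measurable ?M"
      by (intro borel_measurable_simple_function simple_function_compose2[OF s0(1) cz])
    then show "{t \<in> space ?M. N (s0 k t - z) \<le> 2 * nu t} \<in> sets ?M"
      using nu_m by measurable
  qed
  have sV: "s k t \<in> V" if "t \<in> {0..T}" for k t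
    using that s0(2) zero(1) by (simp add: s_def)
  have sz: "N (z - s k t) \<le> 2 * nu t" if "t \<in> {0..T}" for k t
  proof (cases "N (s0 k t - z) \<le> 2 * nu t")
    case True
    then show ?thesis using commute[OF zero(1) s0(2)[OF that]] by (simp add: s_def)
  next
    case False
    have "N (z - z) = 0" using zero by simp
    then show ?thesis using False nu0[of t] by (simp add: s_def)
  qed
  have bound: "AE t in ?M. N (u t - s k t) \<le> 3 * nu t" for k
    using ae aeT
  proof eventually_elim
    case (elim t)
    then have "N (u t - s k t) \<le> N (u t - z) + N (z - s k t)"
      using triangle zero(1) sV by blast
    then show ?case using sz[of t k] elim by (simp add: nu_def)
  qed
  have bound2: "AE t in ?M. norm ((N (u t - s k t))\<^sup>2) \<le> 9 * (nu t)\<^sup>2" for k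
    using bound[of k]
  proof eventually_elim
    case (elim t)
    then have "(N (u t - s k t))\<^sup>2 \<le> (3 * nu t)\<^sup>2" using N by (intro power_mono)
    then show ?case by (simp add: power_mult_distrib)
  qed
  have m: "(\<lambda>t. N (u t - s k t)) \<in> borel_measurable ?M" for k
    by (rule meas[OF s_simple sV])
  have m2: "(\<lambda>t. (N (u t - s k t))\<^sup>2) \<in> borel_measurable ?M" for k
    using m[of k] by (rule borel_measurable_power)
  have i9: "integrable ?M (\<lambda>t. 9 * (nu t)\<^sup>2)" using nu2 by simp
  have bound_all: "AE t in ?M. \<forall>k. N (u t - s k t) \<le> 3 * nu t"
    using bound by (simp add: AE_all_countable)
  have lim: "AE t in ?M. (\<lambda>k. (N (u t - s k t))\<^sup>2) \<longlonglongrightarrow> 0"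
    using ae aeT bound_all
  proof eventually_elim
    case (elim t)
    then have V: "u t \<in> V" "\<And>k. s0 k t \<in> V" using s0(2) by auto
    have "(\<lambda>k. N (u t - s k t)) \<longlonglongrightarrow> 0"
    proof (cases "nu t = 0")
      case True
      \<comment> \<open>Where \<open>u t\<close> has norm 0 the truncation bound itself makes the
        error 0.\<close>
      then have "N (u t - s k t) = 0" for k using elim(3) N[of "u t - s k t"] by (auto intro: antisym)
      then show ?thesis by simp
    next
      case False
      then have "nu t > 0" using nu0[of t] by simp
      with elim(1) have "\<forall>\<^sub>F k in sequentially. N (s0 k t - u t) < nu t"
        by (intro order_tendstoD(2)) auto
      then have "\<forall>\<^sub>F k in sequentially. N (s0 k t - u t) = N (u t - s k t)"
      proof eventually_elim
        case (elim k)
        then have "N (s0 k t - z) \<le> 2 * nu t"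
          using triangle[OF V(2) V(1) zero(1), of k] by (simp add: nu_def)
        then show ?case using commute[OF V(2,1), of k] by (simp add: s_def)
      qed
      then show ?thesis using elim(1) by (auto intro: Lim_transform_eventually)
    qed
    then show ?case using tendsto_power[of _ 0 sequentially 2] by fastforce
  qed
  have "(\<lambda>k. LINT t|?M. (N (u t - s k t))\<^sup>2) \<longlonglongrightarrow> (LINT t|?M. 0)"
    by (rule integral_dominated_convergence[OF _ m2 i9 lim bound2]) simp
  then have lim0: "(\<lambda>k. LINT t|?M. (N (u t - s k t))\<^sup>2) \<longlonglongrightarrow> 0" by simp
  have "square_integrable ?M (\<lambda>t. N (u t - s k t))" for k
    unfolding square_integrable_def
    using m Bochner_Integration.integrable_bound[OF i9 m2] bound2 nu0 by auto
  from that[OF s_simple sV this lim0] show ?thesis .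
qed

section \<open>Distributional time derivatives\<close>

lemma approximate_identity:
  fixes k :: "nat \<Rightarrow> real \<Rightarrow> real"
  assumes \<Gamma>: "continuous_on {a..b} \<Gamma>" and p: "p \<in> {a..b}"
    and k: "\<And>n. continuous_on {a..b} (k n)" "\<And>n x. k n x \<ge> 0"
    and mass: "\<forall>\<^sub>F n in sequentially. integral {a..b} (k n) = 1"
    and local: "\<And>\<delta>. \<delta> > 0 \<Longrightarrow> \<forall>\<^sub>F n in sequentially. \<forall>x. \<bar>x - p\<bar> \<ge> \<delta> \<longrightarrow> k n x = 0"
  shows "(\<lambda>n. integral {a..b} (\<lambda>x. k n x * \<Gamma> x)) \<longlonglongrightarrow> \<Gamma> p"
proof (rule tendstoI)
  fix e :: real assume e: "e > 0"
  then obtain \<delta> where \<delta>: "\<delta> > 0" "\<And>x. x \<in> {a..b} \<Longrightarrow> \<bar>x - p\<bar> < \<delta> \<Longrightarrow> \<bar>\<Gamma> x - \<Gamma> p\<bar> < e / 2"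
    using \<Gamma> p unfolding continuous_on_iff dist_real_def by (metis half_gt_zero)
  show "\<forall>\<^sub>F n in sequentially. dist (integral {a..b} (\<lambda>x. k n x * \<Gamma> x)) (\<Gamma> p) < e"
    using mass local[OF \<delta>(1)]
  proof eventually_elim
    case (elim n)
    have i1: "(\<lambda>x. k n x * \<Gamma> x) integrable_on {a..b}"
      by (intro integrable_continuous_real continuous_on_mult k \<Gamma>)
    have i2: "k n integrable_on {a..b}" by (intro integrable_continuous_real k)
    have "integral {a..b} (\<lambda>x. k n x * \<Gamma> x) - \<Gamma> p = integral {a..b} (\<lambda>x. k n x * \<Gamma> x) - integral {a..b} (\<lambda>x. k n x * \<Gamma> p)"
      using elim(1) by simp
    also have "\<dots> = integral {a..b} (\<lambda>x. k n x * \<Gamma> x - k n x * \<Gamma> p)"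
      using i1 i2 by (intro Henstock_Kurzweil_Integration.integral_diff[symmetric] integrable_on_mult_left)
    also have "norm \<dots> \<le> integral {a..b} (\<lambda>x. k n x * (e / 2))"
    proof (rule integral_norm_bound_integral)
      show "(\<lambda>x. k n x * \<Gamma> x - k n x * \<Gamma> p) integrable_on {a..b}"
        using i1 i2 by (intro Henstock_Kurzweil_Integration.integrable_diff integrable_on_mult_left)
      show "(\<lambda>x. k n x * (e / 2)) integrable_on {a..b}" using i2 by (rule integrable_on_mult_left)
      fix x assume x: "x \<in> {a..b}"
      have "norm (k n x * \<Gamma> x - k n x * \<Gamma> p) = k n x * \<bar>\<Gamma> x - \<Gamma> p\<bar>"
        using k(2)[of n x] by (simp add: abs_mult right_diff_distrib[symmetric])
      also have "\<dots> \<le> k n x * (e / 2)"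
      proof (cases "\<bar>x - p\<bar> < \<delta>")
        case True
        then show ?thesis using \<delta>(2)[OF x] k(2)[of n x] by (intro mult_left_mono) auto
      next
        case False
        then show ?thesis using elim(2) by simp
      qed
      finally show "norm (k n x * \<Gamma> x - k n x * \<Gamma> p) \<le> k n x * (e / 2)" .
    qed
    also have "\<dots> = e / 2" using elim(1) by simp
    finally show ?case using e by (simp add: dist_real_def)
  qed
qed

lemma eventually_ge_sequentially: "\<forall>\<^sub>F n in sequentially. real n \<ge> c"
  using filterlim_real_sequentially by (rule filterlim_at_top[THEN iffD1, rule_format])

lemma tent_integral:
  assumes "a \<le> b"
  shows "integral {a..b} (\<lambda>x. n * tent (n * (x - r))) = smoothstep (n * (b - r)) - smoothstep (n * (a - r))"
    and "integral {a..b} (\<lambda>x. n * tent (n * (t - x))) = smoothstep (n * (t - a)) - smoothstep (n * (t - b))"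
proof -
  have "((\<lambda>x. n * tent (n * (x - r))) has_integral smoothstep (n * (b - r)) - smoothstep (n * (a - r))) {a..b}"
    by (rule fundamental_theorem_of_calculus[OF assms])
       (auto intro!: derivative_eq_intros simp: has_real_derivative_iff_has_vector_derivative[symmetric])
  then show "integral {a..b} (\<lambda>x. n * tent (n * (x - r))) = smoothstep (n * (b - r)) - smoothstep (n * (a - r))"
    by (rule integral_unique)
  have "((\<lambda>x. n * tent (n * (t - x))) has_integral - smoothstep (n * (t - b)) - - smoothstep (n * (t - a))) {a..b}"
    by (rule fundamental_theorem_of_calculus[OF assms])
       (auto intro!: derivative_eq_intros simp: has_real_derivative_iff_has_vector_derivative[symmetric])
  from integral_unique[OF this]
  show "integral {a..b} (\<lambda>x. n * tent (n * (t - x))) = smoothstep (n * (t - a)) - smoothstep (n * (t - b))"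
    by linarith
qed

lemma eventually_scaled_tent_eq_0:
  assumes "\<delta> > 0"
  shows "\<forall>\<^sub>F n in sequentially. \<forall>y. \<bar>y\<bar> \<ge> \<delta> \<longrightarrow> real n * tent (real n * y) = 0"
  using eventually_ge_sequentially[of "1 / \<delta>"]
proof eventually_elim
  case (elim n)
  then have n: "real n * \<delta> \<ge> 1" using assms by (simp add: field_simps)
  show ?case
  proof (intro allI impI)
    fix y :: real assume "\<bar>y\<bar> \<ge> \<delta>"
    then consider "y \<ge> \<delta>" | "y \<le> 0" by linarith
    then have "real n * y \<le> 0 \<or> real n * y \<ge> 1"
    proof cases
      case 1
      then have "real n * y \<ge> real n * \<delta>" by (intro mult_left_mono) auto
      then show ?thesis using n by linarith
    qed (auto simp: mult_le_0_iff)
    then show "real n * tent (real n * y) = 0" by (simp add: tent_eq_0)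
  qed
qed

text \<open>The derivative of a steep bump is a positive pulse of mass 1 just after \<open>r\<close>
  and a negative one just before \<open>t\<close>; each is an approximate identity.\<close>

lemma bump_deriv_integral_tendsto:
  assumes \<Gamma>: "continuous_on {0..T} \<Gamma>" and rt: "0 < r" "r < t" "t < T"
  shows "(\<lambda>n. LINT x|lebesgue_on {0..T}. bump_deriv (real n) r t x * \<Gamma> x) \<longlonglongrightarrow> \<Gamma> r - \<Gamma> t"
proof -
  let ?k1 = "\<lambda>n x. real n * tent (real n * (x - r))" and ?k2 = "\<lambda>n x. real n * tent (real n * (t - x))"
  have c: "continuous_on {0..T} (?k1 n)" "continuous_on {0..T} (?k2 n)" for n
    by (intro continuous_intros)+
  have "(\<lambda>n. integral {0..T} (\<lambda>x. ?k1 n x * \<Gamma> x)) \<longlonglongrightarrow> \<Gamma> r"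
  proof (rule approximate_identity[OF \<Gamma>])
    show "\<forall>\<^sub>F n in sequentially. integral {0..T} (?k1 n) = 1"
      using eventually_ge_sequentially[of "1 / (T - r)"]
    proof eventually_elim
      case (elim n)
      then have "real n * (T - r) \<ge> 1" using rt by (simp add: field_simps)
      then show ?case using rt by (subst tent_integral) (auto simp: smoothstep_eq_1 smoothstep_eq_0)
    qed
    fix \<delta> :: real assume \<delta>: "\<delta> > 0"
    show "\<forall>\<^sub>F n in sequentially. \<forall>x. \<bar>x - r\<bar> \<ge> \<delta> \<longrightarrow> ?k1 n x = 0"
      using eventually_scaled_tent_eq_0[OF \<delta>]
      by eventually_elim (auto simp: abs_minus_commute)
  qed (use c rt in \<open>auto simp: tent_nonneg\<close>)
  moreover have "(\<lambda>n. integral {0..T} (\<lambda>x. ?k2 n x * \<Gamma> x)) \<longlonglongrightarrow> \<Gamma> t"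
  proof (rule approximate_identity[OF \<Gamma>])
    show "\<forall>\<^sub>F n in sequentially. integral {0..T} (?k2 n) = 1"
      using eventually_ge_sequentially[of "1 / t"]
    proof eventually_elim
      case (elim n)
      then have "real n * t \<ge> 1" using rt by (simp add: field_simps)
      moreover have "real n * (t - T) \<le> 0" using rt by (simp add: mult_le_0_iff)
      ultimately show ?case using rt by (subst tent_integral) (auto simp: smoothstep_eq_1 smoothstep_eq_0)
    qed
    fix \<delta> :: real assume \<delta>: "\<delta> > 0"
    show "\<forall>\<^sub>F n in sequentially. \<forall>x. \<bar>x - t\<bar> \<ge> \<delta> \<longrightarrow> ?k2 n x = 0"
      using eventually_scaled_tent_eq_0[OF \<delta>]
      by eventually_elim (auto simp: abs_minus_commute)
  qed (use c rt in \<open>auto simp: tent_nonneg\<close>)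
  ultimately have lim: "(\<lambda>n. integral {0..T} (\<lambda>x. ?k1 n x * \<Gamma> x) - integral {0..T} (\<lambda>x. ?k2 n x * \<Gamma> x)) \<longlonglongrightarrow> \<Gamma> r - \<Gamma> t"
    by (rule tendsto_diff)
  have ev: "\<forall>\<^sub>F n in sequentially. integral {0..T} (\<lambda>x. ?k1 n x * \<Gamma> x) - integral {0..T} (\<lambda>x. ?k2 n x * \<Gamma> x) =
      (LINT x|lebesgue_on {0..T}. bump_deriv (real n) r t x * \<Gamma> x)"
    \<comment> \<open>From \<open>n * (t - r) \<ge> 2\<close> on the ramps are disjoint: where one
      hat is active the other step is already 1.\<close>
    using eventually_ge_sequentially[of "2 / (t - r)"]
  proof eventually_elim
    case (elim n)
    then have n: "real n * (t - r) \<ge> 2" using rt by (simp add: field_simps)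
    have eq: "bump_deriv (real n) r t x = ?k1 n x - ?k2 n x" for x
    proof -
      have s: "real n * (x - r) + real n * (t - x) \<ge> 2" using n by (simp add: algebra_simps)
      have 1: "tent (real n * (x - r)) * smoothstep (real n * (t - x)) = tent (real n * (x - r))"
        using s by (cases "real n * (x - r) \<ge> 1") (auto simp: tent_eq_0 smoothstep_eq_1)
      have 2: "smoothstep (real n * (x - r)) * tent (real n * (t - x)) = tent (real n * (t - x))"
        using s by (cases "real n * (t - x) \<ge> 1") (auto simp: tent_eq_0 smoothstep_eq_1)
      show ?thesis unfolding bump_deriv_def mult.assoc 1 2 ..
    qed
    have "(LINT x|lebesgue_on {0..T}. bump_deriv (real n) r t x * \<Gamma> x) = integral {0..T} (\<lambda>x. bump_deriv (real n) r t x * \<Gamma> x)"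
      by (intro lebesgue_integral_eq_integral continuous_imp_integrable_real continuous_intros \<Gamma>) simp
    also have "\<dots> = integral {0..T} (\<lambda>x. ?k1 n x * \<Gamma> x - ?k2 n x * \<Gamma> x)"
      by (simp only: eq left_diff_distrib)
    also have "\<dots> = integral {0..T} (\<lambda>x. ?k1 n x * \<Gamma> x) - integral {0..T} (\<lambda>x. ?k2 n x * \<Gamma> x)"
      by (intro Henstock_Kurzweil_Integration.integral_diff integrable_continuous_real continuous_on_mult c \<Gamma>)
    finally show ?case by simp
  qed
  show ?thesis by (rule Lim_transform_eventually[OF lim ev])
qed

text \<open>Bumps approximating the indicator of the interval turn the distributional identity into
  an increment formula at interior times. Near 0 and \<open>T\<close> no bump has room; there
  continuity takes over, as \<open>\<Gamma>\<close> minus the primitive of \<open>g\<close> is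
  constant on the open interval and hence on its closure.\<close>

lemma primitive_of_distributional_derivative:
  fixes \<Gamma> g :: "real \<Rightarrow> real"
  assumes \<Gamma>: "continuous_on {0..T} \<Gamma>" and g: "integrable (lebesgue_on {0..T}) g"
    and test: "\<And>\<psi> \<psi>'. test_function {0<..<T} \<psi> \<psi>' \<Longrightarrow>
      (LINT t|lebesgue_on {0..T}. \<psi>' t * \<Gamma> t) = - (LINT t|lebesgue_on {0..T}. \<psi> t * g t)"
    and rt: "0 \<le> r" "r \<le> t" "t \<le> T"
  shows "\<Gamma> t - \<Gamma> r = (LINT x|lebesgue_on {r..t}. g x)"
proof -
  let ?L = "lebesgue_on {0..T}"
  have gm: "g \<in> borel_measurable ?L" using g by simp
  have inner: "\<Gamma> t - \<Gamma> r = (LINT x|lebesgue_on {r..t}. g x)" if rt: "0 < r" "r < t" "t < T" for r t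
  proof -
    have bm: "bump (real n) r t \<in> borel_measurable ?L" for n
      by (intro continuous_imp_measurable_on_sets_lebesgue continuous_intros) simp
    have "(\<lambda>n. LINT x|?L. bump (real n) r t x * g x) \<longlonglongrightarrow> (LINT x|?L. indicator (box r t) x * g x)"
    proof (rule integral_dominated_convergence[where w = "\<lambda>x. \<bar>g x\<bar>"])
      have "(indicator (box r t) :: real \<Rightarrow> real) \<in> borel_measurable ?L"
        by (intro measurable_restrict_space1 borel_measurable_indicator) (simp add: borel_open)
      then show "(\<lambda>x. indicator (box r t) x * g x) \<in> borel_measurable ?L"
        using gm by (rule borel_measurable_times)
      show "(\<lambda>x. bump (real n) r t x * g x) \<in> borel_measurable ?L" for n
        using bm gm by (rule borel_measurable_times)
      show "AE x in ?L. (\<lambda>n. bump (real n) r t x * g x) \<longlonglongrightarrow> indicator (box r t) x * g x"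
        unfolding box_real by (intro AE_I2 tendsto_mult_right bump_tendsto)
      show "AE x in ?L. norm (bump (real n) r t x * g x) \<le> \<bar>g x\<bar>" for n
        by (intro AE_I2) (simp add: abs_mult bump_bounds mult_left_le_one_le)
    qed (use g in simp)
    moreover have "(LINT x|?L. bump_deriv (real n) r t x * \<Gamma> x) = - (LINT x|?L. bump (real n) r t x * g x)" for n
      by (intro test test_function_bump_real) (use rt in auto)
    ultimately have "(\<lambda>n. LINT x|?L. bump_deriv (real n) r t x * \<Gamma> x) \<longlonglongrightarrow> - (LINT x|?L. indicator (box r t) x * g x)"
      by (simp add: tendsto_minus)
    then have "\<Gamma> r - \<Gamma> t = - (LINT x|?L. indicator (box r t) x * g x)"
      using bump_deriv_integral_tendsto[OF \<Gamma> rt] LIMSEQ_unique by blast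
    also have "(LINT x|?L. indicator (box r t) x * g x) = (LINT x|lebesgue_on {r..t}. g x)"
      using rt by (subst integral_indicator_box_Icc[OF gm]) (simp add: max_absorb2 min_absorb2)
    finally show ?thesis by simp
  qed
  show ?thesis
  proof (cases "T = 0 \<or> r = t")
    case True
    then have "r = t" using rt by auto
    moreover have "(LINT x|lebesgue_on {t..t}. g x) = 0" by (rule integral_eq_zero_null_sets) simp
    ultimately show ?thesis by simp
  next
    case False
    then have T: "T > 0" using rt by auto
    define I where "I x = (LINT y|lebesgue_on {0..x}. g y)" for x
    have Ic: "continuous_on {0..T} I" unfolding I_def using g by (rule indefinite_integral_continuous_real)
    have Idiff: "I t - I r = (LINT x|lebesgue_on {r..t}. g x)" if "0 \<le> r" "r \<le> t" "t \<le> T" for r t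
      using integral_combine[OF integrable_subinterval[OF g], of 0 t r] that by (simp add: I_def)
    have "\<Gamma> x - I x = \<Gamma> (T / 2) - I (T / 2)" if x: "x \<in> {0..T}" for x
    proof (rule continuous_constant_on_closure[of "{0<..<T}" "\<lambda>x. \<Gamma> x - I x"])
      show "continuous_on (closure {0<..<T}) (\<lambda>x. \<Gamma> x - I x)"
        using T \<Gamma> Ic by (simp add: continuous_on_diff)
      show "x \<in> closure {0<..<T}" using T x by simp
      fix y assume y: "y \<in> {0<..<T}"
      consider "y < T / 2" | "y = T / 2" | "y > T / 2" by linarith
      then show "\<Gamma> y - I y = \<Gamma> (T / 2) - I (T / 2)"
        by cases (use y T inner[of y "T / 2"] inner[of "T / 2" y] Idiff[of y "T / 2"] Idiff[of "T / 2" y] in auto)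
    qed
    from this[of t] this[of r] show ?thesis using Idiff[OF rt] rt by simp
  qed
qed

section \<open>Matrix estimates in dimension two\<close>

lemma trace_transpose_mult_2:
  fixes A B C :: "real^2^2"
  shows "trace (transpose A ** B ** C) = A \<bullet> (B ** C)"
  by (simp add: trace_def transpose_def matrix_matrix_mult_def inner_vec_def sum_2 algebra_simps)

text \<open>The product \<open>A ** J\<close> acts on the columns of \<open>J\<close>; ellipticity
  is applied to each of the two and the results are added.\<close>

lemma coercive_matrix_mult_2:
  fixes A J :: "real^2^2"
  assumes "\<And>\<xi>. \<xi> \<bullet> (A *v \<xi>) \<ge> \<alpha> * (norm \<xi>)\<^sup>2"
  shows "J \<bullet> (A ** J) \<ge> \<alpha> * (norm J)\<^sup>2"
  using assms[of "\<chi> i. J $ i $ 1"] assms[of "\<chi> i. J $ i $ 2"]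
  by (simp add: power2_norm_eq_inner inner_vec_def sum_2 matrix_vector_mult_def matrix_matrix_mult_def algebra_simps)

text \<open>Each entry is a sum of two products, hence at most \<open>2 * K * norm J\<close>; four
  entries contribute another factor 2.\<close>

lemma norm_matrix_mult_2_le:
  fixes A J :: "real^2^2"
  assumes A: "\<And>i j. \<bar>A $ i $ j\<bar> \<le> K"
  shows "norm (A ** J) \<le> 4 * K * norm J"
proof -
  have K: "K \<ge> 0" using order_trans[OF abs_ge_zero A] .
  have "\<bar>(A ** J) $ i $ j\<bar> \<le> 2 * K * norm J" for i j
  proof -
    have J: "\<bar>J $ k $ j\<bar> \<le> norm J" for k
      using component_le_norm_cart[of "J $ k" j] Finite_Cartesian_Product.norm_nth_le[of J k] by linarith
    have "\<bar>A $ i $ k * J $ k $ j\<bar> \<le> K * norm J" for k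
      unfolding abs_mult by (intro mult_mono A J K) auto
    from this[of 1] this[of 2] show ?thesis
      by (simp add: matrix_matrix_mult_def sum_2)
  qed
  then have entry: "(norm ((A ** J) $ i $ j))\<^sup>2 \<le> (2 * K * norm J)\<^sup>2" for i j
    by (intro power_mono) auto
  have "(norm (A ** J))\<^sup>2 \<le> (\<Sum>i\<in>(UNIV :: 2 set). \<Sum>j\<in>(UNIV :: 2 set). (2 * K * norm J)\<^sup>2)"
    unfolding power2_norm_vec_eq_sum by (intro sum_mono entry)
  also have "\<dots> = (4 * K * norm J)\<^sup>2" by (simp add: power_mult_distrib sum_2)
  finally show ?thesis using K by (simp add: power2_le_iff_abs_le)
qed

section \<open>The cross-diffusion problem\<close>

context bounded_open_domain
begin

section \<open>Dual pairings and the norm of the Jacobian\<close>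

lemma H1_dual_of_diff:
  assumes F: "F \<in> H1_dual \<Omega>" and f: "f \<in> H1 \<Omega>" and g: "g \<in> H1 \<Omega>"
  shows "F (\<lambda>x. f x - g x) = F f - F g"
proof -
  have add: "\<And>f g. f \<in> H1 \<Omega> \<Longrightarrow> g \<in> H1 \<Omega> \<Longrightarrow> F (\<lambda>x. f x + g x) = F f + F g"
    and scale: "\<And>c f. f \<in> H1 \<Omega> \<Longrightarrow> F (\<lambda>x. c * f x) = c * F f"
    using F unfolding H1_dual_def by blast+
  have "F (\<lambda>x. f x + (-1) * g x) = F f + (-1) * F g"
    using add[OF f H1_scale(1)[OF g, of "-1"]] scale[OF g, of "-1"] by simp
  then show ?thesis by simp
qed

text \<open>Continuity of the evaluation at \<open>w\<close> carries measurability from simple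
  functions to their limit, and the dual norm dominates the square.\<close>

lemma L2_bochner_dual_pairing:
  assumes F: "L2_bochner T (H1_dual \<Omega>) (norm_H1_dual \<Omega>) F" and w: "w \<in> H1 \<Omega>"
  shows "square_integrable (lebesgue_on {0..T}) (\<lambda>t. F t w)"
proof -
  let ?L = "lebesgue_on {0..T}"
  obtain s where s: "\<And>n. simple_function ?L (s n)" "\<And>n t. t \<in> {0..T} \<Longrightarrow> s n t \<in> H1_dual \<Omega>"
    and ae: "AE t in ?L. F t \<in> H1_dual \<Omega> \<and> (\<lambda>n. norm_H1_dual \<Omega> (s n t - F t)) \<longlonglongrightarrow> 0"
    and F2: "integrable ?L (\<lambda>t. (norm_H1_dual \<Omega> (F t))\<^sup>2)"
    using F unfolding L2_bochner_def by blast
  obtain c where c: "\<And>G. G \<in> H1_dual \<Omega> \<Longrightarrow> \<bar>G w\<bar> \<le> c * norm_H1_dual \<Omega> G"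
    using H1_dual_bound[OF w] by blast
  have aeT: "AE t in ?L. t \<in> {0..T}" by (rule AE_I2) simp
  have m: "(\<lambda>t. F t w) \<in> borel_measurable ?L"
  proof (rule borel_measurable_lebesgue_on_AE_limit[where f = "\<lambda>n t. s n t w"])
    show "(\<lambda>t. s n t w) \<in> borel_measurable ?L" for n
      by (intro borel_measurable_simple_function simple_function_compose1[OF s(1), of "\<lambda>G. G w"])
    show "AE t in ?L. (\<lambda>n. s n t w) \<longlonglongrightarrow> F t w"
      using ae aeT
    proof eventually_elim
      case (elim t)
      have "norm (s n t w - F t w) \<le> c * norm_H1_dual \<Omega> (s n t - F t)" for n
        using c[OF H1_dual_diff[OF s(2)[OF elim(2), of n] conjunct1[OF elim(1)]]] by (simp add: fun_diff_def)
      then have "(\<lambda>n. s n t w - F t w) \<longlonglongrightarrow> 0"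
        by (intro Lim_null_comparison[OF _ tendsto_mult_right_zero[OF conjunct2[OF elim(1)]]]
            always_eventually allI)
      then show ?case by (rule LIM_zero_cancel)
    qed
  qed auto
  have "integrable ?L (\<lambda>t. (norm (F t w))\<^sup>2)"
  proof (rule Bochner_Integration.integrable_bound)
    show "integrable ?L (\<lambda>t. c\<^sup>2 * (norm_H1_dual \<Omega> (F t))\<^sup>2)" using F2 by simp
    show "(\<lambda>t. (norm (F t w))\<^sup>2) \<in> borel_measurable ?L" using m by simp
    show "AE t in ?L. norm ((norm (F t w))\<^sup>2) \<le> norm (c\<^sup>2 * (norm_H1_dual \<Omega> (F t))\<^sup>2)"
      using ae
    proof eventually_elim
      case (elim t)
      then have "(norm (F t w))\<^sup>2 \<le> (c * norm_H1_dual \<Omega> (F t))\<^sup>2"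
        using c[of "F t"] by (intro power_mono) auto
      then show ?case by (simp add: power_mult_distrib)
    qed
  qed
  then show ?thesis using m by (simp add: square_integrable_def)
qed

definition jacobian_norm :: "(real^2 \<Rightarrow> real^2) \<Rightarrow> real" where
  "jacobian_norm v = sqrt (LINT x|M. (norm (jacobian \<Omega> v x))\<^sup>2)"

lemma jacobian_norm_nonneg: "jacobian_norm v \<ge> 0"
  by (simp add: jacobian_norm_def)

lemma jacobian_norm_power2: "(jacobian_norm v)\<^sup>2 = (LINT x|M. (norm (jacobian \<Omega> v x))\<^sup>2)"
  by (simp add: jacobian_norm_def)

lemma jacobian_norm_le_norm_X1:
  assumes "v \<in> X1 \<Omega>"
  shows "jacobian_norm v \<le> norm_X1 \<Omega> v"
  unfolding jacobian_norm_def norm_X1_eq[OF assms]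
proof (intro real_sqrt_le_mono integral_mono)
  show "integrable M (\<lambda>x. (norm (jacobian \<Omega> v x))\<^sup>2)"
    using jacobian_square_integrable[OF assms] by (simp add: square_integrable_def)
  show "integrable M (\<lambda>x. (norm (v x, jacobian \<Omega> v x))\<^sup>2)"
    using X1_pair_square_integrable[OF assms] by (simp add: square_integrable_def)
qed (simp add: norm_Pair)

lemma jacobian_norm_const: "jacobian_norm (\<lambda>x. c) = 0"
proof -
  have "(LINT x|M. (norm (jacobian \<Omega> (\<lambda>x. c) x))\<^sup>2) = 0"
    by (rule integral_eq_zero_AE) (use X1_const(2)[of c] in \<open>auto elim: eventually_mono\<close>)
  then show ?thesis by (simp add: jacobian_norm_def)
qed

lemma norm_X1_zero: "norm_X1 \<Omega> (\<lambda>x. 0) = 0"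
proof -
  have "(LINT x|M. (norm (0 :: real^2, jacobian \<Omega> (\<lambda>x. 0) x))\<^sup>2) = 0"
    by (rule integral_eq_zero_AE) (use X1_const(2)[of 0] in \<open>auto elim!: eventually_mono simp: norm_Pair\<close>)
  then show ?thesis using norm_X1_eq[OF X1_const(1)[of 0]] by simp
qed

end

text \<open>One time horizon with one choice of time derivatives. The coefficient bounds are stated
  at points of the plane, and \<open>\<alpha>\<close>, \<open>K\<close> and \<open>C\<close> are
  parameters, so the same constants can be used for every horizon and yield a common decay
  rate.\<close>

locale cross_diffusion_solution = bounded_open_domain \<Omega> for \<Omega> +
  fixes D :: "real^2 \<Rightarrow> real^2^2" and \<alpha> L K C T :: real
    and u0 :: "real^2 \<Rightarrow> real^2" and u :: "real \<Rightarrow> real^2 \<Rightarrow> real^2"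
    and ut vt :: "real \<Rightarrow> (real^2 \<Rightarrow> real) \<Rightarrow> real"
  assumes \<alpha>: "\<alpha> > 0" and C: "C \<ge> 0" and T: "T > 0"
    and elliptic: "\<And>z \<xi>. \<xi> \<bullet> (D z *v \<xi>) \<ge> \<alpha> * (norm \<xi>)\<^sup>2"
    and lipschitz: "\<And>z z' i j. \<bar>D z' $ i $ j - D z $ i $ j\<bar> \<le> L * norm (z' - z)"
    and bound: "\<And>z i j. \<bar>D z $ i $ j\<bar> \<le> K"
    and poincare: "\<And>v. v \<in> X1 \<Omega> \<Longrightarrow>
      (LINT x|M. (norm (v x - mean_vec \<Omega> v))\<^sup>2) \<le> C * (LINT x|M. (norm (jacobian \<Omega> v x))\<^sup>2)"
    and u0: "u0 \<in> X1 \<Omega>"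
    and u_cont: "cont_X0 \<Omega> T u" and u_bochner: "L2_bochner T (X1 \<Omega>) (norm_X1 \<Omega>) u"
    and u_init: "AE x in M. u 0 x = u0 x"
    and ut: "time_derivative \<Omega> T (\<lambda>t x. u t x $ 1) ut"
    and vt: "time_derivative \<Omega> T (\<lambda>t x. u t x $ 2) vt"
    and weak_eq: "AE t in lebesgue_on {0..T}. \<forall>w\<in>X1 \<Omega>.
       ut t (\<lambda>x. w x $ 1) + vt t (\<lambda>x. w x $ 2) +
       (LINT x|M. trace (transpose (jacobian \<Omega> w x) ** D (u t x) ** jacobian \<Omega> (u t) x)) = 0"
begin

section \<open>Pairings with the solution and their time derivatives\<close>

definition pairing :: "(real^2 \<Rightarrow> real^2) \<Rightarrow> real \<Rightarrow> real" where
  "pairing v t = (LINT x|M. u t x \<bullet> v x)"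

definition du :: "(real^2 \<Rightarrow> real^2) \<Rightarrow> real \<Rightarrow> real" where
  "du v t = ut t (\<lambda>x. v x $ 1) + vt t (\<lambda>x. v x $ 2)"

definition energy :: "real \<Rightarrow> real" where
  "energy t = (LINT x|M. (norm (u t x))\<^sup>2)"

lemma u_square_integrable: "t \<in> {0..T} \<Longrightarrow> square_integrable M (u t)"
  using u_cont by (simp add: cont_X0_def X0_iff)

lemma u_distance_tendsto:
  assumes "t \<in> {0..T}"
  shows "((\<lambda>s. sqrt (LINT x|M. (norm (u s x - u t x))\<^sup>2)) \<longlongrightarrow> 0) (at t within {0..T})"
proof (rule Lim_transform_eventually)
  show "((\<lambda>s. norm_X0 \<Omega> (u s - u t)) \<longlongrightarrow> 0) (at t within {0..T})"
    using u_cont assms by (simp add: cont_X0_def)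
  have "\<forall>\<^sub>F s in at t within {0..T}. s \<in> {0..T}" by (simp add: eventually_at_filter)
  then show "\<forall>\<^sub>F s in at t within {0..T}. norm_X0 \<Omega> (u s - u t) = sqrt (LINT x|M. (norm (u s x - u t x))\<^sup>2)"
  proof eventually_elim
    case (elim s)
    have "u s - u t \<in> X0 \<Omega>"
      using square_integrable_diff[OF u_square_integrable[OF elim] u_square_integrable[OF assms]]
      by (simp add: X0_iff fun_diff_def)
    then show ?case by (simp add: norm_X0_eq)
  qed
qed

lemma pairing_continuous:
  assumes v: "square_integrable M v"
  shows "continuous_on {0..T} (pairing v)"
  unfolding continuous_on_def
proof
  fix t assume t: "t \<in> {0..T}"
  let ?d = "\<lambda>s. sqrt (LINT x|M. (norm (u s x - u t x))\<^sup>2)" and ?v = "sqrt (LINT x|M. (norm (v x))\<^sup>2)"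
  have "((\<lambda>s. pairing v s - pairing v t) \<longlongrightarrow> 0) (at t within {0..T})"
  proof (rule Lim_null_comparison)
    have "\<forall>\<^sub>F s in at t within {0..T}. s \<in> {0..T}" by (simp add: eventually_at_filter)
    then show "\<forall>\<^sub>F s in at t within {0..T}. norm (pairing v s - pairing v t) \<le> ?d s * ?v"
    proof eventually_elim
      case (elim s)
      note us = u_square_integrable[OF elim] u_square_integrable[OF t]
      have "pairing v s - pairing v t = (LINT x|M. (u s x - u t x) \<bullet> v x)"
        using us[THEN square_integrable_inner, OF v] by (simp add: pairing_def inner_diff_left)
      then show ?case using Cauchy_Schwarz_integral[OF square_integrable_diff[OF us] v] by simp
    qed
    show "((\<lambda>s. ?d s * ?v) \<longlongrightarrow> 0) (at t within {0..T})"
      by (rule tendsto_mult_left_zero[OF u_distance_tendsto[OF t]])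
  qed
  then show "(pairing v \<longlongrightarrow> pairing v t) (at t within {0..T})" by (rule LIM_zero_cancel)
qed

lemma energy_continuous: "continuous_on {0..T} energy"
proof -
  \<comment> \<open>For the square root, continuity is the reverse triangle inequality.\<close>
  have "continuous_on {0..T} (\<lambda>t. sqrt (energy t))"
    unfolding continuous_on_def
  proof
    fix t assume t: "t \<in> {0..T}"
    have "((\<lambda>s. sqrt (energy s) - sqrt (energy t)) \<longlongrightarrow> 0) (at t within {0..T})"
    proof (rule Lim_null_comparison[OF _ u_distance_tendsto[OF t]])
      have "\<forall>\<^sub>F s in at t within {0..T}. s \<in> {0..T}" by (simp add: eventually_at_filter)
      then show "\<forall>\<^sub>F s in at t within {0..T}. norm (sqrt (energy s) - sqrt (energy t)) \<le> sqrt (LINT x|M. (norm (u s x - u t x))\<^sup>2)"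
      proof eventually_elim
        case (elim s)
        note s = u_square_integrable[OF elim] and t = u_square_integrable[OF t]
        have "sqrt (energy s) \<le> sqrt (LINT x|M. (norm (u s x - u t x))\<^sup>2) + sqrt (energy t)"
          using square_integrable_norm_triangle[OF square_integrable_diff[OF s t] t] by (simp add: energy_def)
        moreover have "sqrt (energy t) \<le> sqrt (LINT x|M. (norm (u t x - u s x))\<^sup>2) + sqrt (energy s)"
          using square_integrable_norm_triangle[OF square_integrable_diff[OF t s] s] by (simp add: energy_def)
        ultimately show ?case by (simp add: norm_minus_commute abs_le_iff)
      qed
    qed
    then show "((\<lambda>t. sqrt (energy t)) \<longlongrightarrow> sqrt (energy t)) (at t within {0..T})" by (rule LIM_zero_cancel)
  qed
  then have "continuous_on {0..T} (\<lambda>t. (sqrt (energy t))\<^sup>2)" by (rule continuous_on_power)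
  moreover have "(sqrt (energy t))\<^sup>2 = energy t" for t by (simp add: energy_def)
  ultimately show ?thesis by simp
qed

text \<open>The expansion of the squared distance between \<open>u r\<close> and \<open>u t\<close>,
  which is nonnegative; \<open>pairing (u t) t\<close> equals \<open>energy t\<close>.\<close>

lemma energy_difference_le:
  assumes "t \<in> {0..T}" "r \<in> {0..T}"
  shows "energy t - energy r \<le> 2 * (pairing (u t) t - pairing (u t) r)"
proof -
  have "0 \<le> (LINT x|M. (norm (u r x - u t x))\<^sup>2)" by simp
  also have "\<dots> = energy r - 2 * pairing (u t) r + energy t"
    using square_integrable_diff_norm[OF assms(2,1)[THEN u_square_integrable]] by (simp add: energy_def pairing_def)
  finally show ?thesis by (simp add: pairing_def energy_def power2_norm_eq_inner)
qed

lemma pairing_diff: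
  assumes "x \<in> X1 \<Omega>" "y \<in> X1 \<Omega>" "t \<in> {0..T}"
  shows "pairing (x - y) t = pairing x t - pairing y t"
  using assms(1,2)[THEN X1_X0, unfolded X0_iff, THEN square_integrable_inner[OF u_square_integrable[OF assms(3)]]]
  by (simp add: pairing_def inner_diff_right)

lemma du_square_integrable:
  assumes "v \<in> X1 \<Omega>"
  shows "square_integrable (lebesgue_on {0..T}) (du v)"
proof -
  have "(\<lambda>x. v x $ i) \<in> H1 \<Omega>" for i using assms by (simp add: X1_def)
  moreover have "L2_bochner T (H1_dual \<Omega>) (norm_H1_dual \<Omega>) ut" "L2_bochner T (H1_dual \<Omega>) (norm_H1_dual \<Omega>) vt"
    using ut vt by (simp_all add: time_derivative_def)
  ultimately show ?thesis
    unfolding du_def by (intro square_integrable_add L2_bochner_dual_pairing)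
qed

lemma pairing_primitive:
  assumes v: "v \<in> X1 \<Omega>"
  shows "square_integrable_primitive T (pairing v) (du v)"
proof
  show sq: "square_integrable (lebesgue_on {0..T}) (du v)" using v by (rule du_square_integrable)
  let ?L = "lebesgue_on {0..T}"
  have vi: "(\<lambda>x. v x $ i) \<in> H1 \<Omega>" for i using v by (simp add: X1_def)
  have vsq: "square_integrable M v" using X1_X0[OF v] by (simp add: X0_iff)
  fix r t assume rt: "0 \<le> r" "r \<le> t" "t \<le> T"
  show "pairing v t - pairing v r = (LINT \<tau>|lebesgue_on {r..t}. du v \<tau>)"
  proof (rule primitive_of_distributional_derivative[OF pairing_continuous[OF vsq] square_integrable_imp_integrable_Icc[OF sq] _ rt])
    fix \<psi> \<psi>' :: "real \<Rightarrow> real" assume t: "test_function {0<..<T} \<psi> \<psi>'"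
    have c: "continuous_on UNIV \<psi>" "continuous_on UNIV \<psi>'" using test_function_bounded[OF t] by metis+
    let ?p = "\<lambda>i t. LINT x|M. u t x $ i * v x $ i"
    \<comment> \<open>The time derivatives are given by components; vectors with a single nonzero
      component extract the component pairings and their continuity.\<close>
    have axis: "square_integrable M (\<lambda>x. axis i (v x $ i) :: real^2)" for i :: 2
    proof -
      have "square_integrable M (\<lambda>x. (axis i (v x $ i) :: real^2) $ j)" for j
        using vsq by (cases "i = j") (auto simp: axis_def square_integrable_iff_nth square_integrable_const)
      then show ?thesis
        unfolding square_integrable_iff_nth[of M "\<lambda>x. axis i (v x $ i) :: real^2"] by blast
    qed
    have pc: "continuous_on {0..T} (?p i)" for i :: 2
      using pairing_continuous[OF axis[of i]] by (simp add: pairing_def[abs_def] inner_axis)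
    have psplit: "pairing v t = ?p 1 t + ?p 2 t" if "t \<in> {0..T}" for t
    proof -
      have "integrable M (\<lambda>x. u t x $ i * v x $ i)" for i
        using u_square_integrable[OF that] vsq
        by (intro integrable_mult_square_integrable) (simp_all add: square_integrable_iff_nth)
      then show ?thesis by (simp add: pairing_def inner_vec_def sum_2)
    qed
    have i1: "integrable ?L (\<lambda>t. \<psi>' t * ?p i t)" for i :: 2
      by (intro continuous_imp_integrable_real continuous_on_mult pc continuous_on_subset[OF c(2)]) simp
    have \<psi>sq: "square_integrable ?L \<psi>"
      by (intro square_integrable_continuous_Icc continuous_on_subset[OF c(1)]) simp
    have i2: "integrable ?L (\<lambda>t. \<psi> t * ut t (\<lambda>x. v x $ 1))" "integrable ?L (\<lambda>t. \<psi> t * vt t (\<lambda>x. v x $ 2))"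
      using square_integrable_inner[OF \<psi>sq L2_bochner_dual_pairing[OF _ vi]] ut vt
      by (auto simp: time_derivative_def)
    have "(LINT t|?L. \<psi>' t * pairing v t) = (LINT t|?L. \<psi>' t * ?p 1 t + \<psi>' t * ?p 2 t)"
      by (intro Bochner_Integration.integral_cong refl) (simp add: psplit distrib_left)
    also have "\<dots> = (LINT t|?L. \<psi>' t * ?p 1 t) + (LINT t|?L. \<psi>' t * ?p 2 t)"
      by (intro Bochner_Integration.integral_add i1)
    also have "\<dots> = - (LINT t|?L. \<psi> t * ut t (\<lambda>x. v x $ 1)) + - (LINT t|?L. \<psi> t * vt t (\<lambda>x. v x $ 2))"
    proof -
      have "(LINT t|?L. \<psi>' t * ?p 1 t) = - (LINT t|?L. \<psi> t * ut t (\<lambda>x. v x $ 1))"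
        by (rule conjunct2[OF ut[unfolded time_derivative_def], rule_format, OF vi t])
      moreover have "(LINT t|?L. \<psi>' t * ?p 2 t) = - (LINT t|?L. \<psi> t * vt t (\<lambda>x. v x $ 2))"
        by (rule conjunct2[OF vt[unfolded time_derivative_def], rule_format, OF vi t])
      ultimately show ?thesis by simp
    qed
    also have "\<dots> = - (LINT t|?L. \<psi> t * du v t)"
      using i2 by (simp add: du_def distrib_left)
    finally show "(LINT t|?L. \<psi>' t * pairing v t) = - (LINT t|?L. \<psi> t * du v t)" .
  qed
qed

text \<open>Lipschitz continuity of \<open>D\<close> makes the coefficients along \<open>u t\<close>
  measurable, and their bound keeps the product with the Jacobian in \<open>L2\<close>.\<close>

lemma flux_square_integrable:
  assumes t: "t \<in> {0..T}" and ut: "u t \<in> X1 \<Omega>"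
  shows "square_integrable M (\<lambda>x. D (u t x) ** jacobian \<Omega> (u t) x)"
    and "sqrt (LINT x|M. (norm (D (u t x) ** jacobian \<Omega> (u t) x))\<^sup>2) \<le> 4 * K * jacobian_norm (u t)"
proof -
  let ?J = "jacobian \<Omega> (u t)" and ?f = "\<lambda>x. D (u t x) ** jacobian \<Omega> (u t) x"
  have K: "K \<ge> 0" using order_trans[OF abs_ge_zero bound] .
  have J: "square_integrable M ?J" by (rule jacobian_square_integrable[OF ut])
  have um: "u t \<in> borel_measurable M" using u_square_integrable[OF t] by (simp add: square_integrable_def)
  have "continuous_on UNIV (\<lambda>z. D z $ i $ j)" for i j
  proof (rule lipschitz_on_continuous_on[OF lipschitz_onI])
    show "dist (D z' $ i $ j) (D z $ i $ j) \<le> \<bar>L\<bar> * dist z' z" for z z'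
      using lipschitz[of z' i j z] mult_right_mono[OF abs_ge_self[of L] norm_ge_zero[of "z' - z"]]
      by (simp add: dist_norm)
  qed simp
  then have Dm: "(\<lambda>x. D (u t x) $ i $ j) \<in> borel_measurable M" for i j
    using measurable_compose[OF um borel_measurable_continuous_onI] by blast
  have Jm: "(\<lambda>x. ?J x $ i $ j) \<in> borel_measurable M" for i j
    using J by (simp add: square_integrable_iff_nth square_integrable_def)
  have fm: "(\<lambda>x. ?f x $ i $ j) \<in> borel_measurable M" for i j
    unfolding matrix_matrix_mult_def using Dm Jm by (simp add: borel_measurable_sum borel_measurable_times)
  have fb: "norm (?f x) \<le> 4 * K * norm (?J x)" for x
    by (rule norm_matrix_mult_2_le[OF bound])
  have f2: "(norm (?f x))\<^sup>2 \<le> (4 * K)\<^sup>2 * (norm (?J x))\<^sup>2" for x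
    using power_mono[OF fb[of x] norm_ge_zero, of 2] by (simp add: power_mult_distrib)
  have m: "?f \<in> borel_measurable M"
    unfolding borel_measurable_euclidean_space[of ?f] using fm
    by (auto simp: Basis_vec_def inner_axis)
  have J2: "integrable M (\<lambda>x. (4 * K)\<^sup>2 * (norm (?J x))\<^sup>2)" using J by (simp add: square_integrable_def)
  have i: "integrable M (\<lambda>x. (norm (?f x))\<^sup>2)"
    by (rule Bochner_Integration.integrable_bound[OF J2]) (use m f2 in auto)
  show "square_integrable M ?f" using m i by (simp add: square_integrable_def)
  have "(LINT x|M. (norm (?f x))\<^sup>2) \<le> (LINT x|M. (4 * K)\<^sup>2 * (norm (?J x))\<^sup>2)"
    by (rule integral_mono[OF i J2 f2])
  also have "\<dots> = (4 * K * jacobian_norm (u t))\<^sup>2" by (simp add: power_mult_distrib jacobian_norm_power2)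
  finally have "sqrt (LINT x|M. (norm (?f x))\<^sup>2) \<le> sqrt ((4 * K * jacobian_norm (u t))\<^sup>2)"
    by (rule real_sqrt_le_mono)
  then show "sqrt (LINT x|M. (norm (?f x))\<^sup>2) \<le> 4 * K * jacobian_norm (u t)"
    using K jacobian_norm_nonneg[of "u t"] by (simp add: real_sqrt_abs)
qed

section \<open>The weak equation at almost every time\<close>

lemma AE_time: "AE t in lebesgue_on {0..T}. t \<in> {0..T}"
  by (rule AE_I2) simp

lemma AE_u_X1: "AE t in lebesgue_on {0..T}. u t \<in> X1 \<Omega>"
  using u_bochner unfolding L2_bochner_def by (auto elim: eventually_mono)

lemma AE_weak_eq:
  "AE t in lebesgue_on {0..T}. \<forall>w\<in>X1 \<Omega>.
     du w t = - (LINT x|M. jacobian \<Omega> w x \<bullet> (D (u t x) ** jacobian \<Omega> (u t) x))"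
  using weak_eq by eventually_elim (auto simp: du_def trace_transpose_mult_2 eq_neg_iff_add_eq_0)

text \<open>Cauchy-Schwarz in the weak equation. The exceptional times do not depend on
  \<open>v\<close>, so \<open>v\<close> may vary with \<open>t\<close>; and the Jacobian norm of
  \<open>v\<close>, rather than the full norm, makes the bound vanish on constants.\<close>

lemma AE_du_bound:
  "AE t in lebesgue_on {0..T}. \<forall>v\<in>X1 \<Omega>. \<bar>du v t\<bar> \<le> 4 * K * jacobian_norm (u t) * jacobian_norm v"
  using AE_time AE_u_X1 AE_weak_eq
proof eventually_elim
  case (elim t)
  show ?case
  proof
    fix v assume v: "v \<in> X1 \<Omega>"
    let ?f = "\<lambda>x. D (u t x) ** jacobian \<Omega> (u t) x"
    have "\<bar>du v t\<bar> = \<bar>LINT x|M. jacobian \<Omega> v x \<bullet> ?f x\<bar>" using elim(3) v by simp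
    also have "\<dots> \<le> jacobian_norm v * sqrt (LINT x|M. (norm (?f x))\<^sup>2)"
      using Cauchy_Schwarz_integral[OF jacobian_square_integrable[OF v] flux_square_integrable(1)[OF elim(1,2)]]
      by (simp add: jacobian_norm_def)
    also have "\<dots> \<le> jacobian_norm v * (4 * K * jacobian_norm (u t))"
      by (intro mult_left_mono flux_square_integrable(2)[OF elim(1,2)] jacobian_norm_nonneg)
    finally show "\<bar>du v t\<bar> \<le> 4 * K * jacobian_norm (u t) * jacobian_norm v" by (simp add: mult.commute)
  qed
qed

lemma AE_du_diff: "AE t in lebesgue_on {0..T}. \<forall>x\<in>X1 \<Omega>. \<forall>y\<in>X1 \<Omega>. du (x - y) t = du x t - du y t"
proof -
  have "AE t in lebesgue_on {0..T}. ut t \<in> H1_dual \<Omega>" "AE t in lebesgue_on {0..T}. vt t \<in> H1_dual \<Omega>"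
    using ut vt unfolding time_derivative_def L2_bochner_def by (auto elim: eventually_mono)
  then show ?thesis
  proof eventually_elim
    case (elim t)
    show ?case
    proof (intro ballI)
      fix x y assume "x \<in> X1 \<Omega>" "y \<in> X1 \<Omega>"
      then have "(\<lambda>z. x z $ i) \<in> H1 \<Omega>" "(\<lambda>z. y z $ i) \<in> H1 \<Omega>" for i by (simp_all add: X1_def)
      then show "du (x - y) t = du x t - du y t"
        using H1_dual_of_diff[OF elim(1)] H1_dual_of_diff[OF elim(2)] by (simp add: du_def)
    qed
  qed
qed

text \<open>Constants have Jacobian norm 0, so the bound on \<open>du\<close> forces the derivative
  of this pairing to vanish.\<close>

lemma pairing_const:
  assumes "t \<in> {0..T}"
  shows "pairing (\<lambda>x. c) t = pairing (\<lambda>x. c) 0"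
proof -
  interpret P: square_integrable_primitive T "pairing (\<lambda>x. c)" "du (\<lambda>x. c)"
    by (rule pairing_primitive[OF X1_const(1)])
  have "AE s in lebesgue_on {0..t}. \<forall>v\<in>X1 \<Omega>. \<bar>du v s\<bar> \<le> 4 * K * jacobian_norm (u s) * jacobian_norm v"
    by (rule AE_lebesgue_on_subset[OF AE_du_bound]) (use assms in auto)
  then have "AE s in lebesgue_on {0..t}. du (\<lambda>x. c) s = 0"
    by eventually_elim (use X1_const(1) jacobian_norm_const in fastforce)
  then have "(LINT s|lebesgue_on {0..t}. du (\<lambda>x. c) s) = 0" by (rule integral_eq_zero_AE)
  then show ?thesis using P.primitive[of 0 t] assms by simp
qed

lemma mean_vec_conserved:
  assumes "t \<in> {0..T}"
  shows "mean_vec \<Omega> (u t) = mean_vec \<Omega> u0"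
proof -
  have "(LINT x|M. u t x $ i) = (LINT x|M. u0 x $ i)" for i
  proof -
    have "(LINT x|M. u t x $ i) = (LINT x|M. u 0 x $ i)"
      using pairing_const[OF assms, of "axis i 1"] by (simp add: pairing_def inner_axis)
    also have "\<dots> = (LINT x|M. u0 x $ i)"
    proof (rule integral_cong_AE)
      have "square_integrable M (u 0)" "square_integrable M u0"
        using u_square_integrable[of 0] T X1_X0[OF u0] by (auto simp: X0_iff)
      then show "(\<lambda>x. u 0 x $ i) \<in> borel_measurable M" "(\<lambda>x. u0 x $ i) \<in> borel_measurable M"
        by (simp_all add: square_integrable_iff_nth square_integrable_def)
    qed (use u_init in \<open>auto elim: eventually_mono\<close>)
    finally show ?thesis .
  qed
  then show ?thesis by (simp add: mean_vec_def mean_def)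
qed

definition deviation :: "real \<Rightarrow> real" where
  "deviation t = (LINT x|M. (norm (u t x - mean_vec \<Omega> u0))\<^sup>2)"

text \<open>The cross term in the expansion is a pairing with a constant and therefore conserved.
  Energy and deviation thus have the same increments.\<close>

lemma deviation_eq_energy:
  assumes "t \<in> {0..T}"
  shows "deviation t = energy t + (deviation 0 - energy 0)"
proof -
  have "deviation t = energy t - 2 * pairing (\<lambda>x. mean_vec \<Omega> u0) t + (LINT x|M. (norm (mean_vec \<Omega> u0))\<^sup>2)"
    if "t \<in> {0..T}" for t
    unfolding deviation_def energy_def pairing_def
    by (rule square_integrable_diff_norm[OF u_square_integrable[OF that] square_integrable_const])
  from this[OF assms] this[of 0] show ?thesis using pairing_const[OF assms] T by simp
qed

lemma deviation_continuous: "continuous_on {0..T} deviation"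
proof -
  have "continuous_on {0..T} (\<lambda>t. energy t + (deviation 0 - energy 0))"
    by (intro continuous_intros energy_continuous)
  then show ?thesis by (rule continuous_on_eq) (simp add: deviation_eq_energy[symmetric])
qed

text \<open>The weak equation tested with \<open>u t\<close> itself, then ellipticity and the
  Poincare inequality with the conserved mean. The denominator \<open>C + 1\<close> is positive even
  if \<open>C\<close> is 0.\<close>

lemma AE_du_u_le: "AE t in lebesgue_on {0..T}. du (u t) t \<le> - (\<alpha> / (C + 1)) * deviation t"
  using AE_time AE_u_X1 AE_weak_eq
proof eventually_elim
  case (elim t)
  let ?J = "jacobian \<Omega> (u t)"
  have J: "square_integrable M ?J" by (rule jacobian_square_integrable[OF elim(2)])
  have "\<alpha> * (jacobian_norm (u t))\<^sup>2 = (LINT x|M. \<alpha> * (norm (?J x))\<^sup>2)"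
    by (simp add: jacobian_norm_power2)
  also have "\<dots> \<le> (LINT x|M. ?J x \<bullet> (D (u t x) ** ?J x))"
  proof (rule integral_mono)
    show "integrable M (\<lambda>x. \<alpha> * (norm (?J x))\<^sup>2)" using J by (simp add: square_integrable_def)
    show "integrable M (\<lambda>x. ?J x \<bullet> (D (u t x) ** ?J x))"
      by (rule square_integrable_inner[OF J flux_square_integrable(1)[OF elim(1,2)]])
  qed (rule coercive_matrix_mult_2[OF elliptic])
  also have "\<dots> = - du (u t) t" using elim(2,3) by simp
  finally have 1: "du (u t) t \<le> - (\<alpha> * (jacobian_norm (u t))\<^sup>2)" by simp
  have "deviation t \<le> C * (jacobian_norm (u t))\<^sup>2"
    using poincare[OF elim(2)] mean_vec_conserved[OF elim(1)] by (simp add: deviation_def jacobian_norm_power2)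
  also have "\<dots> \<le> (C + 1) * (jacobian_norm (u t))\<^sup>2" by (simp add: distrib_right)
  finally have "\<alpha> / (C + 1) * deviation t \<le> \<alpha> / (C + 1) * ((C + 1) * (jacobian_norm (u t))\<^sup>2)"
    using \<alpha> C by (intro mult_left_mono) auto
  also have "\<dots> = \<alpha> * (jacobian_norm (u t))\<^sup>2" using C by simp
  finally show ?case using 1 by simp
qed

lemma deviation_decay:
  assumes ab: "0 < a" "a \<le> b" "b \<le> T"
  shows "deviation b - deviation a \<le> - 2 * (\<alpha> / (C + 1)) * (LINT t|lebesgue_on {a..b}. deviation t)"
proof -
  let ?L = "lebesgue_on {0..T}"
  obtain s where s: "\<And>k. simple_function ?L (s k)" "\<And>k t. t \<in> {0..T} \<Longrightarrow> s k t \<in> X1 \<Omega>"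
    "\<And>k. square_integrable ?L (\<lambda>t. norm_X1 \<Omega> (u t - s k t))"
    "(\<lambda>k. LINT t|?L. (norm_X1 \<Omega> (u t - s k t))\<^sup>2) \<longlonglongrightarrow> 0"
  proof (rule L2_bochner_simple_approximation[OF u_bochner, where z = "\<lambda>x. 0"])
    fix s assume "\<And>k. simple_function ?L (s k)" "\<And>k t. t \<in> {0..T} \<Longrightarrow> s k t \<in> X1 \<Omega>"
      "\<And>k. square_integrable ?L (\<lambda>t. norm_X1 \<Omega> (u t - s k t))"
      "(\<lambda>k. LINT t|?L. (norm_X1 \<Omega> (u t - s k t))\<^sup>2) \<longlonglongrightarrow> 0"
    then show thesis by (rule that)
  qed (rule norm_X1_nonneg norm_X1_diff_triangle norm_X1_diff_commute X1_const(1) norm_X1_diff_zero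
         norm_X1_zero | assumption)+
  have K: "K \<ge> 0" using order_trans[OF abs_ge_zero bound] .
  have u2: "integrable ?L (\<lambda>t. (norm_X1 \<Omega> (u t))\<^sup>2)" using u_bochner by (simp add: L2_bochner_def)
  \<comment> \<open>The full norm replaces the Jacobian norm in the bound because its square is
    integrable in time by the Bochner condition; measurability is recovered through the square
    root.\<close>
  have n: "square_integrable ?L (\<lambda>t. 4 * K * norm_X1 \<Omega> (u t))"
  proof -
    have "(\<lambda>t. sqrt ((norm_X1 \<Omega> (u t))\<^sup>2)) \<in> borel_measurable ?L"
      using measurable_compose[OF borel_measurable_integrable[OF u2], of sqrt borel] by simp
    then have "(\<lambda>t. norm_X1 \<Omega> (u t)) \<in> borel_measurable ?L" by (simp add: norm_X1_nonneg)
    then have "square_integrable ?L (\<lambda>t. norm_X1 \<Omega> (u t))" using u2 by (simp add: square_integrable_def)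
    from square_integrable_scaleR[OF this, of "4 * K"] show ?thesis by simp
  qed
  have F_bound: "AE t in ?L. \<forall>v\<in>X1 \<Omega>. \<bar>du v t\<bar> \<le> 4 * K * norm_X1 \<Omega> (u t) * norm_X1 \<Omega> v"
    using AE_du_bound AE_u_X1
  proof eventually_elim
    case (elim t)
    show ?case
    proof
      fix v assume v: "v \<in> X1 \<Omega>"
      have "\<bar>du v t\<bar> \<le> 4 * K * jacobian_norm (u t) * jacobian_norm v" using elim(1) v by blast
      also have "\<dots> \<le> 4 * K * norm_X1 \<Omega> (u t) * norm_X1 \<Omega> v"
        using K v elim(2) by (intro mult_mono mult_nonneg_nonneg jacobian_norm_le_norm_X1 jacobian_norm_nonneg norm_X1_nonneg) auto
      finally show "\<bar>du v t\<bar> \<le> 4 * K * norm_X1 \<Omega> (u t) * norm_X1 \<Omega> v" .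
    qed
  qed
  have G: "integrable ?L (\<lambda>t. - (\<alpha> / (C + 1)) * deviation t)"
    using deviation_continuous by (intro continuous_imp_integrable_real continuous_intros)
  have "energy b - energy a \<le> 2 * (LINT t|lebesgue_on {a..b}. - (\<alpha> / (C + 1)) * deviation t)"
  proof (rule energy_inequality[where V = "X1 \<Omega>" and \<Gamma> = pairing and F = du and u = u and s = s
        and N = "norm_X1 \<Omega>" and n = "\<lambda>t. 4 * K * norm_X1 \<Omega> (u t)" and T = T])
    show "energy t - energy r \<le> 2 * (pairing (u t) t - pairing (u t) r)" if "t \<in> {0..T}" "r \<in> {0..T}" for t r
      using that by (rule energy_difference_le)
  qed (rule ab s energy_continuous X1_diff(1) pairing_diff pairing_primitive F_bound AE_du_diff n
        norm_X1_nonneg AE_u_X1 G AE_du_u_le | assumption)+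
  then show ?thesis
    using deviation_eq_energy[of a] deviation_eq_energy[of b] ab by simp
qed

end

section \<open>From integrated decay to the limit\<close>

theorem lemma7:
  fixes \<Omega> :: "(real^2) set" and D :: "real^2 \<Rightarrow> real^2^2"
    and u0 :: "real^2 \<Rightarrow> real^2" and u :: "real \<Rightarrow> real^2 \<Rightarrow> real^2"
  assumes domain: "lipschitz_domain \<Omega>"
    and H1: "\<And>T. T > 0 \<Longrightarrow> uniformly_elliptic \<Omega> T D"
    and H2: "\<And>T. T > 0 \<Longrightarrow> lipschitz_coefficients \<Omega> T D"
    and H3: "\<And>T. T > 0 \<Longrightarrow> bounded_coefficients \<Omega> T D"
    and u0: "u0 \<in> X1 \<Omega>"
    and u: "global_weak_solution \<Omega> D u0 u"
    and zero: "\<And>t. t \<ge> 0 \<Longrightarrow> AE x in lebesgue_on \<Omega>. scale_space \<Omega> D t (\<lambda>x. 0) x = 0"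
    and shift: "\<And>C t. t \<ge> 0 \<Longrightarrow>
      AE x in lebesgue_on \<Omega>. scale_space \<Omega> D t (\<lambda>x. u0 x + C) x = scale_space \<Omega> D t u0 x + C"
  shows "((\<lambda>t. norm_X0 \<Omega> (\<lambda>x. u t x - mean_vec \<Omega> u0)) \<longlongrightarrow> 0) at_top"
proof -
  interpret bounded_open_domain \<Omega>
    using domain by unfold_locales (auto simp: lipschitz_domain_def)
  obtain p where p: "p \<in> closure \<Omega>"
    using domain closure_subset by (fastforce simp: lipschitz_domain_def)
  obtain \<alpha> where \<alpha>: "\<alpha> > 0" and "\<forall>u :: real \<Rightarrow> real^2 \<Rightarrow> real^2. \<forall>\<xi>. \<forall>x\<in>closure \<Omega>. \<forall>t\<in>{0..1}.
      \<xi> \<bullet> (D (u t x) *v \<xi>) \<ge> \<alpha> * (norm \<xi>)\<^sup>2"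
    using H1[of 1] unfolding uniformly_elliptic_def by auto
  \<comment> \<open>Functions with constant value \<open>z\<close>, evaluated at one point of the
    closure, turn the hypothesis into a statement about all \<open>z\<close> in the plane. The other
    two coefficient bounds are obtained in the same way.\<close>
  from this(2)[rule_format, OF p, where u = "\<lambda>_ _. z" and t = 0 for z]
  have elliptic: "\<xi> \<bullet> (D z *v \<xi>) \<ge> \<alpha> * (norm \<xi>)\<^sup>2" for z \<xi> by simp
  obtain L where "\<forall>(u :: real \<Rightarrow> real^2 \<Rightarrow> real^2) v. \<forall>x\<in>closure \<Omega>. \<forall>t\<in>{0..1}. \<forall>i j.
      \<bar>D (v t x) $ i $ j - D (u t x) $ i $ j\<bar> \<le> L * norm (v t x - u t x)"
    using H2[of 1] unfolding lipschitz_coefficients_def by auto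
  from this[rule_format, OF p, where u = "\<lambda>_ _. z" and v = "\<lambda>_ _. z'" and t = 0 for z z']
  have lip: "\<bar>D z' $ i $ j - D z $ i $ j\<bar> \<le> L * norm (z' - z)" for z z' i j by simp
  obtain K where "\<forall>u :: real \<Rightarrow> real^2 \<Rightarrow> real^2. \<forall>x\<in>closure \<Omega>. \<forall>t\<in>{0..1}. \<forall>i j. \<bar>D (u t x) $ i $ j\<bar> \<le> K"
    using H3[of 1] unfolding bounded_coefficients_def by auto
  from this[rule_format, OF p, where u = "\<lambda>_ _. z" and t = 0 for z]
  have bnd: "\<bar>D z $ i $ j\<bar> \<le> K" for z i j by simp
  obtain C where C: "C \<ge> 0" "\<forall>v\<in>X1 \<Omega>. (LINT x|M. (norm (v x - mean_vec \<Omega> v))\<^sup>2) \<le>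
      C * (LINT x|M. (norm (jacobian \<Omega> v x))\<^sup>2)"
    using poincare_inequality_X1[OF domain] by blast
  define \<psi> where "\<psi> t = (LINT x|M. (norm (u t x - mean_vec \<Omega> u0))\<^sup>2)" for t
  define \<kappa> where "\<kappa> = 2 * (\<alpha> / (C + 1))"
  have \<kappa>: "\<kappa> > 0" using \<alpha> C by (simp add: \<kappa>_def)
  have \<psi>0: "\<psi> t \<ge> 0" for t by (simp add: \<psi>_def)
  \<comment> \<open>\<open>\<psi>\<close> and \<open>\<kappa>\<close> are fixed before the horizon,
    so the estimates for different horizons concern one function with one rate.\<close>
  have sol: "square_integrable M (u T) \<and> continuous_on {0..T} \<psi> \<and>
      (\<forall>a b. 0 < a \<longrightarrow> a \<le> b \<longrightarrow> b \<le> T \<longrightarrow> \<psi> b - \<psi> a \<le> - \<kappa> * (LINT t|lebesgue_on {a..b}. \<psi> t))"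
    if T: "T > 0" for T
  proof -
    have w: "weak_solution \<Omega> D T u0 u" using u T by (simp add: global_weak_solution_def)
    then obtain ut vt where "time_derivative \<Omega> T (\<lambda>t x. u t x $ 1) ut" "time_derivative \<Omega> T (\<lambda>t x. u t x $ 2) vt"
      "AE t in lebesgue_on {0..T}. \<forall>w\<in>X1 \<Omega>.
         ut t (\<lambda>x. w x $ 1) + vt t (\<lambda>x. w x $ 2) +
         (LINT x|M. trace (transpose (jacobian \<Omega> w x) ** D (u t x) ** jacobian \<Omega> (u t) x)) = 0"
      unfolding weak_solution_def by blast
    then interpret S: cross_diffusion_solution \<Omega> D \<alpha> L K C T u0 u ut vt
      using w \<alpha> C T elliptic lip bnd u0 by unfold_locales (auto simp: weak_solution_def)
    have "\<psi> = S.deviation" by (simp add: \<psi>_def S.deviation_def fun_eq_iff)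
    then show ?thesis
      using S.u_square_integrable[of T] S.deviation_continuous S.deviation_decay T by (simp add: \<kappa>_def)
  qed
  have decay: "\<psi> b \<le> \<psi> a - \<kappa> * (LINT t|lebesgue_on {a..b}. \<psi> t)" if "0 < a" "a \<le> b" for a b
    using sol[of b] that by force
  have anti: "\<psi> b \<le> \<psi> a" if "0 < a" "a \<le> b" for a b
  proof -
    have "\<kappa> * (LINT t|lebesgue_on {a..b}. \<psi> t) \<ge> 0" using \<kappa> \<psi>0 by (intro mult_nonneg_nonneg) auto
    then show ?thesis using decay[OF that] by linarith
  qed
  have bound: "\<psi> b \<le> \<psi> 1 / (1 + \<kappa> * (b - 1))" if b: "1 \<le> b" for b
  proof -
    \<comment> \<open>The estimates start at positive times; 1 is an arbitrary starting point. On
      \<open>{1..b}\<close> the final value \<open>\<psi> b\<close> is the smallest, so the integral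
      is at least \<open>(b - 1) * \<psi> b\<close>.\<close>
    have "continuous_on {1..b} \<psi>" using sol[of b] b by (auto intro: continuous_on_subset)
    then have "(LINT t|lebesgue_on {1..b}. \<psi> b) \<le> (LINT t|lebesgue_on {1..b}. \<psi> t)"
      using anti by (intro integral_mono continuous_imp_integrable_real) auto
    then have "(b - 1) * \<psi> b \<le> (LINT t|lebesgue_on {1..b}. \<psi> t)"
      using b by (simp add: measure_restrict_space)
    then have "\<kappa> * ((b - 1) * \<psi> b) \<le> \<kappa> * (LINT t|lebesgue_on {1..b}. \<psi> t)"
      using \<kappa> by (intro mult_left_mono) auto
    then have "\<psi> b * (1 + \<kappa> * (b - 1)) \<le> \<psi> 1"
      using decay[of 1 b] b by (simp add: algebra_simps)
    moreover have "1 + \<kappa> * (b - 1) > 0" using \<kappa> b by (simp add: add_pos_nonneg)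
    ultimately show ?thesis by (simp add: pos_le_divide_eq)
  qed
  have "filterlim (\<lambda>b. 1 + \<kappa> * (b - 1)) at_top at_top"
  proof (intro filterlim_tendsto_add_at_top[OF tendsto_const] filterlim_tendsto_pos_mult_at_top[OF tendsto_const \<kappa>])
    show "filterlim (\<lambda>b :: real. b - 1) at_top at_top"
      unfolding filterlim_at_top
    proof
      fix Z :: real
      show "\<forall>\<^sub>F b in at_top. Z \<le> b - 1"
        using eventually_ge_at_top[of "Z + 1"] by eventually_elim simp
    qed
  qed
  then have "((\<lambda>b. \<psi> 1 / (1 + \<kappa> * (b - 1))) \<longlongrightarrow> 0) at_top"
    by (intro tendsto_divide_0[OF tendsto_const] filterlim_at_top_imp_at_infinity)
  then have "(\<psi> \<longlongrightarrow> 0) at_top"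
    by (rule tendsto_sandwich[OF _ _ tendsto_const, rotated 2])
       (use \<psi>0 bound in \<open>auto intro: eventually_at_top_linorderI[of 1]\<close>)
  then have "((\<lambda>t. sqrt (\<psi> t)) \<longlongrightarrow> sqrt 0) at_top" by (rule tendsto_real_sqrt)
  then have lim: "((\<lambda>t. sqrt (\<psi> t)) \<longlongrightarrow> 0) at_top" by simp
  have norm_eq: "norm_X0 \<Omega> (\<lambda>x. u t x - mean_vec \<Omega> u0) = sqrt (\<psi> t)" if "t > 0" for t
  proof -
    have "(\<lambda>x. u t x - mean_vec \<Omega> u0) \<in> X0 \<Omega>"
      using square_integrable_diff[OF conjunct1[OF sol[OF that]] square_integrable_const[of "mean_vec \<Omega> u0"]]
      by (simp add: X0_iff)
    then show ?thesis by (simp add: norm_X0_eq \<psi>_def)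
  qed
  have "\<forall>\<^sub>F t in at_top. sqrt (\<psi> t) = norm_X0 \<Omega> (\<lambda>x. u t x - mean_vec \<Omega> u0)"
    using eventually_gt_at_top[of 0] by eventually_elim (simp add: norm_eq)
  with lim show ?thesis by (rule Lim_transform_eventually)
qed

end
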